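(* Let $X=(X,\mathrm{d},\mu)$ be a metric measure space admitting a strong measured differentiable structure. Then every metric $k$-current $T$ on $X$ of locally finite mass with $\|T\|\ll\mu$ is a $k$-precurrent.
   Context: Metric spaces are separable and locally compact. A metric $k$-current is a map $T(f\,dg^1\wedge\dots\wedge dg^k)$ on $\mathrm{Lip}_c(X)\times\mathrm{Lip}_{loc}(X)^k$ which is linear in each argument, sequentially continuous (where $f_i\to f$ in $\mathrm{Lip}_c$ means pointwise convergence with uniformly bounded Lipschitz constants and supports in a fixed compact set, and $g_i\to g$ in $\mathrm{Lip}_{loc}$ means pointwise convergence with uniformly bounded Lipschitz constants on each compact set), and vanishes when some $g^i$ is constant on $\mathrm{supp} f$. Mass $\|T\|(U)$ for $U$ open is $\sup T(\sum_s f_s\,dg^1_s\wedge\dots\wedge dg^k_s)$ over finite sums with $\mathrm{supp} f_s\subset U$, $\sum_s|f_s|\le 1$, each $g^i_s$ $1$-Lipschitz on $\mathrm{supp} f_s$, extended to all sets by outer regularity; locally finite mass means $\|T\|(K)<\infty$ for compact $K$. Such $T$ extends to forms $\beta\,dg^1\wedge\dots\wedge dg^k$ with $\beta$ bounded Borel with compact support (limit along $\mathrm{Lip}_c$ approximations of $\beta$ in $L^1(\|T\|)$), and $T\llcorner Y(\beta\,dg^1\wedge\dots)=T(\mathbf 1_Y\beta\,dg^1\wedge\dots)$. Coordinate patch $(Y,\pi)$: $Y\subseteq X$ measurable, $\pi\colon Y\to\mathbb{E}$ Lipschitz into a Euclidean space such that every (locally) Lipschitz $g$ has, on a set $Y_g\subseteq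 Y$ of full $\mu$-measure, a unique measurable differential $y\mapsto d^\pi g_y\in\mathbb{E}^*$ with $g(x)=g(y)+\langle d^\pi g_y,\pi(x)-\pi(y)\rangle+o(\mathrm{d}(x,y))$ as $x\to y$; a strong measured differentiable structure is a covering of $X$ by countably many coordinate patches. A map $T$ on $\{\beta\,dg^1\wedge\dots\wedge dg^k:\beta\text{ bounded Borel compactly supported}, g^i\in\mathrm{Lip}_{loc}(X)\}$, linear in each argument, is a $k$-precurrent on the patch $(Y,\pi)$ if there is a locally $\mu$-integrable map $\hat\lambda\colon Y\to\bigwedge^k\mathbb{E}$ with $T(\beta\,dg^1\wedge\dots\wedge dg^k)=\int_Y\langle\beta\,d^\pi g^1\wedge\dots\wedge d^\pi g^k,\hat\lambda\rangle\,d\mu$ for all such forms; $T$ is a $k$-precurrent if $T\llcorner Y$ is a $k$-precurrent on $Y$ for every coordinate patch $(Y,\pi)$. *)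

theory Defs
  imports "HOL-Analysis.Analysis"
begin

definition fsupp :: "('a::metric_space \<Rightarrow> real) \<Rightarrow> 'a set" where
  "fsupp f = closure {x. f x \<noteq> 0}"

definition lipc :: "('a::metric_space \<Rightarrow> real) \<Rightarrow> bool" where
  "lipc f \<longleftrightarrow> (\<exists>C. C-lipschitz_on UNIV f) \<and> compact (fsupp f)"

definition liploc :: "('a::metric_space \<Rightarrow> real) \<Rightarrow> bool" where
  "liploc g \<longleftrightarrow> (\<forall>K. compact K \<longrightarrow> (\<exists>C. C-lipschitz_on K g))"

text \<open>A k-tuple (g^1,...,g^k) of locally Lipschitz functions, stored as g 0, ..., g (k-1);
  the unused entries are normalised to 0.\<close>
definition ktuple :: "nat \<Rightarrow> (nat \<Rightarrow> 'a::metric_space \<Rightarrow> real) \<Rightarrow> bool" where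
  "ktuple k g \<longleftrightarrow> (\<forall>i<k. liploc (g i)) \<and> (\<forall>i\<ge>k. g i = (\<lambda>_. 0))"

definition lipc_conv :: "(nat \<Rightarrow> 'a::metric_space \<Rightarrow> real) \<Rightarrow> ('a \<Rightarrow> real) \<Rightarrow> bool" where
  "lipc_conv fs f \<longleftrightarrow> (\<forall>x. (\<lambda>j. fs j x) \<longlonglongrightarrow> f x)
     \<and> (\<exists>C. \<forall>j. C-lipschitz_on UNIV (fs j))
     \<and> (\<exists>K. compact K \<and> (\<forall>j. fsupp (fs j) \<subseteq> K))"

definition liploc_conv :: "(nat \<Rightarrow> 'a::metric_space \<Rightarrow> real) \<Rightarrow> ('a \<Rightarrow> real) \<Rightarrow> bool" where
  "liploc_conv gs g \<longleftrightarrow> (\<forall>x. (\<lambda>j. gs j x) \<longlonglongrightarrow> g x)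
     \<and> (\<forall>K. compact K \<longrightarrow> (\<exists>C. \<forall>j. C-lipschitz_on K (gs j)))"

text \<open>A map T(f dg^1 ... dg^k) is modelled as T f g.\<close>
definition metric_current ::
  "nat \<Rightarrow> (('a::metric_space \<Rightarrow> real) \<Rightarrow> (nat \<Rightarrow> 'a \<Rightarrow> real) \<Rightarrow> real) \<Rightarrow> bool" where
  "metric_current k T \<longleftrightarrow>
     (\<forall>f1 f2 g a b. lipc f1 \<and> lipc f2 \<and> ktuple k g \<longrightarrow>
        T (\<lambda>x. a * f1 x + b * f2 x) g = a * T f1 g + b * T f2 g)
   \<and> (\<forall>f g i h1 h2 a b. lipc f \<and> ktuple k g \<and> i < k \<and> liploc h1 \<and> liploc h2 \<longrightarrow>
        T f (g(i := (\<lambda>x. a * h1 x + b * h2 x))) = a * T f (g(i := h1)) + b * T f (g(i := h2)))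
   \<and> (\<forall>fs f gs g. (\<forall>j. lipc (fs j)) \<and> lipc f \<and> lipc_conv fs f
        \<and> (\<forall>j. ktuple k (gs j)) \<and> ktuple k g \<and> (\<forall>i<k. liploc_conv (\<lambda>j. gs j i) (g i))
        \<longrightarrow> (\<lambda>j. T (fs j) (gs j)) \<longlonglongrightarrow> T f g)
   \<and> (\<forall>f g i. lipc f \<and> ktuple k g \<and> i < k \<and> (\<exists>c. \<forall>x\<in>fsupp f. g i x = c) \<longrightarrow> T f g = 0)"

definition mass_open ::
  "nat \<Rightarrow> (('a::metric_space \<Rightarrow> real) \<Rightarrow> (nat \<Rightarrow> 'a \<Rightarrow> real) \<Rightarrow> real) \<Rightarrow> 'a set \<Rightarrow> ennreal" where
  "mass_open k T U =
     (SUP p \<in> {(N :: nat, fs :: nat \<Rightarrow> 'a \<Rightarrow> real, gs :: nat \<Rightarrow> nat \<Rightarrow> 'a \<Rightarrow> real). (\<forall>s<N. lipc (fs s) \<and> fsupp (fs s) \<subseteq> U \<and> ktuple k (gs s)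
                              \<and> (\<forall>i<k. (1::real)-lipschitz_on (fsupp (fs s)) (gs s i)))
                           \<and> (\<forall>x. (\<Sum>s<N. \<bar>fs s x\<bar>) \<le> 1)}.
        case p of (N, fs, gs) \<Rightarrow> ennreal (\<Sum>s<N. T (fs s) (gs s)))"

definition mass_set ::
  "nat \<Rightarrow> (('a::metric_space \<Rightarrow> real) \<Rightarrow> (nat \<Rightarrow> 'a \<Rightarrow> real) \<Rightarrow> real) \<Rightarrow> 'a set \<Rightarrow> ennreal" where
  "mass_set k T A = (INF U \<in> {U. open U \<and> A \<subseteq> U}. mass_open k T U)"

definition mass_measure ::
  "nat \<Rightarrow> (('a::metric_space \<Rightarrow> real) \<Rightarrow> (nat \<Rightarrow> 'a \<Rightarrow> real) \<Rightarrow> real) \<Rightarrow> 'a measure" where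
  "mass_measure k T = measure_of UNIV (sets borel) (mass_set k T)"

definition locally_finite_mass ::
  "nat \<Rightarrow> (('a::metric_space \<Rightarrow> real) \<Rightarrow> (nat \<Rightarrow> 'a \<Rightarrow> real) \<Rightarrow> real) \<Rightarrow> bool" where
  "locally_finite_mass k T \<longleftrightarrow> (\<forall>K. compact K \<longrightarrow> mass_set k T K < \<infinity>)"

definition bborel_c :: "('a::metric_space \<Rightarrow> real) \<Rightarrow> bool" where
  "bborel_c \<beta> \<longleftrightarrow> \<beta> \<in> borel_measurable borel \<and> bounded (range \<beta>)
     \<and> (\<exists>K. compact K \<and> {x. \<beta> x \<noteq> 0} \<subseteq> K)"

definition current_ext ::
  "nat \<Rightarrow> (('a::metric_space \<Rightarrow> real) \<Rightarrow> (nat \<Rightarrow> 'a \<Rightarrow> real) \<Rightarrow> real)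
     \<Rightarrow> ('a \<Rightarrow> real) \<Rightarrow> (nat \<Rightarrow> 'a \<Rightarrow> real) \<Rightarrow> real" where
  "current_ext k T \<beta> g = (THE L. \<forall>fs. (\<forall>j. lipc (fs j))
       \<and> (\<exists>K. compact K \<and> (\<forall>j. fsupp (fs j) \<subseteq> K))
       \<and> ((\<lambda>j. \<integral>\<^sup>+ x. ennreal \<bar>fs j x - \<beta> x\<bar> \<partial>(mass_measure k T)) \<longlonglongrightarrow> 0)
       \<longrightarrow> (\<lambda>j. T (fs j) g) \<longlonglongrightarrow> L)"

text \<open>The Euclidean space E is R^n, its points and covectors are represented as
  nat \<Rightarrow> real, only coordinates i < n being relevant.\<close>
definition eucl_dist :: "nat \<Rightarrow> (nat \<Rightarrow> real) \<Rightarrow> (nat \<Rightarrow> real) \<Rightarrow> real" where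
  "eucl_dist n v w = sqrt (\<Sum>i<n. (v i - w i)\<^sup>2)"

definition is_pi_diff ::
  "'a::metric_space set \<Rightarrow> ('a \<Rightarrow> nat \<Rightarrow> real) \<Rightarrow> nat \<Rightarrow> ('a \<Rightarrow> real) \<Rightarrow> 'a \<Rightarrow> (nat \<Rightarrow> real) \<Rightarrow> bool" where
  "is_pi_diff Y \<pi> n g y w \<longleftrightarrow> (\<forall>i\<ge>n. w i = 0) \<and>
     ((\<lambda>x. (g x - g y - (\<Sum>i<n. w i * (\<pi> x i - \<pi> y i))) / dist x y) \<longlongrightarrow> 0) (at y within Y)"

definition dpi ::
  "'a::metric_space set \<Rightarrow> ('a \<Rightarrow> nat \<Rightarrow> real) \<Rightarrow> nat \<Rightarrow> ('a \<Rightarrow> real) \<Rightarrow> 'a \<Rightarrow> nat \<Rightarrow> real" where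
  "dpi Y \<pi> n g y = (if \<exists>!w. is_pi_diff Y \<pi> n g y w then THE w. is_pi_diff Y \<pi> n g y w else (\<lambda>_. 0))"

definition coord_patch :: "'a::metric_space measure \<Rightarrow> 'a set \<Rightarrow> ('a \<Rightarrow> nat \<Rightarrow> real) \<Rightarrow> nat \<Rightarrow> bool" where
  "coord_patch \<mu> Y \<pi> n \<longleftrightarrow> Y \<in> sets \<mu>
     \<and> (\<exists>C. \<forall>x\<in>Y. \<forall>y\<in>Y. eucl_dist n (\<pi> x) (\<pi> y) \<le> C * dist x y)
     \<and> (\<forall>g. liploc g \<longrightarrow>
          (\<exists>Yg. Yg \<subseteq> Y \<and> Yg \<in> sets \<mu> \<and> emeasure \<mu> (Y - Yg) = 0
               \<and> (\<forall>y\<in>Yg. \<exists>!w. is_pi_diff Y \<pi> n g y w))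
          \<and> (\<forall>i<n. (\<lambda>y. indicator Y y * dpi Y \<pi> n g y i) \<in> borel_measurable \<mu>))"

definition strong_mds :: "'a::metric_space measure \<Rightarrow> bool" where
  "strong_mds \<mu> \<longleftrightarrow> (\<exists>(Ys :: nat \<Rightarrow> 'a set) \<pi>s ns. (\<forall>j. coord_patch \<mu> (Ys j) (\<pi>s j) (ns j))
                         \<and> (\<Union>j. Ys j) = UNIV)"

definition kdet :: "nat \<Rightarrow> (nat \<Rightarrow> nat \<Rightarrow> real) \<Rightarrow> real" where
  "kdet k M = (\<Sum>\<sigma>\<in>{\<sigma>. \<sigma> permutes {..<k}}. of_int (sign \<sigma>) * (\<Prod>a<k. M a (\<sigma> a)))"

text \<open>k-vectors in R^n: coefficients lam I w.r.t. the basis e_I, I a k-subset of {..<n}.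
  Pairing of w^1 wedge ... wedge w^k with lam.\<close>
definition wedge_pair :: "nat \<Rightarrow> nat \<Rightarrow> (nat \<Rightarrow> nat \<Rightarrow> real) \<Rightarrow> (nat set \<Rightarrow> real) \<Rightarrow> real" where
  "wedge_pair k n \<omega> lam = (\<Sum>I\<in>{I. I \<subseteq> {..<n} \<and> card I = k}.
       lam I * kdet k (\<lambda>a b. \<omega> a (sorted_list_of_set I ! b)))"

definition multilinear_on ::
  "nat \<Rightarrow> (('a \<Rightarrow> real) \<Rightarrow> bool) \<Rightarrow> (('a \<Rightarrow> real) \<Rightarrow> bool)
     \<Rightarrow> (('a \<Rightarrow> real) \<Rightarrow> (nat \<Rightarrow> 'a \<Rightarrow> real) \<Rightarrow> real) \<Rightarrow> bool" where
  "multilinear_on k D1 D2 S \<longleftrightarrow>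
     (\<forall>f1 f2 g a b. D1 f1 \<and> D1 f2 \<and> (\<forall>i<k. D2 (g i)) \<and> (\<forall>i\<ge>k. g i = (\<lambda>_. 0)) \<longrightarrow>
        S (\<lambda>x. a * f1 x + b * f2 x) g = a * S f1 g + b * S f2 g)
   \<and> (\<forall>f g i h1 h2 a b. D1 f \<and> (\<forall>i<k. D2 (g i)) \<and> (\<forall>i\<ge>k. g i = (\<lambda>_. 0)) \<and> i < k \<and> D2 h1 \<and> D2 h2 \<longrightarrow>
        S f (g(i := (\<lambda>x. a * h1 x + b * h2 x))) = a * S f (g(i := h1)) + b * S f (g(i := h2)))"

definition precurrent_on ::
  "'a::metric_space measure \<Rightarrow> nat \<Rightarrow> (('a \<Rightarrow> real) \<Rightarrow> (nat \<Rightarrow> 'a \<Rightarrow> real) \<Rightarrow> real)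
     \<Rightarrow> 'a set \<Rightarrow> ('a \<Rightarrow> nat \<Rightarrow> real) \<Rightarrow> nat \<Rightarrow> bool" where
  "precurrent_on \<mu> k S Y \<pi> n \<longleftrightarrow> multilinear_on k bborel_c liploc S \<and>
     (\<exists>lam :: 'a \<Rightarrow> nat set \<Rightarrow> real.
        (\<forall>I K. compact K \<longrightarrow> set_integrable \<mu> (Y \<inter> K) (\<lambda>y. lam y I))
      \<and> (\<forall>\<beta> g. bborel_c \<beta> \<and> ktuple k g \<longrightarrow>
           S \<beta> g = (\<integral>y\<in>Y. \<beta> y * wedge_pair k n (\<lambda>a. dpi Y \<pi> n (g a) y) (lam y) \<partial>\<mu>)))"

definition precurrent ::
  "'a::metric_space measure \<Rightarrow> nat \<Rightarrow> (('a \<Rightarrow> real) \<Rightarrow> (nat \<Rightarrow> 'a \<Rightarrow> real) \<Rightarrow> real) \<Rightarrow> bool" where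
  "precurrent \<mu> k S \<longleftrightarrow> (\<forall>Y \<pi> n. coord_patch \<mu> Y \<pi> n \<longrightarrow>
       precurrent_on \<mu> k (\<lambda>\<beta> g. S (\<lambda>x. indicator Y x * \<beta> x) g) Y \<pi> n)"

end

theory Submission
  imports Defs
begin

text \<open>
  The mass of T is a Borel measure m (Caratheodory), and a layer-cake argument gives
  \<open>\<bar>T f g\<bar> \<le> (\<Prod>i. Lip (g i)) * (\<integral> \<bar>f\<bar> \<partial>m)\<close>. Hence for each tuple g the functional \<open>f \<mapsto> T f g\<close> has a locally bounded
  density H g with respect to m. Strict locality (H g vanishes a.e. where some g i is constant) improves the
  estimate to \<open>\<bar>H g\<bar> \<le> (\<Prod>i. Lip (g i restricted to B))\<close> a.e. on any Borel set B. On a coordinate patch, Y is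
  covered by countably many sets on which \<open>g a - q \<cdot> \<pi>\<close> has a small Lipschitz constant for a rational covector q
  close to the differential of g a; therefore \<open>H g = (\<Sum>i. (d g a) i * H (g(a := \<pi> i)))\<close> a.e. on Y. Iterating over all
  entries and using alternation, H g is the pairing of the wedge product of the differentials with the k-vector
  of the densities of the coordinate tuples. The Radon-Nikodym derivative of m turns this into the
  representation with respect to \<open>\<mu>\<close>.
\<close>

section \<open>Lipschitz functions\<close>

text \<open>The axioms give locality and continuity only when tested on Lipschitz functions, whereas
  a patch, the sets where a first order expansion is uniform, and the null sets of a differential
  are at best Borel. This is why everything is moved from \<open>T\<close> to densities: a density
  may be restricted to any Borel set, and identities that hold almost everywhere on countably many
  pieces may be glued. The price is that weak limits must respect vanishing on Borel sets. They do
  because all densities of a sequence are bounded on each \<open>V j\<close> by one product of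
  Lipschitz constants, so they can be tested on indicators through L1 approximation. The small
  factor in the chain rule comes from the product form of the bound: one entry with a Lipschitz
  constant of order \<epsilon> makes the whole product small, while the other constants stay fixed
  on \<open>V J\<close>. The coordinates of a patch are controlled on Y only, so they are first
  extended to all of X; the differential is a limit within Y and does not see the extension.\<close>

lemma fsupp_minimal: "closed C \<Longrightarrow> {x. f x \<noteq> 0} \<subseteq> C \<Longrightarrow> fsupp f \<subseteq> C"
  by (simp add: fsupp_def closure_minimal)

lemma subset_fsupp: "{x. f x \<noteq> 0} \<subseteq> fsupp f"
  by (simp add: fsupp_def closure_subset)

lemma fsupp_mono: "(\<And>x. f x \<noteq> 0 \<Longrightarrow> g x \<noteq> 0) \<Longrightarrow> fsupp f \<subseteq> fsupp g"
  unfolding fsupp_def by (rule closure_mono) auto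

lemma lipcI:
  assumes "C-lipschitz_on UNIV f" "compact K" "{x. f x \<noteq> 0} \<subseteq> K"
  shows "lipc f"
proof -
  have "fsupp f \<subseteq> K"
    using assms fsupp_minimal compact_imp_closed by blast
  then have "compact (fsupp f)"
    using assms(2) by (metis closed_closure compact_Int_closed fsupp_def inf.absorb_iff2)
  then show ?thesis
    using assms(1) unfolding lipc_def by blast
qed

lemma lipc_continuous: "lipc f \<Longrightarrow> continuous_on UNIV f"
  unfolding lipc_def using lipschitz_on_continuous_on by blast

lemma lipc_bounded:
  assumes "lipc f"
  obtains B where "B > 0" "\<And>x. \<bar>f x\<bar> \<le> B"
proof -
  have "bounded (f ` fsupp f)"
    using assms lipc_continuous[OF assms]
    by (meson UNIV_I compact_continuous_image compact_imp_bounded continuous_on_subset lipc_def subsetI)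
  then obtain B where B: "B > 0" "\<And>x. x \<in> fsupp f \<Longrightarrow> \<bar>f x\<bar> \<le> B"
    by (metis bounded_pos imageI real_norm_def)
  have "\<bar>f x\<bar> \<le> B" for x
    using B subset_fsupp[of f] by (cases "f x = 0") auto
  with B(1) show ?thesis using that by blast
qed

lemma lipc_linear:
  assumes "lipc f" "lipc g"
  shows "lipc (\<lambda>x. a * f x + b * g x)"
proof -
  obtain C D where CD: "C-lipschitz_on UNIV f" "D-lipschitz_on UNIV g"
    using assms unfolding lipc_def by blast
  show ?thesis
  proof (rule lipcI)
    show "(\<bar>a\<bar> * C + \<bar>b\<bar> * D)-lipschitz_on UNIV (\<lambda>x. a * f x + b * g x)"
      using CD by (intro lipschitz_on_add lipschitz_on_cmult_real)
    show "compact (fsupp f \<union> fsupp g)"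
      using assms by (simp add: lipc_def compact_Un)
    show "{x. a * f x + b * g x \<noteq> 0} \<subseteq> fsupp f \<union> fsupp g"
      using subset_fsupp[of f] subset_fsupp[of g] by fastforce
  qed
qed

lemma lipc_cmult: "lipc f \<Longrightarrow> lipc (\<lambda>x. c * f x)"
  using lipc_linear[of f f c 0] by simp

lemma lipc_add: "lipc f \<Longrightarrow> lipc g \<Longrightarrow> lipc (\<lambda>x. f x + g x)"
  using lipc_linear[of f g 1 1] by simp

lemma lipc_zero: "lipc (\<lambda>x. 0)"
  by (rule lipcI[of 0 _ "{}"]) (auto intro: lipschitz_onI)

lemma lipc_compose:
  fixes \<phi> :: "real \<Rightarrow> real"
  assumes "lipc f" "C-lipschitz_on UNIV \<phi>" "\<phi> 0 = 0"
  shows "lipc (\<lambda>x. \<phi> (f x))"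
proof -
  obtain D where D: "D-lipschitz_on UNIV f"
    using assms unfolding lipc_def by blast
  show ?thesis
  proof (rule lipcI)
    show "(C * D)-lipschitz_on UNIV (\<lambda>x. \<phi> (f x))"
      using lipschitz_on_compose2[OF D lipschitz_on_subset[OF assms(2)]] by auto
    show "compact (fsupp f)"
      using assms by (simp add: lipc_def)
    show "{x. \<phi> (f x) \<noteq> 0} \<subseteq> fsupp f"
      using subset_fsupp[of f] assms(3) by fastforce
  qed
qed

lemma lipschitz_on_bounded_mult:
  fixes f g :: "'a::metric_space \<Rightarrow> real"
  assumes "C-lipschitz_on U f" "D-lipschitz_on U g" "\<And>x. x \<in> U \<Longrightarrow> \<bar>f x\<bar> \<le> A" "\<And>x. x \<in> U \<Longrightarrow> \<bar>g x\<bar> \<le> B"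
    "0 \<le> A" "0 \<le> B"
  shows "(A * D + B * C)-lipschitz_on U (\<lambda>x. f x * g x)"
proof (rule lipschitz_onI)
  fix x y assume xy: "x \<in> U" "y \<in> U"
  have "\<bar>f x * g x - f y * g y\<bar> = \<bar>f x * (g x - g y) + g y * (f x - f y)\<bar>"
    by (simp add: algebra_simps)
  also have "\<dots> \<le> \<bar>f x\<bar> * \<bar>g x - g y\<bar> + \<bar>g y\<bar> * \<bar>f x - f y\<bar>"
    by (metis abs_mult abs_triangle_ineq)
  also have "\<dots> \<le> A * (D * dist x y) + B * (C * dist x y)"
    using lipschitz_onD[OF assms(1) xy] lipschitz_onD[OF assms(2) xy] assms(3)[OF xy(1)] assms(4)[OF xy(2)] assms(5,6)
    by (intro add_mono mult_mono) (auto simp: dist_real_def)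
  finally show "dist (f x * g x) (f y * g y) \<le> (A * D + B * C) * dist x y"
    by (simp add: dist_real_def algebra_simps)
next
  show "0 \<le> A * D + B * C"
    using assms lipschitz_on_nonneg by (metis add_nonneg_nonneg mult_nonneg_nonneg)
qed

text \<open>The product estimate needs bounds on the values of both factors; compact support
  provides the one for f.\<close>

lemma lipc_mult:
  assumes "lipc f" "C-lipschitz_on UNIV \<phi>" "\<And>x. \<bar>\<phi> x\<bar> \<le> 1"
  shows "lipc (\<lambda>x. \<phi> x * f x)"
proof -
  obtain D where D: "D-lipschitz_on UNIV f"
    using assms unfolding lipc_def by blast
  obtain B where B: "B > 0" "\<And>x. \<bar>f x\<bar> \<le> B"
    using lipc_bounded[OF assms(1)] by blast
  show ?thesis
  proof (rule lipcI)
    show "(1 * D + B * C)-lipschitz_on UNIV (\<lambda>x. \<phi> x * f x)"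
      using assms D B by (intro lipschitz_on_bounded_mult) auto
    show "compact (fsupp f)"
      using assms by (simp add: lipc_def)
    show "{x. \<phi> x * f x \<noteq> 0} \<subseteq> fsupp f"
      using subset_fsupp[of f] by fastforce
  qed
qed

lemma lipschitz_on_max_real:
  fixes f g :: "'a::metric_space \<Rightarrow> real"
  assumes "C-lipschitz_on U f" "C-lipschitz_on U g"
  shows "C-lipschitz_on U (\<lambda>x. max (f x) (g x))" "C-lipschitz_on U (\<lambda>x. min (f x) (g x))"
proof -
  have *: "\<bar>max a b - max c d\<bar> \<le> e" "\<bar>min a b - min c d\<bar> \<le> e" if "\<bar>a - c\<bar> \<le> e" "\<bar>b - d\<bar> \<le> e" for a b c d e :: real
    using that by linarith+
  show "C-lipschitz_on U (\<lambda>x. max (f x) (g x))" "C-lipschitz_on U (\<lambda>x. min (f x) (g x))"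
    using assms unfolding lipschitz_on_def by (auto simp: dist_real_def intro!: *)
qed

lemma lipschitz_on_const_ge: "0 \<le> C \<Longrightarrow> C-lipschitz_on U (\<lambda>_. c)"
  by (auto intro: lipschitz_onI)

lemma liplocI: "C-lipschitz_on UNIV g \<Longrightarrow> liploc g"
  unfolding liploc_def by (meson lipschitz_on_subset subset_UNIV)

lemma liploc_const: "liploc (\<lambda>_. c)"
  by (rule liplocI[OF lipschitz_on_constant])

lemma liploc_linear:
  assumes "liploc f" "liploc g"
  shows "liploc (\<lambda>x. a * f x + b * g x)"
  unfolding liploc_def
proof (intro allI impI)
  fix K :: "'a set" assume "compact K"
  then obtain C D where CD: "C-lipschitz_on K f" "D-lipschitz_on K g"
    using assms unfolding liploc_def by meson
  have "(\<bar>a\<bar> * C + \<bar>b\<bar> * D)-lipschitz_on K (\<lambda>x. a * f x + b * g x)"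
    using CD by (intro lipschitz_on_add lipschitz_on_cmult_real)
  then show "\<exists>C. C-lipschitz_on K (\<lambda>x. a * f x + b * g x)" by blast
qed

lemma liploc_cmult: "liploc f \<Longrightarrow> liploc (\<lambda>x. c * f x)"
  using liploc_linear[of f f c 0] by simp

lemma liploc_add: "liploc f \<Longrightarrow> liploc g \<Longrightarrow> liploc (\<lambda>x. f x + g x)"
  using liploc_linear[of f g 1 1] by simp

lemma liploc_sum: "(\<And>i. i \<in> I \<Longrightarrow> liploc (f i)) \<Longrightarrow> liploc (\<lambda>x. \<Sum>i\<in>I. f i x)"
  by (induction I rule: infinite_finite_induct) (auto intro: liploc_add liploc_const)

lemma liploc_compose:
  fixes \<phi> :: "real \<Rightarrow> real"
  assumes "liploc f" "C-lipschitz_on UNIV \<phi>"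
  shows "liploc (\<lambda>x. \<phi> (f x))"
  unfolding liploc_def
proof (intro allI impI)
  fix K :: "'a set" assume "compact K"
  then obtain D where D: "D-lipschitz_on K f"
    using assms unfolding liploc_def by meson
  show "\<exists>C. C-lipschitz_on K (\<lambda>x. \<phi> (f x))"
    using lipschitz_on_compose2[OF D lipschitz_on_subset[OF assms(2)]] by auto
qed

lemma ktuple_upd: "ktuple k g \<Longrightarrow> i < k \<Longrightarrow> liploc u \<Longrightarrow> ktuple k (g(i := u))"
  unfolding ktuple_def by auto

lemma liploc_positive_constant:
  assumes "liploc g" "compact K"
  obtains C where "C > 0" "C-lipschitz_on K g"
proof -
  obtain C where "C-lipschitz_on K g"
    using assms unfolding liploc_def by blast
  then have "(max C 1)-lipschitz_on K g"
    by (rule lipschitz_on_mono) auto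
  then show ?thesis
    using that[of "max C 1"] by auto
qed

lemma liploc_conv_const: "liploc g \<Longrightarrow> liploc_conv (\<lambda>_. g) g"
  unfolding liploc_conv_def liploc_def by auto

lemma lipc_conv_const: "lipc f \<Longrightarrow> lipc_conv (\<lambda>_. f) f"
  unfolding lipc_conv_def lipc_def by auto

section \<open>Lipschitz extension and an exhaustion by relatively compact open sets\<close>

lemma lipschitz_extension_real:
  fixes g :: "'a::metric_space \<Rightarrow> real"
  assumes L: "L-lipschitz_on B g"
  obtains u where "L-lipschitz_on UNIV u" "\<And>x. x \<in> B \<Longrightarrow> u x = g x"
proof (cases "B = {}")
  case True
  then show ?thesis
    using that[of "\<lambda>_. 0"] lipschitz_on_nonneg[OF L] by (auto intro: lipschitz_on_const_ge)
next
  case False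
  have L0: "0 \<le> L" using lipschitz_on_nonneg[OF L] .
  \<comment> \<open>McShane's formula: the lower envelope of the cones of slope L with vertices on
    the graph of g over B. It keeps the constant L, so bounds on B become global bounds at no
    loss.\<close>
  define u where "u x = (INF y\<in>B. g y + L * dist x y)" for x
  obtain b where b: "b \<in> B" using False by blast
  \<comment> \<open>Every upward cone stays above the downward cone of the fixed point b, which
    bounds the infimum from below at each x.\<close>
  have low: "g b - L * dist x b \<le> g y + L * dist x y" if "y \<in> B" for x y
  proof -
    have "\<bar>g b - g y\<bar> \<le> L * dist b y"
      using lipschitz_onD[OF L b that] by (simp add: dist_real_def)
    also have "\<dots> \<le> L * (dist x b + dist x y)"
      using L0 by (intro mult_left_mono dist_triangle3)
    finally show ?thesis by (simp add: algebra_simps abs_le_iff)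
  qed
  have bdd: "bdd_below ((\<lambda>y. g y + L * dist x y) ` B)" for x
    by (rule bdd_belowI2) (rule low)
  have le: "u x \<le> u x' + L * dist x x'" for x x'
  proof -
    have "u x - L * dist x x' \<le> u x'"
      unfolding u_def[of x']
    proof (rule cINF_greatest[OF False])
      fix y assume y: "y \<in> B"
      have "u x \<le> g y + L * dist x y"
        unfolding u_def by (rule cINF_lower[OF bdd y])
      also have "\<dots> \<le> g y + L * (dist x x' + dist x' y)"
        using L0 by (intro add_left_mono mult_left_mono) (auto simp: dist_triangle)
      finally show "u x - L * dist x x' \<le> g y + L * dist x' y"
        by (simp add: algebra_simps)
    qed
    then show ?thesis by simp
  qed
  have "L-lipschitz_on UNIV u"
  proof (rule lipschitz_onI[OF _ L0])
    fix x y show "dist (u x) (u y) \<le> L * dist x y"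
      using le[of x y] le[of y x] by (simp add: dist_real_def dist_commute abs_le_iff)
  qed
  moreover have "u x = g x" if x: "x \<in> B" for x
  proof (rule antisym)
    show "u x \<le> g x"
      using cINF_lower[OF bdd x, of x] by (simp add: u_def)
    show "g x \<le> u x"
      unfolding u_def
    proof (rule cINF_greatest[OF False])
      fix y assume "y \<in> B"
      then show "g x \<le> g y + L * dist x y"
        using lipschitz_onD[OF L x] by (force simp: dist_real_def abs_le_iff)
    qed
  qed
  ultimately show ?thesis using that by blast
qed

lemma relatively_compact_exhaustion:
  assumes "\<exists>D :: ('a::metric_space) set. countable D \<and> closure D = UNIV"
    and "\<forall>x :: 'a::metric_space. \<exists>U K. open U \<and> compact K \<and> x \<in> U \<and> U \<subseteq> K"
  obtains V :: "nat \<Rightarrow> 'a::metric_space set"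
  where "\<And>j. open (V j)" "incseq V" "\<And>j. \<exists>K. compact K \<and> V j \<subseteq> K" "(\<Union>j. V j) = UNIV"
proof -
  obtain D :: "'a set" where D: "countable D" "closure D = UNIV" using assms(1) by blast
  \<comment> \<open>Balls with centre in the dense set and radius 1/(n + 1) that lie in a compact
    set: a countable family that replaces arbitrary neighbourhoods.\<close>
  define P where "P = {(d,n). d \<in> D \<and> (\<exists>K. compact K \<and> ball d (1 / real (Suc n)) \<subseteq> K)}"
  have cover: "\<exists>p\<in>P. x \<in> ball (fst p) (1 / real (Suc (snd p)))" for x
  proof -
    obtain U K where U: "open U" "compact K" "x \<in> U" "U \<subseteq> K"
      using assms(2) by blast
    then obtain e where e: "e > 0" "ball x e \<subseteq> U" using openE by blast
    \<comment> \<open>Half of e: a ball of this radius that contains x has its centre within e/2 of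
      x, hence stays inside \<open>ball x e\<close>.\<close>
    obtain n where n: "1 / real (Suc n) < e / 2"
      using e(1) by (metis half_gt_zero nat_approx_posE)
    obtain d where d: "d \<in> D" "dist d x < 1 / real (Suc n)"
      using D(2) closure_approachable[of x D] by (metis UNIV_I of_nat_0_less_iff zero_less_Suc zero_less_divide_1_iff)
    have "ball d (1 / real (Suc n)) \<subseteq> ball x e"
    proof
      fix y assume "y \<in> ball d (1 / real (Suc n))"
      then have "dist x y < e"
        using d(2) n dist_triangle3[of x y d] by (simp add: dist_commute)
      then show "y \<in> ball x e" by simp
    qed
    then have "(d, n) \<in> P" using d U e unfolding P_def by blast
    then show ?thesis using d(2) by (force simp: dist_commute)
  qed
  have P: "countable P" "P \<noteq> {}"
  proof -
    have "P \<subseteq> D \<times> UNIV" unfolding P_def by auto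
    then show "countable P" using D(1) by (meson countable_SIGMA countableI_type countable_subset)
    show "P \<noteq> {}" using cover by blast
  qed
  define W where "W i = ball (fst (from_nat_into P i)) (1 / real (Suc (snd (from_nat_into P i))))" for i
  have WK: "\<exists>K. compact K \<and> W i \<subseteq> K" for i
    using from_nat_into[OF P(2), of i] unfolding W_def P_def by (auto simp: case_prod_unfold)
  define V where "V j = (\<Union>i\<le>j. W i)" for j
  show ?thesis
  proof (rule that[of V])
    show "open (V j)" for j unfolding V_def W_def by auto
    show "incseq V" unfolding V_def incseq_def by fastforce
    show "\<exists>K. compact K \<and> V j \<subseteq> K" for j
    proof -
      obtain K where "\<And>i. compact (K i) \<and> W i \<subseteq> K i" using WK by metis
      then have "compact (\<Union>i\<le>j. K i) \<and> V j \<subseteq> (\<Union>i\<le>j. K i)"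
        unfolding V_def by blast
      then show ?thesis by blast
    qed
    show "(\<Union>j. V j) = UNIV"
    proof -
      have "\<exists>j. x \<in> V j" for x
      proof -
        obtain p where p: "p \<in> P" "x \<in> ball (fst p) (1 / real (Suc (snd p)))" using cover by blast
        then obtain i where "from_nat_into P i = p" using P by (meson from_nat_into_surj)
        then have "x \<in> W i" using p unfolding W_def by simp
        then show ?thesis unfolding V_def by blast
      qed
      then show ?thesis by blast
    qed
  qed
qed

section \<open>The mass measure\<close>

text \<open>A two-set partition of unity over K. The closed sets A and B are recorded because
  \<open>fsupp\<close> is a closure: a product with \<phi> has its support inside A, a product with
  1 - \<phi> inside B.\<close>

lemma lipschitz_cutoff:
  fixes K :: "'a::metric_space set"
  assumes K: "compact K" "K \<subseteq> U \<union> W" "open U" "open W"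
  obtains \<phi> :: "'a \<Rightarrow> real" and C A B where "C-lipschitz_on UNIV \<phi>" "\<And>x. 0 \<le> \<phi> x" "\<And>x. \<phi> x \<le> 1"
    "closed A" "{x. \<phi> x \<noteq> 0} \<subseteq> A" "K \<inter> A \<subseteq> U"
    "closed B" "{x. \<phi> x \<noteq> 1} \<subseteq> B" "K \<inter> B \<subseteq> W"
proof -
  \<comment> \<open>\<open>infdist\<close> to the empty set is 0 by convention, and there is no
    minimum over an empty set, so the degenerate cases use constant functions.\<close>
  consider "K - W = {}" | "K - U = {}" | "K - W \<noteq> {}" "K - U \<noteq> {}" by blast
  then show ?thesis
  proof cases
    case 1
    show ?thesis
      by (rule that[of 0 "\<lambda>_. 0" "{}" UNIV]) (use 1 in \<open>auto intro: lipschitz_on_constant\<close>)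
  next
    case 2
    show ?thesis
      by (rule that[of 0 "\<lambda>_. 1" UNIV "{}"]) (use 2 in \<open>auto intro: lipschitz_on_constant\<close>)
  next
    case 3
    define F where "F = K - W"
    have F: "closed F" "F \<noteq> {}"
      using 3 K by (auto simp: F_def compact_imp_closed closed_Diff)
    have "compact (K - U)" using K by (simp add: compact_diff)
    then obtain z where z: "z \<in> K - U" "\<And>y. y \<in> K - U \<Longrightarrow> infdist z F \<le> infdist y F"
      using continuous_attains_inf[OF _ 3(2), of "\<lambda>x. infdist x F"] continuous_on_infdist[OF continuous_on_id]
      by blast
    define \<delta> where "\<delta> = infdist z F"
    have "z \<notin> F" using z K by (auto simp: F_def)
    then have d: "\<delta> > 0" unfolding \<delta>_def using F infdist_pos_not_in_closed by blast
    \<comment> \<open>Equal to 1 up to distance \<delta>/3 from F and to 0 beyond 2\<delta>/3, where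
      \<delta> is the distance from F to K - U. The remaining margins keep A away from K - U and B
      away from F.\<close>
    define \<phi> where "\<phi> x = max 0 (min 1 (2 - (3 / \<delta>) * infdist x F))" for x
    have "(3/\<delta>)-lipschitz_on UNIV (\<lambda>x. 2 - (3 / \<delta>) * infdist x F)"
    proof (rule lipschitz_onI)
      fix x y
      have "\<bar>(3/\<delta>) * (infdist x F - infdist y F)\<bar> \<le> 3/\<delta> * dist x y"
        unfolding abs_mult using d infdist_triangle_abs[of x F y] by (intro mult_mono) auto
      then show "dist (2 - 3 / \<delta> * infdist x F) (2 - 3 / \<delta> * infdist y F) \<le> 3 / \<delta> * dist x y"
        by (simp add: dist_real_def algebra_simps abs_minus_commute)
    qed (use d in auto)
    then have lip: "(3/\<delta>)-lipschitz_on UNIV \<phi>"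
      unfolding \<phi>_def using d by (intro lipschitz_on_max_real lipschitz_on_const_ge) auto
    define A where "A = {x. infdist x F \<le> 2 / 3 * \<delta>}"
    define B where "B = {x. 1 / 3 * \<delta> \<le> infdist x F}"
    have cl: "closed A" "closed B"
      unfolding A_def B_def by (intro closed_Collect_le continuous_intros)+
    have A: "x \<in> A" if "\<phi> x \<noteq> 0" for x
    proof (rule ccontr)
      assume "x \<notin> A"
      then have "3 / \<delta> * (2 / 3 * \<delta>) \<le> 3 / \<delta> * infdist x F"
        using d by (intro mult_left_mono) (auto simp: A_def)
      then have "2 \<le> 3 / \<delta> * infdist x F" using d by simp
      then show False using that unfolding \<phi>_def by auto
    qed
    have B: "x \<in> B" if "\<phi> x \<noteq> 1" for x
    proof (rule ccontr)
      assume "x \<notin> B"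
      then have "3 / \<delta> * infdist x F \<le> 3 / \<delta> * (1 / 3 * \<delta>)"
        using d by (intro mult_left_mono) (auto simp: B_def)
      then have "3 / \<delta> * infdist x F \<le> 1" using d by simp
      then show False using that unfolding \<phi>_def by auto
    qed
    show ?thesis
    proof (rule that[OF lip _ _ cl(1) _ _ cl(2)])
      show "K \<inter> A \<subseteq> U"
      proof (rule ccontr)
        assume "\<not> K \<inter> A \<subseteq> U"
        then obtain y where "y \<in> K - U" "y \<in> A" by blast
        then have "\<delta> \<le> 2 / 3 * \<delta>" using z(2)[of y] by (simp add: A_def \<delta>_def)
        then show False using d by simp
      qed
      show "K \<inter> B \<subseteq> W"
      proof (rule ccontr)
        assume "\<not> K \<inter> B \<subseteq> W"
        then obtain y where "y \<in> F" "y \<in> B" unfolding F_def by blast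
        then show False using d by (simp add: B_def)
      qed
    qed (use A B in \<open>auto simp: \<phi>_def\<close>)
  qed
qed

text \<open>The competitors in \<open>mass_open\<close> as a predicate. It is also used with a
  compact set or a difference U - K in place of the open set.\<close>

definition mass_family ::
  "nat \<Rightarrow> 'a::metric_space set \<Rightarrow> nat \<Rightarrow> (nat \<Rightarrow> 'a \<Rightarrow> real) \<Rightarrow> (nat \<Rightarrow> nat \<Rightarrow> 'a \<Rightarrow> real) \<Rightarrow> bool" where
  "mass_family k U N fs gs \<longleftrightarrow>
     (\<forall>s<N. lipc (fs s) \<and> fsupp (fs s) \<subseteq> U \<and> ktuple k (gs s)
        \<and> (\<forall>i<k. (1::real)-lipschitz_on (fsupp (fs s)) (gs s i)))
     \<and> (\<forall>x. (\<Sum>s<N. \<bar>fs s x\<bar>) \<le> 1)"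

lemma mass_open_upper:
  "mass_family k U N fs gs \<Longrightarrow> ennreal (\<Sum>s<N. T (fs s) (gs s)) \<le> mass_open k T U"
  unfolding mass_open_def
  by (rule SUP_upper2[of "(N, fs, gs)"]) (auto simp: mass_family_def)

lemma mass_open_least:
  assumes "\<And>N fs gs. mass_family k U N fs gs \<Longrightarrow> ennreal (\<Sum>s<N. T (fs s) (gs s)) \<le> c"
  shows "mass_open k T U \<le> c"
  unfolding mass_open_def
  by (rule SUP_least) (use assms in \<open>auto simp: mass_family_def\<close>)

lemma mass_family_mono: "mass_family k U N fs gs \<Longrightarrow> U \<subseteq> W \<Longrightarrow> mass_family k W N fs gs"
  unfolding mass_family_def by blast

lemma mass_open_mono: "U \<subseteq> W \<Longrightarrow> mass_open k T U \<le> mass_open k T W"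
  by (rule mass_open_least) (blast intro: mass_open_upper mass_family_mono)

text \<open>Finitely many compact supports have a compact union. With it in place of the open set,
  covers become finite and removing it from an open set leaves an open set.\<close>

lemma mass_family_compact:
  assumes "mass_family k U N fs gs"
  obtains K where "compact K" "K \<subseteq> U" "\<And>s. s < N \<Longrightarrow> fsupp (fs s) \<subseteq> K" "mass_family k K N fs gs"
proof (rule that[of "\<Union>s<N. fsupp (fs s)"])
  show "compact (\<Union>s<N. fsupp (fs s))"
    using assms unfolding mass_family_def lipc_def by (intro compact_UN) auto
  show "(\<Union>s<N. fsupp (fs s)) \<subseteq> U" "mass_family k (\<Union>s<N. fsupp (fs s)) N fs gs"
    using assms unfolding mass_family_def by auto
qed auto

lemma sum_lessThan_append:
  fixes f g :: "nat \<Rightarrow> 'b::comm_monoid_add"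
  shows "(\<Sum>s<N + M. if s < N then f s else g (s - N)) = (\<Sum>s<N. f s) + (\<Sum>s<M. g s)"
  by (induction M) (simp_all add: add.assoc)

text \<open>The two families have disjoint supports, hence at each point only one of the two blocks
  contributes to the normalisation.\<close>

lemma mass_family_append:
  assumes f1: "mass_family k K N fs gs" and f2: "mass_family k (U - K) M fs' gs'" and "K \<subseteq> U"
  shows "mass_family k U (N + M) (\<lambda>s. if s < N then fs s else fs' (s - N))
    (\<lambda>s. if s < N then gs s else gs' (s - N))"
  unfolding mass_family_def
proof (intro conjI allI impI)
  fix s assume s: "s < N + M"
  let ?f = "if s < N then fs s else fs' (s - N)" and ?g = "if s < N then gs s else gs' (s - N)"
  show "lipc ?f" "ktuple k ?g"
    using f1 f2 s unfolding mass_family_def by auto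
  show "fsupp ?f \<subseteq> U"
  proof (cases "s < N")
    case True
    then show ?thesis using f1 \<open>K \<subseteq> U\<close> unfolding mass_family_def by auto
  next
    case False
    then have "fsupp (fs' (s - N)) \<subseteq> U - K" using f2 s unfolding mass_family_def by auto
    then show ?thesis using False by auto
  qed
  show "1-lipschitz_on (fsupp ?f) (?g i)" if "i < k" for i
    using f1 f2 s that unfolding mass_family_def by auto
next
  fix x
  have "(\<Sum>s<N + M. \<bar>(if s < N then fs s else fs' (s - N)) x\<bar>)
      = (\<Sum>s<N + M. if s < N then \<bar>fs s x\<bar> else \<bar>fs' (s - N) x\<bar>)"
    by (intro sum.cong) auto
  also have "\<dots> = (\<Sum>s<N. \<bar>fs s x\<bar>) + (\<Sum>s<M. \<bar>fs' s x\<bar>)"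
    by (rule sum_lessThan_append)
  also have "\<dots> \<le> 1"
  proof (cases "x \<in> K")
    case True
    then have "fs' s x = 0" if "s < M" for s
      using f2 that subset_fsupp[of "fs' s"] unfolding mass_family_def by blast
    then show ?thesis using f1 unfolding mass_family_def by simp
  next
    case False
    then have "fs s x = 0" if "s < N" for s
      using f1 that subset_fsupp[of "fs s"] unfolding mass_family_def by blast
    then show ?thesis using f2 unfolding mass_family_def by simp
  qed
  finally show "(\<Sum>s<N + M. \<bar>(if s < N then fs s else fs' (s - N)) x\<bar>) \<le> 1" .
qed

text \<open>Superadditivity: any competitor in U - K can be appended to the given one. It feeds the
  half of the Caratheodory condition that does not come from subadditivity.\<close>

lemma mass_open_diff_compact:
  assumes f1: "mass_family k K N fs gs" and "K \<subseteq> U"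
  shows "ennreal (\<Sum>s<N. T (fs s) (gs s)) + mass_open k T (U - K) \<le> mass_open k T U"
\<comment> \<open>\<open>ennreal\<close> sends negative reals to 0, so it is additive only on
  nonnegative sums; a negative sum contributes nothing.\<close>
proof (cases "0 \<le> (\<Sum>s<N. T (fs s) (gs s))")
  case False
  then have "ennreal (\<Sum>s<N. T (fs s) (gs s)) = 0" by (simp add: ennreal_neg)
  then show ?thesis by (simp add: mass_open_mono)
next
  case True
  let ?S = "{(M, fs', gs'). mass_family k (U - K) M fs' gs'}"
  \<comment> \<open>The empty family is always admissible; a constant moves into a supremum only
    over a nonempty index set.\<close>
  have ne: "?S \<noteq> {}"
  proof -
    have "mass_family k (U - K) 0 fs gs" by (simp add: mass_family_def)
    then show ?thesis by blast
  qed
  have eq: "mass_open k T (U - K) = (SUP p \<in> ?S. case p of (M, fs', gs') \<Rightarrow> ennreal (\<Sum>s<M. T (fs' s) (gs' s)))"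
    unfolding mass_open_def mass_family_def ..
  have "ennreal (\<Sum>s<N. T (fs s) (gs s)) + mass_open k T (U - K)
     = (SUP p \<in> ?S. ennreal (\<Sum>s<N. T (fs s) (gs s)) + (case p of (M, fs', gs') \<Rightarrow> ennreal (\<Sum>s<M. T (fs' s) (gs' s))))"
    unfolding eq by (rule ennreal_SUP_add_right[OF ne])
  also have "\<dots> \<le> mass_open k T U"
  proof (rule SUP_least, clarify)
    fix M fs' gs' assume f2: "mass_family k (U - K) M fs' gs'"
    show "ennreal (\<Sum>s<N. T (fs s) (gs s)) + ennreal (\<Sum>s<M. T (fs' s) (gs' s)) \<le> mass_open k T U"
    proof (cases "0 \<le> (\<Sum>s<M. T (fs' s) (gs' s))")
      case False
      then have "ennreal (\<Sum>s<M. T (fs' s) (gs' s)) = 0" by (simp add: ennreal_neg)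
      then show ?thesis using mass_open_upper[OF mass_family_mono[OF f1 \<open>K \<subseteq> U\<close>], of T] by simp
    next
      case t2: True
      have "(\<Sum>s<N + M. T (if s < N then fs s else fs' (s - N)) (if s < N then gs s else gs' (s - N)))
         = (\<Sum>s<N + M. if s < N then T (fs s) (gs s) else T (fs' (s - N)) (gs' (s - N)))"
        by (intro sum.cong) auto
      also have "\<dots> = (\<Sum>s<N. T (fs s) (gs s)) + (\<Sum>s<M. T (fs' s) (gs' s))"
        by (rule sum_lessThan_append)
      finally show ?thesis
        using mass_open_upper[OF mass_family_append[OF f1 f2 \<open>K \<subseteq> U\<close>], of T] True t2
        by (simp add: ennreal_plus)
    qed
  qed
  finally show ?thesis .
qed

locale current =
  fixes k :: nat and T :: "('a::metric_space \<Rightarrow> real) \<Rightarrow> (nat \<Rightarrow> 'a \<Rightarrow> real) \<Rightarrow> real"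
  assumes current: "metric_current k T"
begin

abbreviation m :: "'a measure" where "m \<equiv> mass_measure k T"

lemma linear:
  assumes "lipc f1" "lipc f2" "ktuple k g"
  shows "T (\<lambda>x. a * f1 x + b * f2 x) g = a * T f1 g + b * T f2 g"
  using current[unfolded metric_current_def, THEN conjunct1, rule_format, of f1 f2 g a b] assms by simp

lemma linear_upd:
  assumes "lipc f" "ktuple k g" "i < k" "liploc h1" "liploc h2"
  shows "T f (g(i := (\<lambda>x. a * h1 x + b * h2 x))) = a * T f (g(i := h1)) + b * T f (g(i := h2))"
  using current[unfolded metric_current_def, THEN conjunct2, THEN conjunct1, rule_format, of f g i h1 h2 a b] assms
  by simp

lemma continuous_upd:
  assumes "lipc f" "\<And>j. ktuple k (gs j)" "ktuple k g" "\<And>i. i < k \<Longrightarrow> liploc_conv (\<lambda>j. gs j i) (g i)"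
  shows "(\<lambda>j. T f (gs j)) \<longlonglongrightarrow> T f g"
  using current[unfolded metric_current_def, THEN conjunct2, THEN conjunct2, THEN conjunct1, rule_format,
      of "\<lambda>_. f" f gs g] lipc_conv_const[of f] assms
  by simp

lemma vanishes_if_constant:
  assumes "lipc f" "ktuple k g" "i < k" "\<And>x. x \<in> fsupp f \<Longrightarrow> g i x = c"
  shows "T f g = 0"
proof -
  have "\<exists>c. \<forall>x\<in>fsupp f. g i x = c" using assms(4) by blast
  then show ?thesis
    using current[unfolded metric_current_def, THEN conjunct2, THEN conjunct2, THEN conjunct2, rule_format, of f g i] assms(1-3)
    by simp
qed

lemma T_zero: "ktuple k g \<Longrightarrow> T (\<lambda>x. 0) g = 0"
  using linear[of "\<lambda>x. 0" "\<lambda>x. 0" g 0 0] lipc_zero by simp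

lemma T_cmult: "lipc f \<Longrightarrow> ktuple k g \<Longrightarrow> T (\<lambda>x. c * f x) g = c * T f g"
  using linear[of f f g c 0] by simp

lemma T_add: "lipc f1 \<Longrightarrow> lipc f2 \<Longrightarrow> ktuple k g \<Longrightarrow> T (\<lambda>x. f1 x + f2 x) g = T f1 g + T f2 g"
  using linear[of f1 f2 g 1 1] by simp

lemma T_diff: "lipc f1 \<Longrightarrow> lipc f2 \<Longrightarrow> ktuple k g \<Longrightarrow> T (\<lambda>x. f1 x - f2 x) g = T f1 g - T f2 g"
  using linear[of f1 f2 g 1 "-1"] by simp

lemma T_sum:
  assumes "\<And>i. i < n \<Longrightarrow> lipc (f i)" "ktuple k g"
  shows "lipc (\<lambda>x. \<Sum>i<(n::nat). f i x) \<and> T (\<lambda>x. \<Sum>i<n. f i x) g = (\<Sum>i<n. T (f i) g)"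
  using assms(1)
proof (induction n)
  case 0
  then show ?case by (simp add: lipc_zero T_zero[OF assms(2)])
next
  case (Suc n)
  then show ?case by (auto simp: T_add[OF _ _ assms(2)] intro: lipc_add)
qed

lemma mass_open_empty: "mass_open k T {} = 0"
proof -
  have "mass_open k T {} \<le> 0"
  proof (rule mass_open_least)
    fix N fs gs assume "mass_family k {} N fs (gs :: nat \<Rightarrow> nat \<Rightarrow> 'a \<Rightarrow> real)"
    then have "fs s = (\<lambda>x. 0) \<and> ktuple k (gs s)" if "s < N" for s
      using that subset_fsupp[of "fs s"] unfolding mass_family_def by fastforce
    then have "(\<Sum>s<N. T (fs s) (gs s)) = 0"
      using T_zero by (intro sum.neutral) auto
    then show "ennreal (\<Sum>s<N. T (fs s) (gs s)) \<le> 0" by simp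
  qed
  then show ?thesis by simp
qed

text \<open>Each competitor is split by a Lipschitz partition of unity over its compact support, and
  \<open>T\<close> is linear in the functions that are split.\<close>

lemma mass_open_Un:
  assumes "open U" "open W"
  shows "mass_open k T (U \<union> W) \<le> mass_open k T U + mass_open k T W"
proof (rule mass_open_least)
  fix N fs gs assume F: "mass_family k (U \<union> W) N fs (gs :: nat \<Rightarrow> nat \<Rightarrow> 'a \<Rightarrow> real)"
  then obtain K where K: "compact K" "K \<subseteq> U \<union> W" "\<And>s. s < N \<Longrightarrow> fsupp (fs s) \<subseteq> K"
    using mass_family_compact by metis
  obtain \<phi> :: "'a \<Rightarrow> real" and C A B where \<phi>: "C-lipschitz_on UNIV \<phi>" "\<And>x. 0 \<le> \<phi> x" "\<And>x. \<phi> x \<le> 1"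
    "closed A" "{x. \<phi> x \<noteq> 0} \<subseteq> A" "K \<inter> A \<subseteq> U"
    "closed B" "{x. \<phi> x \<noteq> 1} \<subseteq> B" "K \<inter> B \<subseteq> W"
    using lipschitz_cutoff[OF K(1,2) assms] by metis
  \<comment> \<open>Multiplication by a function with values in [0,1] shrinks the supports and the
    sum of absolute values, so the normalisation and the 1-Lipschitz condition both survive.\<close>
  have restr: "mass_family k U' N (\<lambda>s x. \<psi> x * fs s x) gs"
    if "C-lipschitz_on UNIV \<psi>" "\<And>x. 0 \<le> \<psi> x" "\<And>x. \<psi> x \<le> 1" "closed A'" "{x. \<psi> x \<noteq> 0} \<subseteq> A'" "K \<inter> A' \<subseteq> U'"
    for \<psi> :: "'a \<Rightarrow> real" and C A' U'
    unfolding mass_family_def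
  proof (intro conjI allI impI)
    fix s assume s: "s < N"
    show "lipc (\<lambda>x. \<psi> x * fs s x)"
      using F s that by (intro lipc_mult[where C=C]) (auto simp: mass_family_def)
    have sub: "fsupp (\<lambda>x. \<psi> x * fs s x) \<subseteq> fsupp (fs s)"
      by (rule fsupp_mono) auto
    have "fsupp (\<lambda>x. \<psi> x * fs s x) \<subseteq> A'"
      using that by (intro fsupp_minimal) auto
    then show "fsupp (\<lambda>x. \<psi> x * fs s x) \<subseteq> U'"
      using sub K(3)[OF s] that(6) by blast
    show "ktuple k (gs s)" using F s by (auto simp: mass_family_def)
    show "1-lipschitz_on (fsupp (\<lambda>x. \<psi> x * fs s x)) (gs s i)" if "i < k" for i
      using F s that sub by (auto simp: mass_family_def intro: lipschitz_on_subset)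
  next
    fix x
    have "(\<Sum>s<N. \<bar>\<psi> x * fs s x\<bar>) \<le> (\<Sum>s<N. \<bar>fs s x\<bar>)"
      using that(2,3) by (intro sum_mono) (auto simp: abs_mult mult_left_le_one_le)
    then show "(\<Sum>s<N. \<bar>\<psi> x * fs s x\<bar>) \<le> 1"
      using F unfolding mass_family_def by (meson order_trans)
  qed
  have f1: "mass_family k U N (\<lambda>s x. \<phi> x * fs s x) gs"
    by (rule restr[of C \<phi> A]) (use \<phi> in auto)
  have f2: "mass_family k W N (\<lambda>s x. (1 - \<phi> x) * fs s x) gs"
  proof (rule restr[of C "\<lambda>x. 1 - \<phi> x" B])
    show "C-lipschitz_on UNIV (\<lambda>x. 1 - \<phi> x)"
      using \<phi>(1) unfolding lipschitz_on_def by (simp add: dist_real_def abs_minus_commute)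
  qed (use \<phi> in auto)
  have "T (fs s) (gs s) = T (\<lambda>x. \<phi> x * fs s x) (gs s) + T (\<lambda>x. (1 - \<phi> x) * fs s x) (gs s)" if "s < N" for s
  proof -
    have "T (\<lambda>x. \<phi> x * fs s x + (1 - \<phi> x) * fs s x) (gs s)
       = T (\<lambda>x. \<phi> x * fs s x) (gs s) + T (\<lambda>x. (1 - \<phi> x) * fs s x) (gs s)"
      using f1 f2 that by (intro T_add) (auto simp: mass_family_def)
    then show ?thesis by (simp add: algebra_simps)
  qed
  then have "(\<Sum>s<N. T (fs s) (gs s))
      = (\<Sum>s<N. T (\<lambda>x. \<phi> x * fs s x) (gs s)) + (\<Sum>s<N. T (\<lambda>x. (1 - \<phi> x) * fs s x) (gs s))"
    by (simp add: sum.distrib[symmetric])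
  then have "ennreal (\<Sum>s<N. T (fs s) (gs s))
     \<le> ennreal (\<Sum>s<N. T (\<lambda>x. \<phi> x * fs s x) (gs s)) + ennreal (\<Sum>s<N. T (\<lambda>x. (1 - \<phi> x) * fs s x) (gs s))"
    by (auto simp: ennreal_plus_if intro!: ennreal_leI)
  also have "\<dots> \<le> mass_open k T U + mass_open k T W"
    by (intro add_mono mass_open_upper[OF f1] mass_open_upper[OF f2])
  finally show "ennreal (\<Sum>s<N. T (fs s) (gs s)) \<le> mass_open k T U + mass_open k T W" .
qed

lemma mass_open_UN_finite:
  "(\<And>i. open (U i)) \<Longrightarrow> mass_open k T (\<Union>i<(n::nat). U i) \<le> (\<Sum>i<n. mass_open k T (U i))"
proof (induction n)
  case 0
  then show ?case by (simp add: mass_open_empty)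
next
  case (Suc n)
  have "mass_open k T (\<Union>i<Suc n. U i) \<le> mass_open k T (\<Union>i<n. U i) + mass_open k T (U n)"
    using mass_open_Un[of "\<Union>i<n. U i" "U n"] Suc.prems
    by (simp add: lessThan_Suc Un_commute open_UN)
  also have "\<dots> \<le> (\<Sum>i<Suc n. mass_open k T (U i))"
    using Suc by (simp add: add_right_mono)
  finally show ?case .
qed

text \<open>A competitor has compact support, hence already lives in a finite subunion.\<close>

lemma mass_open_UN:
  assumes "\<And>i::nat. open (U i)"
  shows "mass_open k T (\<Union>i. U i) \<le> (\<Sum>i. mass_open k T (U i))"
proof (rule mass_open_least)
  fix N fs gs assume F: "mass_family k (\<Union>i. U i) N fs (gs :: nat \<Rightarrow> nat \<Rightarrow> 'a \<Rightarrow> real)"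
  then obtain K where K: "compact K" "K \<subseteq> (\<Union>i. U i)" "mass_family k K N fs gs"
    using mass_family_compact by metis
  obtain J where J: "finite J" "K \<subseteq> (\<Union>i\<in>J. U i)"
    using compactE_image[OF K(1), of UNIV U] assms K(2) by metis
  define n where "n = Suc (Max (insert 0 J))"
  have "J \<subseteq> {..<n}" using J(1) by (auto simp: n_def less_Suc_eq_le)
  then have "K \<subseteq> (\<Union>i<n. U i)" using J(2) by blast
  then have "ennreal (\<Sum>s<N. T (fs s) (gs s)) \<le> mass_open k T (\<Union>i<n. U i)"
    using K(3) mass_family_mono mass_open_upper by metis
  also have "\<dots> \<le> (\<Sum>i<n. mass_open k T (U i))"
    by (rule mass_open_UN_finite[OF assms])
  also have "\<dots> \<le> (\<Sum>i. mass_open k T (U i))"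
    by (rule sum_le_suminf) auto
  finally show "ennreal (\<Sum>s<N. T (fs s) (gs s)) \<le> (\<Sum>i. mass_open k T (U i))" .
qed

section \<open>The outer measure and Caratheodory's construction\<close>

lemma mass_set_open: "open U \<Longrightarrow> mass_set k T U = mass_open k T U"
  unfolding mass_set_def
  by (rule antisym) (auto intro!: INF_lower INF_greatest mass_open_mono)

lemma mass_set_mono: "A \<subseteq> B \<Longrightarrow> mass_set k T A \<le> mass_set k T B"
  unfolding mass_set_def by (rule INF_superset_mono) auto

lemma mass_set_approx:
  assumes "mass_set k T A < top" "0 < (e::real)"
  obtains U where "open U" "A \<subseteq> U" "mass_open k T U \<le> mass_set k T A + ennreal e"
proof -
  have "mass_set k T A < mass_set k T A + ennreal e"
    using assms by (simp add: ennreal_add_left_cancel_less[of _ 0, simplified] less_top[symmetric])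
  then have "(INF U \<in> {U. open U \<and> A \<subseteq> U}. mass_open k T U) < mass_set k T A + ennreal e"
    by (simp add: mass_set_def[of k T A])
  then obtain U where "U \<in> {U. open U \<and> A \<subseteq> U}" "mass_open k T U < mass_set k T A + ennreal e"
    unfolding INF_less_iff by blast
  then show ?thesis using that[of U] by auto
qed

lemma mass_set_UN: "mass_set k T (\<Union>i::nat. A i) \<le> (\<Sum>i. mass_set k T (A i))"
proof (rule ennreal_le_epsilon)
  fix e :: real assume fin: "(\<Sum>i. mass_set k T (A i)) < top" and e: "0 < e"
  have fin: "mass_set k T (A i) < top" for i
  proof -
    have "(\<Sum>i\<in>{i}. mass_set k T (A i)) \<le> (\<Sum>i. mass_set k T (A i))"
      by (rule sum_le_suminf) auto
    then show ?thesis using fin by simp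
  qed
  have pos: "0 < e * (1/2)^Suc i" for i using e by simp
  have "\<exists>U. open U \<and> A i \<subseteq> U \<and> mass_open k T U \<le> mass_set k T (A i) + ennreal (e * (1/2)^Suc i)" for i
    by (rule mass_set_approx[OF fin pos]) blast
  then obtain U where U: "\<And>i. open (U i)" "\<And>i. A i \<subseteq> U i"
    "\<And>i. mass_open k T (U i) \<le> mass_set k T (A i) + ennreal (e * (1/2)^Suc i)"
    by metis
  have "mass_set k T (\<Union>i. A i) \<le> mass_set k T (\<Union>i. U i)"
    using U(2) by (intro mass_set_mono) blast
  also have "\<dots> = mass_open k T (\<Union>i. U i)"
    using U(1) by (intro mass_set_open) auto
  also have "\<dots> \<le> (\<Sum>i. mass_open k T (U i))"
    by (rule mass_open_UN[OF U(1)])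
  also have "\<dots> \<le> (\<Sum>i. mass_set k T (A i) + ennreal (e * (1/2)^Suc i))"
    by (intro suminf_le U(3)) auto
  also have "\<dots> = (\<Sum>i. mass_set k T (A i)) + (\<Sum>i. ennreal (e * (1/2)^Suc i))"
    by (intro suminf_add[symmetric]) auto
  also have "(\<Sum>i. ennreal (e * (1/2)^Suc i)) = ennreal e"
  proof (rule suminf_ennreal_eq)
    show "(\<lambda>i. e * (1/2)^Suc i) sums e"
      using sums_mult[OF power_half_series, of e] by simp
  qed (use e in auto)
  finally show "mass_set k T (\<Union>i. A i) \<le> (\<Sum>i. mass_set k T (A i)) + ennreal e" .
qed

lemma mass_set_empty: "mass_set k T {} = 0"
  using mass_set_open[of "{}"] mass_open_empty by simp

lemma outer_measure: "outer_measure_space UNIV (mass_set k T)"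
  unfolding outer_measure_space_def positive_def increasing_def countably_subadditive_def
  using mass_set_empty mass_set_mono mass_set_UN by blast

text \<open>For an open test set W, a competitor in W \<inter> U lives on a compact K, and W - K is
  open and contains W - U, so superadditivity applies to K. A general A is reached through the
  infimum over open W.\<close>

lemma open_caratheodory:
  assumes U: "open U"
  shows "mass_set k T (A \<inter> U) + mass_set k T (A - U) \<le> mass_set k T A"
proof -
  have *: "mass_open k T (W \<inter> U) + mass_set k T (W - U) \<le> mass_open k T W" if "open W" for W
  proof -
    let ?S = "{(N, fs, gs). mass_family k (W \<inter> U) N fs gs}"
    have "mass_family k (W \<inter> U) 0 undefined undefined" by (simp add: mass_family_def)
    then have ne: "?S \<noteq> {}" by blast
    have eq: "mass_open k T (W \<inter> U) = (SUP p \<in> ?S. case p of (N, fs, gs) \<Rightarrow> ennreal (\<Sum>s<N. T (fs s) (gs s)))"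
      unfolding mass_open_def mass_family_def ..
    have "mass_open k T (W \<inter> U) + mass_set k T (W - U)
        = (SUP p \<in> ?S. (case p of (N, fs, gs) \<Rightarrow> ennreal (\<Sum>s<N. T (fs s) (gs s))) + mass_set k T (W - U))"
      unfolding eq by (rule ennreal_SUP_add_left[OF ne, symmetric])
    also have "\<dots> \<le> mass_open k T W"
    proof (rule SUP_least, clarify)
      fix N fs gs assume F: "mass_family k (W \<inter> U) N fs (gs :: nat \<Rightarrow> nat \<Rightarrow> 'a \<Rightarrow> real)"
      obtain K where K: "compact K" "K \<subseteq> W \<inter> U" "mass_family k K N fs gs"
        using mass_family_compact[OF F] by metis
      have "mass_set k T (W - U) \<le> mass_set k T (W - K)"
        using K by (intro mass_set_mono) blast
      also have "\<dots> = mass_open k T (W - K)"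
        using that K by (intro mass_set_open) (simp add: compact_imp_closed open_Diff)
      finally have "ennreal (\<Sum>s<N. T (fs s) (gs s)) + mass_set k T (W - U)
         \<le> ennreal (\<Sum>s<N. T (fs s) (gs s)) + mass_open k T (W - K)"
        by (rule add_left_mono)
      also have "\<dots> \<le> mass_open k T W"
        using K by (intro mass_open_diff_compact) auto
      finally show "ennreal (\<Sum>s<N. T (fs s) (gs s)) + mass_set k T (W - U) \<le> mass_open k T W" .
    qed
    finally show ?thesis .
  qed
  show ?thesis
    unfolding mass_set_def[of k T A]
  proof (rule INF_greatest)
    fix W assume "W \<in> {W. open W \<and> A \<subseteq> W}"
    then have W: "open W" "A \<subseteq> W" by auto
    have "mass_set k T (A \<inter> U) + mass_set k T (A - U) \<le> mass_set k T (W \<inter> U) + mass_set k T (W - U)"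
      using W by (intro add_mono mass_set_mono) auto
    also have "\<dots> \<le> mass_open k T W"
      using * W U by (simp add: mass_set_open open_Int)
    finally show "mass_set k T (A \<inter> U) + mass_set k T (A - U) \<le> mass_open k T W" .
  qed
qed

lemma measure_space_mass_set: "measure_space UNIV (sets borel) (mass_set k T)"
proof -
  let ?L = "lambda_system UNIV UNIV (mass_set k T)"
  have L: "measure_space UNIV ?L (mass_set k T)"
    using sigma_algebra.caratheodory_lemma[OF sigma_algebra_Pow, of UNIV "mass_set k T"] outer_measure
    by simp
  have "U \<in> ?L" if "open U" for U
  proof -
    have "mass_set k T A \<le> mass_set k T (U \<inter> A) + mass_set k T ((UNIV - U) \<inter> A)" for A
    proof -
      \<comment> \<open>Two sets padded with empty ones, so that countable subadditivity yields the
        finite case.\<close>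
      let ?B = "\<lambda>i::nat. if i = 0 then U \<inter> A else if i = 1 then (UNIV - U) \<inter> A else {}"
      have "mass_set k T A = mass_set k T (\<Union>i. ?B i)"
        by (rule arg_cong[where f="mass_set k T"]) (auto split: if_splits)
      also have "\<dots> \<le> (\<Sum>i. mass_set k T (?B i))" by (rule mass_set_UN)
      also have "\<dots> = (\<Sum>i\<in>{0,1}. mass_set k T (?B i))"
        by (rule suminf_finite) (auto simp: mass_set_empty)
      finally show ?thesis by simp
    qed
    then show ?thesis
      using open_caratheodory[OF that] unfolding lambda_system_def
      by (auto intro!: antisym simp: Int_commute Diff_eq)
  qed
  then have "{S. open S} \<subseteq> ?L" by auto
  moreover have "sigma_algebra UNIV ?L" using L by (simp add: measure_space_def)
  ultimately have "sets (borel :: 'a measure) \<subseteq> ?L"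
    unfolding borel_def by (simp add: sigma_algebra.sigma_sets_subset)
  then show ?thesis
    using L sets.sigma_algebra_axioms[of "borel :: 'a measure"]
    by (auto simp: measure_space_def countably_additive_def positive_def)
qed

lemma sets_mass [measurable_cong, simp]: "sets m = sets borel"
  unfolding mass_measure_def using sets.sigma_sets_eq[of "borel :: 'a measure"]
  by (simp add: sets.space_closed[of "borel :: 'a measure", simplified])

lemma space_mass [simp]: "space m = UNIV"
  unfolding mass_measure_def using sets.space_closed[of "borel :: 'a measure"] by (simp add: space_measure_of)

lemma emeasure_mass: "A \<in> sets borel \<Longrightarrow> emeasure m A = mass_set k T A"
  using measure_space_mass_set unfolding mass_measure_def measure_space_def
  by (intro emeasure_measure_of_sigma) auto

end

section \<open>Bounding a current by its mass\<close>

abbreviation L1_norm :: "'a measure \<Rightarrow> ('a \<Rightarrow> real) \<Rightarrow> real" where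
  "L1_norm M f \<equiv> (\<integral>x. \<bar>f x\<bar> \<partial>M)"

abbreviation L1_dist :: "'a measure \<Rightarrow> ('a \<Rightarrow> real) \<Rightarrow> ('a \<Rightarrow> real) \<Rightarrow> real" where
  "L1_dist M f g \<equiv> (\<integral>x. \<bar>f x - g x\<bar> \<partial>M)"

abbreviation pairing :: "'a measure \<Rightarrow> ('a \<Rightarrow> real) \<Rightarrow> ('a \<Rightarrow> real) \<Rightarrow> real" where
  "pairing M f h \<equiv> (\<integral>x. f x * h x \<partial>M)"

text \<open>Each summand is the length of the part of [0,t] between the heights i * d and (i + 1) *
  d.\<close>

lemma sum_slices:
  fixes t d :: real
  assumes "0 \<le> t" "0 < d"
  shows "(\<Sum>i<n. max 0 (min d (t - real i * d))) = min t (real n * d)"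
proof (induction n)
  case (Suc n)
  have "real n * d \<le> real (Suc n) * d" using assms by (simp add: algebra_simps)
  then show ?case using Suc by (auto simp: max_def min_def algebra_simps)
qed (use assms in auto)

text \<open>The exhaustion is a parameter, so that all local bounds refer to the same sets; every
  compact set lies in one \<open>V j\<close>.\<close>

locale lf_current = current k T for k and T :: "('a::metric_space \<Rightarrow> real) \<Rightarrow> (nat \<Rightarrow> 'a \<Rightarrow> real) \<Rightarrow> real" +
  fixes V :: "nat \<Rightarrow> 'a set"
  assumes lf_mass: "locally_finite_mass k T"
    and open_V: "\<And>j. open (V j)" and incseq_V: "incseq V"
    and V_compact: "\<And>j. \<exists>K. compact K \<and> V j \<subseteq> K" and V_cover: "(\<Union>j. V j) = UNIV"
begin

lemma emeasure_compact_finite: "compact K \<Longrightarrow> emeasure m K < \<infinity>"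
  using lf_mass emeasure_mass[of K] unfolding locally_finite_mass_def by (simp add: borel_compact)

lemma V_measurable [measurable]: "V j \<in> sets borel"
  using open_V by (rule borel_open)

lemma emeasure_V_finite: "emeasure m (V j) < \<infinity>"
proof -
  obtain K where "compact K" "V j \<subseteq> K" using V_compact by blast
  then show ?thesis
    using emeasure_compact_finite[of K] emeasure_mono[of "V j" K m] by (simp add: borel_compact le_less_trans)
qed

lemma compact_subset_V: assumes "compact K" obtains j where "K \<subseteq> V j"
proof -
  obtain J where J: "finite J" "K \<subseteq> (\<Union>i\<in>J. V i)"
    using compactE_image[OF assms, of UNIV V] open_V V_cover by (metis subset_UNIV)
  have "(\<Union>i\<in>J. V i) \<subseteq> V (Max (insert 0 J))"
  proof (rule UN_least)
    fix i assume "i \<in> J"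
    then have "i \<le> Max (insert 0 J)" using J(1) by simp
    then show "V i \<subseteq> V (Max (insert 0 J))" by (rule incseqD[OF incseq_V])
  qed
  then show ?thesis by (rule that[OF order_trans[OF J(2)]])
qed

lemma closure_V_compact: "compact (closure (V j))"
proof -
  obtain K where K: "compact K" "V j \<subseteq> K" using V_compact by blast
  then have "K \<inter> closure (V j) = closure (V j)"
    using closure_minimal[OF K(2) compact_imp_closed[OF K(1)]] by blast
  then show ?thesis using compact_Int_closed[OF K(1) closed_closure, of "V j"] by simp
qed

lemma lipcI_V: assumes "C-lipschitz_on UNIV f" "{x. f x \<noteq> 0} \<subseteq> V j" shows "lipc f"
proof -
  obtain K where K: "compact K" "V j \<subseteq> K" using V_compact by blast
  show ?thesis by (rule lipcI[OF assms(1) K(1) order_trans[OF assms(2) K(2)]])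
qed

lemma lipc_subset_V: assumes "lipc f" obtains j where "{x. f x \<noteq> 0} \<subseteq> V j"
proof -
  have "compact (fsupp f)" using assms by (simp add: lipc_def)
  then obtain j where "fsupp f \<subseteq> V j" by (rule compact_subset_V)
  then show ?thesis by (rule that[OF order_trans[OF subset_fsupp]])
qed

lemma lipc_measurable: "lipc f \<Longrightarrow> f \<in> borel_measurable borel"
  by (rule borel_measurable_continuous_onI) (rule lipc_continuous)

text \<open>Local compactness enters here: a Lipschitz bound on compact sets gives continuity on
  each open \<open>V j\<close>, and these cover X.\<close>

lemma liploc_continuous:
  fixes g :: "'a \<Rightarrow> real"
  assumes g: "liploc g"
  shows "continuous_on UNIV g"
proof -
  have "continuous_on (V j) g" for j
  proof -
    obtain K where K: "compact K" "V j \<subseteq> K" using V_compact by blast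
    then obtain C where "C-lipschitz_on K g" using g unfolding liploc_def by blast
    then show ?thesis using K(2) lipschitz_on_continuous_on continuous_on_subset by blast
  qed
  then have "continuous_on (\<Union>j. V j) g"
    using open_V by (intro continuous_on_open_UN) auto
  then show ?thesis using V_cover by simp
qed

lemma integrable_if_bounded:
  fixes f :: "'a \<Rightarrow> real"
  assumes [measurable]: "f \<in> borel_measurable borel" and "\<And>x. \<bar>f x\<bar> \<le> B" "{x. f x \<noteq> 0} \<subseteq> V j"
  shows "integrable m f"
proof (rule Bochner_Integration.integrable_bound[of m "\<lambda>x. B * indicator (V j) x"])
  show "integrable m (\<lambda>x. B * indicator (V j) x)"
    using emeasure_V_finite by (intro integrable_mult_right integrable_real_indicator) auto
  show "AE x in m. norm (f x) \<le> norm (B * indicator (V j) x)"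
  proof (intro AE_I2)
    fix x show "norm (f x) \<le> norm (B * indicator (V j) x)"
      using assms(2)[of x] assms(3) by (cases "x \<in> V j") auto
  qed
qed measurable

lemma lipc_integrable: assumes "lipc f" shows "integrable m f"
proof -
  obtain j where "{x. f x \<noteq> 0} \<subseteq> V j" using lipc_subset_V[OF assms] by blast
  moreover obtain B where "\<And>x. \<bar>f x\<bar> \<le> B" using lipc_bounded[OF assms] by metis
  ultimately show ?thesis using integrable_if_bounded lipc_measurable[OF assms] by blast
qed

text \<open>Divided by c, f alone is a competitor in every open set that contains C, and the mass of
  C is the infimum over these sets.\<close>

lemma current_le_compact:
  assumes f: "lipc f" and g: "ktuple k g" and c: "\<And>x. \<bar>f x\<bar> \<le> c" "0 < c" and C: "compact C" "fsupp f \<subseteq> C"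
    and lip: "\<And>i. i < k \<Longrightarrow> 1-lipschitz_on (fsupp f) (g i)"
  shows "\<bar>T f g\<bar> \<le> c * measure m C"
proof -
  \<comment> \<open>Stated for every u with the support of f, so that it also applies to -f and
    yields the absolute value.\<close>
  have *: "T u g \<le> c * measure m C" if u: "lipc u" "\<And>x. \<bar>u x\<bar> \<le> c" "fsupp u = fsupp f" for u
  proof -
    have "ennreal (T (\<lambda>x. (1/c) * u x) g) \<le> mass_set k T C"
      unfolding mass_set_def
    proof (rule INF_greatest)
      fix U assume U: "U \<in> {U. open U \<and> C \<subseteq> U}"
      have eq: "fsupp (\<lambda>x. (1/c) * u x) = fsupp f" using c(2) u(3) by (simp add: fsupp_def)
      have "mass_family k U 1 (\<lambda>_ x. (1/c) * u x) (\<lambda>_. g)"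
        unfolding mass_family_def eq
        using U lip g C lipc_cmult[OF u(1), of "1/c"] u(2) c(2) by (auto simp: abs_mult)
      then show "ennreal (T (\<lambda>x. (1/c) * u x) g) \<le> mass_open k T U"
        using mass_open_upper[of k U 1] by force
    qed
    then have "ennreal (T (\<lambda>x. (1/c) * u x) g) \<le> ennreal (measure m C)"
      using emeasure_compact_finite[OF C(1)] emeasure_mass[of C] emeasure_eq_ennreal_measure[of m C] borel_compact[OF C(1)]
      by (metis infinity_ennreal_def less_irrefl)
    then have "T (\<lambda>x. (1/c) * u x) g \<le> measure m C"
      by (simp only: ennreal_le_iff[OF measure_nonneg])
    then have "(1/c) * T u g \<le> measure m C" by (simp only: T_cmult[OF u(1) g])
    then show ?thesis using c(2) by (simp add: divide_le_eq mult.commute)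
  qed
  have "T (\<lambda>x. -1 * f x) g \<le> c * measure m C"
    using c f by (intro * lipc_cmult) (auto simp: fsupp_def)
  then show ?thesis using *[OF f c(1) refl] T_cmult[OF f g, of "-1"] by (simp add: abs_le_iff)
qed

text \<open>A layer-cake argument: the current is tested on the horizontal slices of f of height d; the mass
  of the support of each slice is controlled by the integral of the slice below it.\<close>
lemma current_le_mass_nonneg:
  assumes f: "lipc f" "\<And>x. 0 \<le> f x" and g: "ktuple k g" and lip: "\<And>i. i < k \<Longrightarrow> 1-lipschitz_on (fsupp f) (g i)"
  shows "\<bar>T f g\<bar> \<le> (\<integral>x. f x \<partial>m)"
proof (rule field_le_epsilon)
  fix e :: real assume e: "0 < e"
  \<comment> \<open>The bottom slice has no slice below it; this height makes its cost at most e.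
    Adding 1 avoids division by 0.\<close>
  define d where "d = e / (measure m (fsupp f) + 1)"
  have mpos: "measure m (fsupp f) + 1 > 0" by (simp add: add_nonneg_pos)
  have d: "d > 0" unfolding d_def using e mpos by simp
  have "d * measure m (fsupp f) \<le> d * (measure m (fsupp f) + 1)" using d by (intro mult_left_mono) auto
  also have "\<dots> = e" using mpos by (simp add: d_def)
  finally have dm: "d * measure m (fsupp f) \<le> e" .
  define s where "s i x = max 0 (min d (f x - real i * d))" for i x
  have s_lipc: "lipc (s i)" for i
  proof -
    have "1-lipschitz_on UNIV (\<lambda>t. max 0 (min d (t - real i * d)))"
      by (intro lipschitz_on_max_real lipschitz_on_const_ge) (auto intro: lipschitz_onI simp: dist_real_def)
    then show ?thesis
      unfolding s_def
    proof (rule lipc_compose[OF f(1)])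
      have "0 \<le> real i * d" using d by simp
      then show "max 0 (min d (0 - real i * d)) = 0" using d by linarith
    qed
  qed
  obtain B where B: "\<And>x. \<bar>f x\<bar> \<le> B" using lipc_bounded[OF f(1)] by metis
  obtain N where N: "B < real N * d" using reals_Archimedean3[OF d] by blast
  \<comment> \<open>The number of slices is written as a successor so that the bottom one can be
    split off later.\<close>
  have sum_s: "(\<Sum>i<Suc N. s i x) = f x" for x
  proof -
    have "f x < real (Suc N) * d" using B[of x] N d by (simp add: algebra_simps)
    then show ?thesis using sum_slices[OF f(2) d, of x "Suc N"] by (simp add: s_def del: sum.lessThan_Suc)
  qed
  have sle: "s i x \<le> f x" for i x
    using f(2)[of x] d mult_nonneg_nonneg[of "real i" d] unfolding s_def by linarith
  have "fsupp (s i) \<subseteq> fsupp f" for i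
    by (rule fsupp_mono) (metis antisym f(2) max.cobounded1 s_def sle)
  then have lip_s: "1-lipschitz_on (fsupp (s i)) (g a)" if "a < k" for i a
    using lip[OF that] lipschitz_on_subset by blast
  have s_bd: "\<bar>s i x\<bar> \<le> d" for i x unfolding s_def using d by auto
  have cf: "compact (fsupp f)" using f(1) by (simp add: lipc_def)
  have s0: "\<bar>T (s 0) g\<bar> \<le> d * measure m (fsupp f)"
    using \<open>\<And>i. fsupp (s i) \<subseteq> fsupp f\<close> by (intro current_le_compact s_lipc g s_bd d cf lip_s)
  have sS: "\<bar>T (s (Suc i)) g\<bar> \<le> (\<integral>x. s i x \<partial>m)" for i
  proof -
    \<comment> \<open>Off C the slice \<open>s (Suc i)\<close> vanishes, while on C the slice
      \<open>s i\<close> below it is full, that is, equal to d.\<close>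
    define C where "C = fsupp f \<inter> {x. real (Suc i) * d \<le> f x}"
    have "closed {x. real (Suc i) * d \<le> f x}"
      by (intro closed_Collect_le continuous_intros lipc_continuous f)
    then have C: "compact C" unfolding C_def using cf by (rule compact_Int_closed[rotated])
    have "fsupp (s (Suc i)) \<subseteq> C"
    proof (rule fsupp_minimal)
      show "closed C" using C by (rule compact_imp_closed)
      show "{x. s (Suc i) x \<noteq> 0} \<subseteq> C"
      proof
        fix x assume "x \<in> {x. s (Suc i) x \<noteq> 0}"
        then have x: "s (Suc i) x \<noteq> 0" by simp
        then have "x \<in> fsupp f" using \<open>\<And>i. fsupp (s i) \<subseteq> fsupp f\<close> subset_fsupp[of "s (Suc i)"] by blast
        moreover have "real (Suc i) * d \<le> f x" using x unfolding s_def by (auto simp: max_def min_def split: if_splits)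
        ultimately show "x \<in> C" by (simp add: C_def)
      qed
    qed
    then have "\<bar>T (s (Suc i)) g\<bar> \<le> d * measure m C"
      by (intro current_le_compact s_lipc g s_bd d C lip_s)
    also have "\<dots> = (\<integral>x. d * indicator C x \<partial>m)" by simp
    also have "\<dots> \<le> (\<integral>x. s i x \<partial>m)"
    proof (rule integral_mono)
      show "integrable m (\<lambda>x. d * indicator C x)"
        using emeasure_compact_finite[OF C] C by (intro integrable_mult_right integrable_real_indicator) (auto simp: borel_compact)
      show "integrable m (s i)" by (rule lipc_integrable[OF s_lipc])
      show "d * indicator C x \<le> s i x" for x
        using d unfolding C_def s_def by (auto simp: indicator_def algebra_simps)
    qed
    finally show ?thesis .
  qed
  have "T f g = (\<Sum>i<Suc N. T (s i) g)"
    using T_sum[of "Suc N" s g] s_lipc g unfolding sum_s by simp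
  then have "\<bar>T f g\<bar> \<le> (\<Sum>i<Suc N. \<bar>T (s i) g\<bar>)" by (metis sum_abs)
  also have "\<dots> = \<bar>T (s 0) g\<bar> + (\<Sum>i<N. \<bar>T (s (Suc i)) g\<bar>)"
    by (rule sum.lessThan_Suc_shift)
  also have "\<dots> \<le> e + (\<Sum>i<N. (\<integral>x. s i x \<partial>m))"
    using s0 dm sS by (intro add_mono sum_mono) auto
  also have "(\<Sum>i<N. (\<integral>x. s i x \<partial>m)) = (\<integral>x. (\<Sum>i<N. s i x) \<partial>m)"
    by (rule Bochner_Integration.integral_sum[symmetric]) (rule lipc_integrable[OF s_lipc])
  also have "\<dots> \<le> (\<integral>x. f x \<partial>m)"
  proof (rule integral_mono)
    show "integrable m (\<lambda>x. \<Sum>i<N. s i x)" by (intro Bochner_Integration.integrable_sum lipc_integrable s_lipc)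
    show "(\<Sum>i<N. s i x) \<le> f x" for x
      using sum_s[of x] by (simp add: s_def)
  qed (rule lipc_integrable[OF f(1)])
  finally show "\<bar>T f g\<bar> \<le> (\<integral>x. f x \<partial>m) + e" by simp
qed

text \<open>The positive and negative parts have supports inside that of f, and their integrals add
  up to the L1 norm.\<close>

lemma current_le_mass_1:
  assumes f: "lipc f" and g: "ktuple k g" and lip: "\<And>i. i < k \<Longrightarrow> 1-lipschitz_on (fsupp f) (g i)"
  shows "\<bar>T f g\<bar> \<le> L1_norm m f"
proof -
  define p q where "p x = max 0 (f x)" and "q x = max 0 (- f x)" for x
  have p: "lipc p" unfolding p_def
    by (rule lipc_compose[OF f, of 1]) (auto intro!: lipschitz_on_max_real lipschitz_on_const_ge lipschitz_on_id)
  have q: "lipc q" unfolding q_def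
    by (rule lipc_compose[OF f, of 1 "\<lambda>t. max 0 (-t)"])
      (auto intro!: lipschitz_on_max_real lipschitz_on_const_ge lipschitz_on_id)
  have "fsupp p \<subseteq> fsupp f" "fsupp q \<subseteq> fsupp f"
    unfolding p_def q_def by (auto intro!: fsupp_mono)
  then have "\<bar>T p g\<bar> \<le> (\<integral>x. p x \<partial>m)" "\<bar>T q g\<bar> \<le> (\<integral>x. q x \<partial>m)"
    using lip by (auto intro!: current_le_mass_nonneg p q g intro: lipschitz_on_subset) (auto simp: p_def q_def)
  moreover have "T f g = T p g - T q g"
  proof -
    have "f = (\<lambda>x. p x - q x)" unfolding p_def q_def by auto
    then show ?thesis using T_diff[OF p q g] by simp
  qed
  moreover have "L1_norm m f = (\<integral>x. p x \<partial>m) + (\<integral>x. q x \<partial>m)"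
  proof -
    have "(\<lambda>x. \<bar>f x\<bar>) = (\<lambda>x. p x + q x)" unfolding p_def q_def by auto
    then show ?thesis using Bochner_Integration.integral_add[OF lipc_integrable[OF p] lipc_integrable[OF q]] by simp
  qed
  ultimately show ?thesis by linarith
qed

lemma current_scale:
  assumes f: "lipc f" and g: "ktuple k g" and "n \<le> k"
  shows "T f (\<lambda>i. if i < n then (\<lambda>x. c i * g i x) else g i) = (\<Prod>i<n. c i) * T f g"
  using \<open>n \<le> k\<close>
proof (induction n)
  case (Suc n)
  let ?g = "\<lambda>i. if i < n then (\<lambda>x. c i * g i x) else g i"
  have gk: "ktuple k ?g" using g unfolding ktuple_def by (auto intro: liploc_cmult)
  \<comment> \<open>A linear combination with second coefficient 0 turns \<open>linear_upd\<close>
    into homogeneity.\<close>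
  have eq: "(\<lambda>i. if i < Suc n then (\<lambda>x. c i * g i x) else g i) = ?g(n := (\<lambda>x. c n * g n x + 0 * g n x))"
    by (auto simp: fun_eq_iff less_Suc_eq)
  have "T f (?g(n := (\<lambda>x. c n * g n x + 0 * g n x))) = c n * T f (?g(n := g n)) + 0 * T f (?g(n := g n))"
    using Suc.prems g by (intro linear_upd f gk) (auto simp: ktuple_def)
  also have "?g(n := g n) = ?g" by auto
  finally show ?case unfolding eq using Suc by (simp only: prod.lessThan_Suc Suc_leD mult_zero_left add_0_right mult.assoc mult.commute mult.left_commute)
qed simp

text \<open>Dividing entry i by \<open>L i\<close> reduces to constants 1, and multilinearity
  returns the product. Only Lipschitz constants on the support of f enter, which is what makes the
  estimate local.\<close>

lemma current_le_mass:
  assumes f: "lipc f" and g: "ktuple k g"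
    and lip: "\<And>i. i < k \<Longrightarrow> (L i)-lipschitz_on (fsupp f) (g i)" "\<And>i. i < k \<Longrightarrow> 0 < L i"
  shows "\<bar>T f g\<bar> \<le> (\<Prod>i<k. L i) * L1_norm m f"
proof -
  define g' where "g' i = (if i < k then (\<lambda>x. (1 / L i) * g i x) else g i)" for i
  have g'k: "ktuple k g'" using g unfolding ktuple_def g'_def by (auto intro: liploc_cmult simp del: times_divide_eq_left)
  have "1-lipschitz_on (fsupp f) (g' i)" if "i < k" for i
    using lipschitz_on_cmult_real[OF lip(1)[OF that], of "1 / L i"] lip(2)[OF that] that by (simp add: g'_def)
  then have *: "\<bar>T f g'\<bar> \<le> L1_norm m f" by (intro current_le_mass_1 f g'k)
  have "g = (\<lambda>i. if i < k then (\<lambda>x. L i * g' i x) else g' i)"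
    using lip(2) by (fastforce simp: g'_def fun_eq_iff)
  then have "T f g = (\<Prod>i<k. L i) * T f g'" using current_scale[OF f g'k, of k L] by simp
  moreover have "0 \<le> (\<Prod>i<k. L i)" using lip(2) by (intro prod_nonneg) (auto intro: less_imp_le)
  ultimately show ?thesis using * by (simp add: abs_mult mult_left_mono)
qed

section \<open>Density of Lipschitz functions\<close>

lemma indicator_approx_open:
  assumes W: "open W" "W \<subseteq> V j" and e: "0 < e"
  shows "\<exists>f. lipc f \<and> {x. f x \<noteq> 0} \<subseteq> W \<and> (\<forall>x. 0 \<le> f x \<and> f x \<le> 1) \<and> L1_dist m f (indicator W) < e"
\<comment> \<open>The complement of UNIV is empty and \<open>infdist\<close> to it is 0, so the
  formula of the other case would fail. Here X itself lies in \<open>V j\<close>, so the constant 1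
  is admissible.\<close>
proof (cases "W = UNIV")
  case True
  then have "lipc (\<lambda>x::'a. 1::real)" using W by (intro lipcI_V[of 0 _ j] lipschitz_on_constant) auto
  then show ?thesis using True e by (intro exI[of _ "\<lambda>_. 1"]) auto
next
  case False
  \<comment> \<open>Increases to the indicator of W with n and stays below the indicator of
    \<open>V j\<close>, which has finite mass: dominated convergence applies.\<close>
  define f where "f n x = min 1 (real n * infdist x (- W))" for n x
  have cl: "closed (- W)" "- W \<noteq> {}" using W False by auto
  have fl: "(real n)-lipschitz_on UNIV (f n)" for n
    unfolding f_def
  proof (intro lipschitz_on_max_real lipschitz_on_const_ge lipschitz_onI)
    fix x y
    show "dist (real n * infdist x (- W)) (real n * infdist y (- W)) \<le> real n * dist x y"
      using mult_left_mono[OF infdist_triangle_abs[of x "-W" y], of "real n"]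
      by (simp add: dist_real_def abs_mult flip: right_diff_distrib)
  qed auto
  have fW: "{x. f n x \<noteq> 0} \<subseteq> W" for n
  proof
    fix x assume x: "x \<in> {x. f n x \<noteq> 0}"
    show "x \<in> W"
    proof (rule ccontr)
      assume "x \<notin> W"
      then have "infdist x (- W) = 0" by simp
      then show False using x by (simp add: f_def)
    qed
  qed
  have lf: "lipc (f n)" for n using lipcI_V[OF fl] fW W(2) by blast
  have f01: "0 \<le> f n x" "f n x \<le> 1" for n x unfolding f_def by (auto simp: infdist_nonneg)
  have [measurable]: "f n \<in> borel_measurable borel" "W \<in> sets borel" for n
    using lipc_measurable[OF lf] W by auto
  have lim: "(\<lambda>n. \<bar>f n x - indicator W x\<bar>) \<longlonglongrightarrow> 0" for x
  proof (cases "x \<in> W")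
    case True
    then have "infdist x (- W) > 0" using cl infdist_pos_not_in_closed by (metis ComplD)
    then obtain N where N: "1 < real N * infdist x (- W)" using reals_Archimedean3 by blast
    have "\<forall>\<^sub>F n in sequentially. 0 = \<bar>f n x - indicator W x\<bar>"
      using eventually_ge_at_top[of N]
    proof eventually_elim
      case (elim n)
      have "real N * infdist x (- W) \<le> real n * infdist x (- W)"
        using elim by (intro mult_right_mono) (auto simp: infdist_nonneg)
      then show ?case using N True by (simp add: f_def)
    qed
    then show ?thesis by (rule Lim_transform_eventually[OF tendsto_const])
  next
    case False
    then have "f n x = 0" for n using fW[of n] by blast
    then show ?thesis using False by simp
  qed
  have "(\<lambda>n. L1_dist m (f n) (indicator W)) \<longlonglongrightarrow> (\<integral>x. 0 \<partial>m)"
  proof (rule integral_dominated_convergence[where w="indicator (V j)"])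
    show "integrable m (indicator (V j) :: 'a \<Rightarrow> real)" using emeasure_V_finite by (intro integrable_real_indicator) auto
    show "AE x in m. norm \<bar>f n x - indicator W x\<bar> \<le> indicator (V j) x" for n
    proof (intro AE_I2)
      fix x
      show "norm \<bar>f n x - indicator W x\<bar> \<le> indicator (V j) x"
        using f01[of n x] fW[of n] W(2) by (cases "x \<in> W") (auto simp: indicator_def)
    qed
  qed (use lim in auto)
  then have "(\<lambda>n. L1_dist m (f n) (indicator W)) \<longlonglongrightarrow> 0" by simp
  then have "\<forall>\<^sub>F n in sequentially. L1_dist m (f n) (indicator W) < e"
    using e by (rule order_tendstoD(2))
  then obtain n where "L1_dist m (f n) (indicator W) < e" using eventually_happens by fastforce
  then show ?thesis using lf fW f01 by blast
qed

text \<open>Outer regularity is built into \<open>mass_set\<close>: A is enclosed in an open set of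
  nearly the same mass. Intersecting with W keeps the supports inside W.\<close>

lemma indicator_approx:
  assumes A: "A \<in> sets borel" "A \<subseteq> W" and W: "open W" "W \<subseteq> V j" and e: "0 < e"
  obtains f where "lipc f" "{x. f x \<noteq> 0} \<subseteq> W" "\<And>x. 0 \<le> f x" "\<And>x. f x \<le> 1"
    "L1_dist m f (indicator A) < e"
proof -
  have finA: "emeasure m A < top"
    using emeasure_V_finite[of j] emeasure_mono[of A "V j" m] order_trans[OF A(2) W(2)] by (simp add: le_less_trans)
  then obtain U where U: "open U" "A \<subseteq> U" "mass_open k T U \<le> mass_set k T A + ennreal (e/2)"
    using mass_set_approx[of A "e/2"] e emeasure_mass[OF A(1)] by auto
  define U' where "U' = U \<inter> W"
  have U': "open U'" "U' \<subseteq> V j" "A \<subseteq> U'" "U' \<subseteq> W" "U' \<in> sets borel"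
    using U W A unfolding U'_def by (auto intro: open_Int)
  have "emeasure m U' \<le> emeasure m U"
    using U(1) U' unfolding U'_def by (intro emeasure_mono) auto
  also have "\<dots> \<le> emeasure m A + ennreal (e/2)"
    using U emeasure_mass[of U] emeasure_mass[OF A(1)] mass_set_open[of U] by simp
  finally have le: "emeasure m U' \<le> emeasure m A + ennreal (e/2)" .
  have finU': "emeasure m U' < top"
    using emeasure_V_finite[of j] emeasure_mono[of U' "V j" m] U' by (simp add: le_less_trans)
  have mU': "measure m U' \<le> measure m A + e/2"
  proof -
    have "ennreal (measure m U') \<le> ennreal (measure m A + e/2)"
      using le finA finU' e by (simp add: emeasure_eq_ennreal_measure ennreal_plus)
    then show ?thesis using e by (subst (asm) ennreal_le_iff) auto
  qed
  obtain f where f: "lipc f" "{x. f x \<noteq> 0} \<subseteq> U'" "\<And>x. 0 \<le> f x" "\<And>x. f x \<le> 1"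
    "L1_dist m f (indicator U') < e/2"
    using indicator_approx_open[OF U'(1,2), of "e/2"] e by auto
  have ints: "integrable m (indicator A :: 'a \<Rightarrow> real)" "integrable m (indicator U' :: 'a \<Rightarrow> real)"
    using finA finU' A U' by (auto intro!: integrable_real_indicator)
  have "L1_dist m f (indicator A) \<le> (\<integral>x. \<bar>f x - indicator U' x\<bar> + (indicator U' x - indicator A x) \<partial>m)"
  proof (rule integral_mono)
    show "integrable m (\<lambda>x. \<bar>f x - indicator A x\<bar>)"
      "integrable m (\<lambda>x. \<bar>f x - indicator U' x\<bar> + (indicator U' x - indicator A x))"
      using ints lipc_integrable[OF f(1)] by auto
    show "\<bar>f x - indicator A x\<bar> \<le> \<bar>f x - indicator U' x\<bar> + (indicator U' x - indicator A x)" for x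
      using U'(3) by (auto simp: indicator_def)
  qed
  also have "\<dots> = L1_dist m f (indicator U') + (measure m U' - measure m A)"
    using ints lipc_integrable[OF f(1)] by simp
  also have "\<dots> < e" using f(5) mU' by simp
  finally show ?thesis using that[OF f(1) _ f(3,4)] f(2) U'(4) by blast
qed

end

section \<open>Bounded functionals on a dense subspace of L1\<close>

text \<open>Bounded functionals on L1 come from bounded functions, here for a functional known only
  on a dense subspace. Its values \<open>E A\<close> on indicators are obtained as limits; E + C * M
  is a measure with values between 0 and 2 * C * M, and its Radon-Nikodym density minus C is h. The
  density of D in L1 is a by-product.\<close>

lemma L1_functional_representation:
  fixes M :: "'a measure" and D :: "('a \<Rightarrow> real) set" and L :: "('a \<Rightarrow> real) \<Rightarrow> real"
  assumes fin: "finite_measure M" and C: "0 \<le> C"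
    and D_int: "\<And>f. f \<in> D \<Longrightarrow> integrable M f"
    and D_lin: "\<And>f g a b. f \<in> D \<Longrightarrow> g \<in> D \<Longrightarrow> (\<lambda>x. a * f x + b * g x) \<in> D"
    and L_lin: "\<And>f g a b. f \<in> D \<Longrightarrow> g \<in> D \<Longrightarrow> L (\<lambda>x. a * f x + b * g x) = a * L f + b * L g"
    and bd: "\<And>f. f \<in> D \<Longrightarrow> \<bar>L f\<bar> \<le> C * L1_norm M f"
    and dense: "\<And>A e. A \<in> sets M \<Longrightarrow> 0 < e \<Longrightarrow> \<exists>f\<in>D. L1_dist M f (indicator A) < e"
  obtains h where "h \<in> borel_measurable M" "\<And>x. \<bar>h x\<bar> \<le> C" "\<And>f. f \<in> D \<Longrightarrow> L f = pairing M f h"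
    "\<And>\<beta> e. integrable M \<beta> \<Longrightarrow> 0 < e \<Longrightarrow> \<exists>f\<in>D. L1_dist M f \<beta> < e"
proof -
  interpret finite_measure M by (rule fin)
  have D_diff: "(\<lambda>x. f x - g x) \<in> D" "L (\<lambda>x. f x - g x) = L f - L g" if "f \<in> D" "g \<in> D" for f g
    using D_lin[OF that, of 1 "-1"] L_lin[OF that, of 1 "-1"] by auto
  have triangle: "L1_dist M f g \<le> L1_dist M f u + L1_dist M g u"
    if "integrable M f" "integrable M g" "integrable M u" for f g u :: "'a \<Rightarrow> real"
  proof -
    have "L1_dist M f g \<le> (\<integral>x. \<bar>f x - u x\<bar> + \<bar>g x - u x\<bar> \<partial>M)"
      using that by (intro integral_mono) auto
    then show ?thesis using that by simp
  qed
  have ind: "integrable M (indicator A :: 'a \<Rightarrow> real)" if "A \<in> sets M" for A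
    using that by (intro integrable_real_indicator) (auto simp: emeasure_eq_measure)
  \<comment> \<open>The closure of the graph of L in L1 times the reals. Working with this relation
    postpones the question whether the extension is total and single-valued.\<close>
  define R where "R \<beta> r \<longleftrightarrow> (\<forall>e>0. \<exists>d\<in>D. L1_dist M d \<beta> < e \<and> \<bar>L d - r\<bar> < e)" for \<beta> r
  have R_self: "R f (L f)" if "f \<in> D" for f unfolding R_def using that by (auto intro!: bexI[of _ f])
  have R_lin: "R (\<lambda>x. a * \<beta> x + b * \<gamma> x) (a * r + b * s)"
    if i: "integrable M \<beta>" "integrable M \<gamma>" and R: "R \<beta> r" "R \<gamma> s" for \<beta> \<gamma> a b r s
    unfolding R_def
  proof (intro allI impI)
    fix e :: real assume e: "0 < e"
    define e' where "e' = e / (\<bar>a\<bar> + \<bar>b\<bar> + 1)"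
    have e': "0 < e'" unfolding e'_def using e by (intro divide_pos_pos) auto
    have sum: "\<bar>a\<bar> * e' + \<bar>b\<bar> * e' + e' = e"
      unfolding e'_def by (simp add: divide_simps) (simp add: algebra_simps)
    obtain d where d: "d \<in> D" "L1_dist M d \<beta> < e'" "\<bar>L d - r\<bar> < e'" using R(1) e' unfolding R_def by blast
    obtain d' where d': "d' \<in> D" "L1_dist M d' \<gamma> < e'" "\<bar>L d' - s\<bar> < e'" using R(2) e' unfolding R_def by blast
    have le: "\<bar>a\<bar> * u + \<bar>b\<bar> * v < e" if "u < e'" "v < e'" for u v
      using mult_left_mono[of u e' "\<bar>a\<bar>"] mult_left_mono[of v e' "\<bar>b\<bar>"] that e' sum by linarith
    have tri: "\<bar>a * x + b * y - (a * x' + b * y')\<bar> \<le> \<bar>a\<bar> * \<bar>x - x'\<bar> + \<bar>b\<bar> * \<bar>y - y'\<bar>" for x y x' y' :: real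
      using abs_triangle_ineq[of "a * (x - x')" "b * (y - y')"] by (simp add: abs_mult[symmetric] algebra_simps)
    have "(\<integral>x. \<bar>a * d x + b * d' x - (a * \<beta> x + b * \<gamma> x)\<bar> \<partial>M)
        \<le> (\<integral>x. \<bar>a\<bar> * \<bar>d x - \<beta> x\<bar> + \<bar>b\<bar> * \<bar>d' x - \<gamma> x\<bar> \<partial>M)"
      using i D_int[OF d(1)] D_int[OF d'(1)] by (intro integral_mono tri) auto
    also have "\<dots> = \<bar>a\<bar> * L1_dist M d \<beta> + \<bar>b\<bar> * L1_dist M d' \<gamma>"
      using i D_int[OF d(1)] D_int[OF d'(1)] by simp
    also have "\<dots> < e" by (rule le[OF d(2) d'(2)])
    finally have 1: "(\<integral>x. \<bar>a * d x + b * d' x - (a * \<beta> x + b * \<gamma> x)\<bar> \<partial>M) < e" .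
    have "\<bar>L (\<lambda>x. a * d x + b * d' x) - (a * r + b * s)\<bar> < e"
      unfolding L_lin[OF d(1) d'(1)] using tri le[OF d(3) d'(3)] by (rule le_less_trans)
    with 1 show "\<exists>d\<in>D. (\<integral>x. \<bar>d x - (a * \<beta> x + b * \<gamma> x)\<bar> \<partial>M) < e \<and> \<bar>L d - (a * r + b * s)\<bar> < e"
      using D_lin[OF d(1) d'(1), of a b] by (intro bexI[of _ "\<lambda>x. a * d x + b * d' x"]) auto
  qed
  have R_bound: "\<bar>r\<bar> \<le> C * L1_norm M \<beta>" if i: "integrable M \<beta>" and R: "R \<beta> r" for \<beta> r
  proof (rule field_le_epsilon)
    fix e :: real assume e: "0 < e"
    define e' where "e' = e / (C + 1)"
    have e': "0 < e'" "C * e' + e' = e" unfolding e'_def using e C by (auto simp: field_simps add_nonneg_eq_0_iff)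
    obtain d where d: "d \<in> D" "L1_dist M d \<beta> < e'" "\<bar>L d - r\<bar> < e'" using R e' unfolding R_def by blast
    have "L1_norm M d \<le> L1_dist M d \<beta> + L1_norm M \<beta>"
      using triangle[OF D_int[OF d(1)] _ i, of "\<lambda>_. 0"] by simp
    then have "C * L1_norm M d \<le> C * (e' + L1_norm M \<beta>)" using d(2) C by (intro mult_left_mono) auto
    then show "\<bar>r\<bar> \<le> C * L1_norm M \<beta> + e" using bd[OF d(1)] d(3) e'(2) unfolding distrib_left by linarith
  qed
  \<comment> \<open>The relation is linear, so the difference of two values is attached to the zero
    function, where the bound forces it to be 0.\<close>
  have R_unique: "r = s" if "integrable M \<beta>" "R \<beta> r" "R \<beta> s" for \<beta> r s
    using R_bound[OF _ R_lin[OF that(1) that(1) that(2,3), of 1 "-1"]] by simp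
  have R_lim: "R \<beta> r" if i: "integrable M \<beta>"
    and ap: "\<And>e. 0 < e \<Longrightarrow> \<exists>\<gamma> s. integrable M \<gamma> \<and> R \<gamma> s \<and> L1_dist M \<beta> \<gamma> < e \<and> \<bar>s - r\<bar> < e" for \<beta> r
    unfolding R_def
  proof (intro allI impI)
    fix e :: real assume "0 < e"
    then have e: "0 < e / 2" by simp
    obtain \<gamma> s where \<gamma>: "integrable M \<gamma>" "R \<gamma> s" "L1_dist M \<beta> \<gamma> < e/2" "\<bar>s - r\<bar> < e/2" using ap[OF e] by blast
    obtain d where d: "d \<in> D" "L1_dist M d \<gamma> < e/2" "\<bar>L d - s\<bar> < e/2" using \<gamma>(2) e unfolding R_def by blast
    have "L1_dist M d \<beta> < e" using triangle[OF D_int[OF d(1)] i \<gamma>(1)] \<gamma>(3) d(2) by linarith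
    moreover have "\<bar>L d - r\<bar> < e" using \<gamma>(4) d(3) by linarith
    ultimately show "\<exists>d\<in>D. L1_dist M d \<beta> < e \<and> \<bar>L d - r\<bar> < e" using d(1) by blast
  qed
  have R_ex: "\<exists>r. R (indicator A) r" if A: "A \<in> sets M" for A
  proof -
    have "\<forall>n. \<exists>f. f \<in> D \<and> L1_dist M f (indicator A) < 1 / real (Suc n)" using dense[OF A] by (simp add: Bex_def)
    from choice[OF this] obtain F where F: "\<And>n. F n \<in> D" "\<And>n. L1_dist M (F n) (indicator A) < 1 / real (Suc n)" by blast
    have small: "\<exists>N. \<forall>n\<ge>N. L1_dist M (F n) (indicator A) < e" if pos: "0 < e" for e
    proof -
      obtain N where "1 / real (Suc N) < e" using nat_approx_posE[OF pos] by blast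
      then have "L1_dist M (F n) (indicator A) < e" if "n \<ge> N" for n
        using F(2)[of n] that frac_le[of 1 1 "real (Suc N)" "real (Suc n)"] by simp
      then show ?thesis by blast
    qed
    \<comment> \<open>L is C-Lipschitz on D for the L1 distance, so its values along an
      approximating sequence form a Cauchy sequence.\<close>
    have "Cauchy (\<lambda>n. L (F n))"
    proof (rule metric_CauchyI)
      fix e :: real assume e: "0 < e"
      then have e': "0 < e / (C + 1) / 2" using C by simp
      obtain N where N: "\<And>n. n \<ge> N \<Longrightarrow> L1_dist M (F n) (indicator A) < e / (C + 1) / 2" using small[OF e'] by blast
      have "dist (L (F i)) (L (F n)) < e" if "i \<ge> N" "n \<ge> N" for i n
      proof -
        have "\<bar>L (F i) - L (F n)\<bar> \<le> C * L1_dist M (F i) (F n)"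
          using bd[OF D_diff(1)[OF F(1) F(1)]] D_diff(2)[OF F(1) F(1)] by simp
        also have "\<dots> \<le> C * (e / (C + 1))"
          using triangle[OF D_int[OF F(1)] D_int[OF F(1)] ind[OF A], of i n] N[OF that(1)] N[OF that(2)] C
          by (intro mult_left_mono) linarith+
        also have "\<dots> < e" using e C by (simp add: field_simps)
        finally show ?thesis by (simp add: dist_real_def)
      qed
      then show "\<exists>N. \<forall>i\<ge>N. \<forall>n\<ge>N. dist (L (F i)) (L (F n)) < e" by blast
    qed
    then obtain r where r: "(\<lambda>n. L (F n)) \<longlonglongrightarrow> r" using Cauchy_convergent convergentD by blast
    have "R (indicator A) r"
      unfolding R_def
    proof (intro allI impI)
      fix e :: real assume e: "0 < e"
      obtain N where N: "\<And>n. n \<ge> N \<Longrightarrow> L1_dist M (F n) (indicator A) < e" using small[OF e] by blast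
      obtain N' where N': "\<And>n. n \<ge> N' \<Longrightarrow> \<bar>L (F n) - r\<bar> < e" using metric_LIMSEQ_D[OF r e] by (auto simp: dist_real_def)
      show "\<exists>d\<in>D. L1_dist M d (indicator A) < e \<and> \<bar>L d - r\<bar> < e"
        using N[of "max N N'"] N'[of "max N N'"] F(1) by auto
    qed
    then show ?thesis by blast
  qed
  define E where "E A = (SOME r. R (indicator A) r)" for A
  have E: "R (indicator A) (E A)" if "A \<in> sets M" for A unfolding E_def by (rule someI_ex[OF R_ex[OF that]])
  have E_le: "\<bar>E A\<bar> \<le> C * measure M A" if A: "A \<in> sets M" for A
    using R_bound[OF ind[OF A] E[OF A]] A by simp
  have E_add: "E (A \<union> B) = E A + E B" if A: "A \<in> sets M" and B: "B \<in> sets M" and AB: "A \<inter> B = {}" for A B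
  proof -
    have "(\<lambda>x. 1 * indicator A x + 1 * indicator B x) = (indicator (A \<union> B) :: 'a \<Rightarrow> real)"
      using AB by (auto simp: indicator_def fun_eq_iff)
    then have "R (indicator (A \<union> B)) (E A + E B)"
      using R_lin[OF ind[OF A] ind[OF B] E[OF A] E[OF B], of 1 1] by simp
    then show ?thesis using R_unique[OF ind[OF sets.Un[OF A B]] E[OF sets.Un[OF A B]]] by blast
  qed
  \<comment> \<open>E is signed and dominated by C * M; adding C * M makes it nonnegative, so that
    the Radon-Nikodym theorem for measures applies.\<close>
  define nu where "nu A = ennreal (E A + C * measure M A)" for A
  have pos: "0 \<le> E A + C * measure M A" "E A + C * measure M A \<le> 2 * C * measure M A" if "A \<in> sets M" for A
    using E_le[OF that] by (auto simp: abs_le_iff)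
  have E_empty: "E {} = 0" using E_le[of "{}"] by simp
  have ca: "countably_additive (sets M) nu"
  \<comment> \<open>For a finite additive set function countable additivity is continuity at the
    empty set, and domination by 2 * C * M provides it.\<close>
  proof (rule sets.empty_continuous_imp_countably_additive)
    show "positive (sets M) nu" unfolding positive_def nu_def using E_empty by simp
    show "additive (sets M) nu"
      unfolding additive_def nu_def
      using pos by (auto simp: E_add finite_measure_Union algebra_simps simp flip: ennreal_plus)
    show "\<forall>A\<in>sets M. nu A \<noteq> \<infinity>" by (simp add: nu_def)
    fix A :: "nat \<Rightarrow> 'a set" assume A: "range A \<subseteq> sets M" "decseq A" "(\<Inter>i. A i) = {}"
    have "(\<lambda>i. measure M (A i)) \<longlonglongrightarrow> measure M (\<Inter>i. A i)"
      using A by (intro finite_Lim_measure_decseq)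
    then have m0: "(\<lambda>i. 2 * C * measure M (A i)) \<longlonglongrightarrow> 0"
      using A(3) tendsto_mult_right_zero[of "\<lambda>i. measure M (A i)" sequentially "2 * C"] by simp
    have "(\<lambda>i. E (A i) + C * measure M (A i)) \<longlonglongrightarrow> 0"
      by (rule tendsto_sandwich[OF _ _ tendsto_const m0]) (use pos A(1) in auto)
    then show "(\<lambda>i. nu (A i)) \<longlonglongrightarrow> 0" unfolding nu_def using tendsto_ennrealI by fastforce
  qed
  define N where "N = measure_of (space M) (sets M) nu"
  have setsN [simp]: "sets N = sets M" "space N = space M" by (simp_all add: N_def)
  have emN: "emeasure N A = nu A" if "A \<in> sets M" for A
    unfolding N_def using that ca E_empty
    by (intro emeasure_measure_of_sigma) (auto simp: positive_def nu_def sets.sigma_algebra_axioms)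
  have "absolutely_continuous M N"
    unfolding absolutely_continuous_def
  proof
    fix A assume "A \<in> null_sets M"
    then have "A \<in> sets M" "measure M A = 0" by (auto simp: measure_def)
    then show "A \<in> null_sets N" using E_le[of A] emN[of A] by (auto simp: null_sets_def nu_def)
  qed
  then obtain \<phi> where \<phi> [measurable]: "\<phi> \<in> borel_measurable M" and dN: "density M \<phi> = N"
    using Radon_Nikodym[of N] by auto
  have nnI: "(\<integral>\<^sup>+x. \<phi> x * indicator A x \<partial>M) = nu A" if "A \<in> sets M" for A
    using emN[OF that] emeasure_density[OF \<phi> that] dN by simp
  have fin_int: "(\<integral>\<^sup>+x. \<phi> x \<partial>M) \<noteq> \<infinity>"
  proof -
    have "(\<integral>\<^sup>+x. \<phi> x \<partial>M) = (\<integral>\<^sup>+x. \<phi> x * indicator (space M) x \<partial>M)"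
      by (intro nn_integral_cong) simp
    then show ?thesis using nnI[of "space M"] by (simp add: nu_def)
  qed
  then have AEfin: "AE x in M. \<phi> x \<noteq> \<infinity>" by (intro nn_integral_noteq_infinite) auto
  define u where "u x = enn2real (\<phi> x)" for x
  have [measurable]: "u \<in> borel_measurable M" unfolding u_def by measurable
  have AEu: "AE x in M. ennreal (u x) = \<phi> x"
    using AEfin unfolding u_def by eventually_elim (simp add: less_top)
  have u_int: "integrable M u"
  proof (rule integrableI_nonneg)
    have "(\<integral>\<^sup>+x. ennreal (u x) \<partial>M) = (\<integral>\<^sup>+x. \<phi> x \<partial>M)" using AEu by (intro nn_integral_cong_AE)
    then show "(\<integral>\<^sup>+x. ennreal (u x) \<partial>M) < \<infinity>" using fin_int by (simp add: less_top)
  qed (auto simp: u_def)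
  have int_u: "pairing M u (indicator A) = E A + C * measure M A" if A: "A \<in> sets M" for A
  proof (rule integral_eq_nn_integral[THEN trans])
    have "AE x in M. ennreal (u x * indicator A x) = \<phi> x * indicator A x"
      using AEu by eventually_elim (auto simp: indicator_def)
    then have "(\<integral>\<^sup>+x. ennreal (u x * indicator A x) \<partial>M) = (\<integral>\<^sup>+x. \<phi> x * indicator A x \<partial>M)"
      by (rule nn_integral_cong_AE)
    then show "enn2real (\<integral>\<^sup>+x. ennreal (u x * indicator A x) \<partial>M) = E A + C * measure M A"
      using nnI[OF A] pos(1)[OF A] by (simp add: nu_def)
  qed (use A in \<open>auto simp: u_def\<close>)
  have u_le: "AE x in M. 0 \<le> 2 * C - u x"
  proof (rule density_nonneg)
    show "integrable M (\<lambda>x. 2 * C - u x)" using u_int by auto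
    fix A assume A: "A \<in> sets M"
    have i: "integrable M (\<lambda>x. u x * indicator A x)" "integrable M (\<lambda>x. 2 * C * indicator A x)"
      using integrable_real_mult_indicator[OF A u_int] ind[OF A] by auto
    have "(\<integral>x\<in>A. (2 * C - u x) \<partial>M) = (\<integral>x. 2 * C * indicator A x - u x * indicator A x \<partial>M)"
      unfolding set_lebesgue_integral_def by (intro Bochner_Integration.integral_cong) (auto simp: algebra_simps)
    also have "\<dots> = 2 * C * measure M A - (E A + C * measure M A)"
      using Bochner_Integration.integral_diff[OF i(2,1)] int_u[OF A] A by simp
    finally show "0 \<le> (\<integral>x\<in>A. (2 * C - u x) \<partial>M)" using pos(2)[OF A] by simp
  qed
  \<comment> \<open>The truncation makes the bound by C hold at every point; since 0 \<le> u \<le> 2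
    * C almost everywhere, it changes u - C on a null set only.\<close>
  define h where "h x = max (- C) (min C (u x - C))" for x
  have [measurable]: "h \<in> borel_measurable M" unfolding h_def by measurable
  have h_bd: "\<bar>h x\<bar> \<le> C" for x unfolding h_def using C by auto
  have h_int: "integrable M (\<lambda>x. \<beta> x * h x)" if "integrable M \<beta>" for \<beta>
  proof (rule Bochner_Integration.integrable_bound[of M "\<lambda>x. C * \<beta> x"])
    show "integrable M (\<lambda>x. C * \<beta> x)" using that by auto
    show "(\<lambda>x. \<beta> x * h x) \<in> borel_measurable M" using that by auto
    show "AE x in M. norm (\<beta> x * h x) \<le> norm (C * \<beta> x)"
      using h_bd C by (intro AE_I2) (auto simp: abs_mult mult.commute[of C] intro: mult_left_mono)
  qed
  have h_L1: "\<bar>pairing M \<beta> h\<bar> \<le> C * L1_norm M \<beta>" if "integrable M \<beta>" for \<beta>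
  proof -
    have "\<bar>pairing M \<beta> h\<bar> \<le> (\<integral>x. \<bar>\<beta> x * h x\<bar> \<partial>M)" by (rule integral_abs_bound)
    also have "\<dots> \<le> (\<integral>x. C * \<bar>\<beta> x\<bar> \<partial>M)"
    proof (rule integral_mono)
      show "\<bar>\<beta> x * h x\<bar> \<le> C * \<bar>\<beta> x\<bar>" for x
        using h_bd[of x] by (auto simp: abs_mult mult.commute[of C] intro: mult_left_mono)
    qed (use that h_int[OF that] in auto)
    finally show ?thesis using that by simp
  qed
  have int_h: "pairing M (indicator A) h = E A" if A: "A \<in> sets M" for A
  proof -
    have i: "integrable M (\<lambda>x. u x * indicator A x)" "integrable M (\<lambda>x. C * indicator A x)"
      using integrable_real_mult_indicator[OF A u_int] ind[OF A] by auto
    have "AE x in M. indicator A x * h x = u x * indicator A x - C * indicator A x"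
      using u_le
    proof eventually_elim
      case (elim x)
      moreover have "0 \<le> u x" by (simp add: u_def)
      ultimately have "h x = u x - C" unfolding h_def by auto
      then show ?case by (auto simp: indicator_def)
    qed
    then have "pairing M (indicator A) h = (\<integral>x. u x * indicator A x - C * indicator A x \<partial>M)"
      using A by (intro integral_cong_AE) auto
    also have "\<dots> = E A" using Bochner_Integration.integral_diff[OF i] int_u[OF A] A by simp
    finally show ?thesis .
  qed
  \<comment> \<open>The relation is propagated rather than an equation: it says at once that \<beta>
    is a limit of elements of D and that the integral is the limit of L along them.\<close>
  have P: "R \<beta> (pairing M \<beta> h)" if "integrable M \<beta>" for \<beta>
    using that
  proof (induction rule: integrable_induct)
    case (base A c)
    have "pairing M (\<lambda>x. indicator A x *\<^sub>R c) h = (\<integral>x. c * (indicator A x * h x) \<partial>M)"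
      by (intro Bochner_Integration.integral_cong) (auto simp: indicator_def)
    then have "pairing M (\<lambda>x. indicator A x *\<^sub>R c) h = c * E A" by (simp add: int_h[OF base(1)])
    then show ?case using R_lin[OF ind[OF base(1)] ind[OF base(1)] E[OF base(1)] E[OF base(1)], of c 0]
      by (simp add: mult.commute)
  next
    case (add f g)
    have "pairing M (\<lambda>x. f x + g x) h = pairing M f h + pairing M g h"
      using h_int[OF add.hyps(1)] h_int[OF add.hyps(2)] by (simp add: distrib_right)
    then show ?case using R_lin[OF add.hyps add.IH, of 1 1] by simp
  next
    case (lim f s)
    show ?case
    proof (rule R_lim[OF lim.hyps(4)])
      fix e :: real assume e: "0 < e"
      have "(\<lambda>i. L1_dist M f (s i)) \<longlonglongrightarrow> (\<integral>x. 0 \<partial>M)"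
      \<comment> \<open>The approximating functions satisfy |s i x| \<le> 2 * |f x|, whence the
        factor 3.\<close>
      proof (rule integral_dominated_convergence[where w="\<lambda>x. 3 * \<bar>f x\<bar>"])
        show "AE x in M. (\<lambda>i. \<bar>f x - s i x\<bar>) \<longlonglongrightarrow> 0"
        proof (intro AE_I2 tendsto_rabs_zero)
          fix x assume "x \<in> space M"
          then show "(\<lambda>i. f x - s i x) \<longlonglongrightarrow> 0" using tendsto_diff[OF tendsto_const lim.hyps(2), of x "f x"] by simp
        qed
        show "AE x in M. norm \<bar>f x - s i x\<bar> \<le> 3 * \<bar>f x\<bar>" for i
          using lim.hyps(3)[of _ i] by (intro AE_I2) fastforce
      qed (use lim.hyps in auto)
      moreover have "0 < e / (C + 1)" using e C by simp
      ultimately have "\<forall>\<^sub>F i in sequentially. L1_dist M f (s i) < e / (C + 1)" using order_tendstoD(2) by fastforce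
      then obtain i where i: "L1_dist M f (s i) < e / (C + 1)" using eventually_happens by fastforce
      have "e / (C + 1) \<le> e" using e C by (simp add: field_simps)
      then have 1: "L1_dist M f (s i) < e" using i by linarith
      have "pairing M (s i) h - pairing M f h = (\<integral>x. (s i x - f x) * h x \<partial>M)"
        using h_int[OF lim.hyps(1)] h_int[OF lim.hyps(4)] by (simp add: left_diff_distrib)
      then have "\<bar>pairing M (s i) h - pairing M f h\<bar> \<le> C * L1_dist M (s i) f"
        using h_L1[of "\<lambda>x. s i x - f x"] lim.hyps(1,4) by simp
      also have "\<dots> \<le> C * (e / (C + 1))" using i C by (intro mult_left_mono) (auto simp: abs_minus_commute)
      also have "\<dots> < e" using e C by (simp add: field_simps)
      finally show "\<exists>\<gamma> r. integrable M \<gamma> \<and> R \<gamma> r \<and> L1_dist M f \<gamma> < e \<and> \<bar>r - pairing M f h\<bar> < e"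
        using 1 lim.hyps(1)[of i] lim.IH[of i] by blast
    qed
  qed
  show ?thesis
  proof (rule that[of h])
    show "L f = pairing M f h" if "f \<in> D" for f
      by (rule R_unique[OF D_int R_self P[OF D_int]]) (rule that)+
    show "\<exists>f\<in>D. L1_dist M f \<beta> < e" if "integrable M \<beta>" "0 < e" for \<beta> e
      using P[OF that(1)] that(2) unfolding R_def by blast
  qed (use h_bd in auto)
qed

section \<open>The density of a current with respect to its mass\<close>

lemma integral_mult_bound:
  fixes u v :: "'a \<Rightarrow> real"
  assumes u: "integrable M u" and v [measurable]: "v \<in> borel_measurable M"
    and bd: "AE x in M. u x \<noteq> 0 \<longrightarrow> \<bar>v x\<bar> \<le> C" and C: "0 \<le> C"
  shows "integrable M (\<lambda>x. u x * v x)" "\<bar>pairing M u v\<bar> \<le> C * L1_norm M u"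
proof -
  have [measurable]: "u \<in> borel_measurable M" using u by auto
  have le: "AE x in M. \<bar>u x * v x\<bar> \<le> C * \<bar>u x\<bar>"
    using bd
  proof eventually_elim
    case (elim x)
    then show ?case by (cases "u x = 0") (auto simp: abs_mult mult.commute[of C] intro: mult_left_mono)
  qed
  show i: "integrable M (\<lambda>x. u x * v x)"
    by (rule Bochner_Integration.integrable_bound[of M "\<lambda>x. C * \<bar>u x\<bar>"]) (use u le C in \<open>auto simp: abs_mult\<close>)
  have "\<bar>pairing M u v\<bar> \<le> (\<integral>x. \<bar>u x * v x\<bar> \<partial>M)" by (rule integral_abs_bound)
  also have "\<dots> \<le> (\<integral>x. C * \<bar>u x\<bar> \<partial>M)"
    by (rule integral_mono_AE[OF integrable_abs[OF i] _ le]) (use u in auto)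
  finally show "\<bar>pairing M u v\<bar> \<le> C * L1_norm M u" by simp
qed

lemma ktuple_lipschitz_constants:
  assumes g: "ktuple k g" and K: "compact K"
  obtains L where "\<And>i. i < k \<Longrightarrow> 0 < L i" "\<And>i. i < k \<Longrightarrow> (L i)-lipschitz_on K (g i)"
proof -
  have "\<forall>i\<in>{..<k}. \<exists>C. 0 < C \<and> C-lipschitz_on K (g i)"
  proof
    fix i assume "i \<in> {..<k}"
    then have "liploc (g i)" using g unfolding ktuple_def by blast
    then show "\<exists>C. 0 < C \<and> C-lipschitz_on K (g i)" by (rule liploc_positive_constant[OF _ K]) blast
  qed
  then obtain L where "\<forall>i\<in>{..<k}. 0 < L i \<and> (L i)-lipschitz_on K (g i)"
    by (rule bchoice[THEN exE])
  then show ?thesis using that by blast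
qed

context lf_current
begin

text \<open>Boundedness is demanded at every point of \<open>V j\<close>, hence on every compact
  set; pairing with integrable functions supported in one \<open>V j\<close> is then defined and
  continuous in L1.\<close>

definition lbdd :: "('a \<Rightarrow> real) \<Rightarrow> bool" where
  "lbdd h \<longleftrightarrow> h \<in> borel_measurable borel \<and> (\<forall>j. \<exists>B. \<forall>x\<in>V j. \<bar>h x\<bar> \<le> B)"

lemma lbdd_measurable: "lbdd h \<Longrightarrow> h \<in> borel_measurable borel"
  by (simp add: lbdd_def)

lemma lbdd_bound: assumes "lbdd h" obtains B where "0 \<le> B" "\<And>x. x \<in> V j \<Longrightarrow> \<bar>h x\<bar> \<le> B"
proof -
  obtain B where "\<And>x. x \<in> V j \<Longrightarrow> \<bar>h x\<bar> \<le> B" using assms unfolding lbdd_def by blast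
  then have "\<bar>h x\<bar> \<le> max 0 B" if "x \<in> V j" for x using that by fastforce
  then show ?thesis using that[of "max 0 B"] by auto
qed

lemma lbdd_linear: assumes "lbdd h" "lbdd h'" shows "lbdd (\<lambda>x. a * h x + b * h' x)"
  unfolding lbdd_def
proof (intro conjI allI)
  show "(\<lambda>x. a * h x + b * h' x) \<in> borel_measurable borel"
    using assms[THEN lbdd_measurable] by auto
  fix j
  obtain B where B: "0 \<le> B" "\<And>x. x \<in> V j \<Longrightarrow> \<bar>h x\<bar> \<le> B" using lbdd_bound[OF assms(1)] by blast
  obtain B' where B': "0 \<le> B'" "\<And>x. x \<in> V j \<Longrightarrow> \<bar>h' x\<bar> \<le> B'" using lbdd_bound[OF assms(2)] by blast
  have "\<bar>a * h x + b * h' x\<bar> \<le> \<bar>a\<bar> * B + \<bar>b\<bar> * B'" if "x \<in> V j" for x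
  proof -
    have "\<bar>a * h x + b * h' x\<bar> \<le> \<bar>a\<bar> * \<bar>h x\<bar> + \<bar>b\<bar> * \<bar>h' x\<bar>" by (metis abs_mult abs_triangle_ineq)
    also have "\<dots> \<le> \<bar>a\<bar> * B + \<bar>b\<bar> * B'" using B B' that by (intro add_mono mult_left_mono) auto
    finally show ?thesis .
  qed
  then show "\<exists>B. \<forall>x\<in>V j. \<bar>a * h x + b * h' x\<bar> \<le> B" by blast
qed

lemma lbdd_zero: "lbdd (\<lambda>_. 0)" unfolding lbdd_def by auto

lemma lbdd_diff: "lbdd h \<Longrightarrow> lbdd h' \<Longrightarrow> lbdd (\<lambda>x. h x - h' x)"
  using lbdd_linear[of h h' 1 "-1"] by simp

lemma lbdd_minus: "lbdd h \<Longrightarrow> lbdd (\<lambda>x. - h x)"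
  using lbdd_linear[of h h "-1" 0] by simp

lemma lbdd_pairing:
  assumes h: "lbdd h" and u: "integrable m u" "{x. u x \<noteq> 0} \<subseteq> V j" and B: "0 \<le> B" "\<And>x. x \<in> V j \<Longrightarrow> \<bar>h x\<bar> \<le> B"
  shows "integrable m (\<lambda>x. u x * h x)" "\<bar>pairing m u h\<bar> \<le> B * L1_norm m u"
proof -
  have 1: "h \<in> borel_measurable m" using lbdd_measurable[OF h] by simp
  have 2: "AE x in m. u x \<noteq> 0 \<longrightarrow> \<bar>h x\<bar> \<le> B" using u(2) B by (intro AE_I2) auto
  show "integrable m (\<lambda>x. u x * h x)" "\<bar>pairing m u h\<bar> \<le> B * L1_norm m u"
    by (rule integral_mult_bound[OF u(1) 1 2 B(1)])+
qed

lemma lbdd_integrable: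
  assumes "lbdd h" "integrable m u" "{x. u x \<noteq> 0} \<subseteq> V j"
  shows "integrable m (\<lambda>x. u x * h x)"
  by (rule lbdd_bound[OF assms(1), of j]) (rule lbdd_pairing(1)[OF assms])

lemma lipc_lbdd_integrable: assumes "lipc f" "lbdd h" shows "integrable m (\<lambda>x. f x * h x)"
  by (rule lipc_subset_V[OF assms(1)]) (rule lbdd_integrable[OF assms(2) lipc_integrable[OF assms(1)]])

lemma indicator_integrable: "A \<in> sets borel \<Longrightarrow> A \<subseteq> V j \<Longrightarrow> integrable m (indicator A :: 'a \<Rightarrow> real)"
  by (rule integrable_if_bounded[of _ 1 j]) (auto simp: indicator_def)

lemma pairing_tendsto:
  assumes h: "lbdd h" and fs: "\<And>l::nat. integrable m (fs l)" "\<And>l. {x. fs l x \<noteq> 0} \<subseteq> V j"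
    and \<beta>: "integrable m \<beta>" "{x. \<beta> x \<noteq> 0} \<subseteq> V j" and lim: "(\<lambda>l. L1_dist m (fs l) \<beta>) \<longlonglongrightarrow> 0"
  shows "(\<lambda>l. pairing m (fs l) h) \<longlonglongrightarrow> pairing m \<beta> h"
proof -
  obtain C where C: "0 \<le> C" "\<And>x. x \<in> V j \<Longrightarrow> \<bar>h x\<bar> \<le> C" using lbdd_bound[OF h] by blast
  have z: "(\<lambda>l. C * L1_dist m (fs l) \<beta>) \<longlonglongrightarrow> 0" by (rule tendsto_mult_right_zero[OF lim])
  have bd: "\<bar>pairing m (fs l) h - pairing m \<beta> h\<bar> \<le> C * L1_dist m (fs l) \<beta>" for l
  proof -
    have "{x. fs l x - \<beta> x \<noteq> 0} \<subseteq> {x. fs l x \<noteq> 0} \<union> {x. \<beta> x \<noteq> 0}" by auto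
    then have s: "{x. fs l x - \<beta> x \<noteq> 0} \<subseteq> V j" using fs(2)[of l] \<beta>(2) by blast
    have "pairing m (fs l) h - pairing m \<beta> h = (\<integral>x. (fs l x - \<beta> x) * h x \<partial>m)"
      using lbdd_integrable[OF h fs] lbdd_integrable[OF h \<beta>] by (simp add: left_diff_distrib)
    then show ?thesis using lbdd_pairing(2)[OF h _ s C] fs(1) \<beta>(1) by simp
  qed
  have "(\<lambda>l. pairing m (fs l) h - pairing m \<beta> h) \<longlonglongrightarrow> 0"
    by (rule tendsto_rabs_zero_cancel, rule tendsto_sandwich[OF _ _ tendsto_const z]) (use bd in auto)
  then show ?thesis by (simp add: LIM_zero_iff)
qed

text \<open>One sequence serves all locally bounded h at once, and its supports stay in the
  prescribed W, so that hypotheses about test functions on W can be used.\<close>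

lemma indicator_approx_sequence:
  assumes A: "A \<in> sets borel" "A \<subseteq> W" and W: "open W" "W \<subseteq> V j"
  obtains fs where "\<And>l::nat. lipc (fs l)" "\<And>l. {x. fs l x \<noteq> 0} \<subseteq> W" "\<And>l x. 0 \<le> fs l x"
    "(\<lambda>l. L1_dist m (fs l) (indicator A)) \<longlonglongrightarrow> 0"
    "\<And>h. lbdd h \<Longrightarrow> (\<lambda>l. pairing m (fs l) h) \<longlonglongrightarrow> pairing m (indicator A) h"
proof -
  have "\<forall>l. \<exists>f. lipc f \<and> {x. f x \<noteq> 0} \<subseteq> W \<and> (\<forall>x. 0 \<le> f x) \<and> L1_dist m f (indicator A) < 1 / real (Suc l)"
  proof
    fix l :: nat
    have "0 < 1 / real (Suc l)" by simp
    then show "\<exists>f. lipc f \<and> {x. f x \<noteq> 0} \<subseteq> W \<and> (\<forall>x. 0 \<le> f x) \<and> L1_dist m f (indicator A) < 1 / real (Suc l)"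
      by (rule indicator_approx[OF A W]) blast
  qed
  from choice[OF this] obtain fs where fs: "\<And>l. lipc (fs l)" "\<And>l. {x. fs l x \<noteq> 0} \<subseteq> W" "\<And>l x. 0 \<le> fs l x"
    "\<And>l. L1_dist m (fs l) (indicator A) < 1 / real (Suc l)" by blast
  have lim: "(\<lambda>l. L1_dist m (fs l) (indicator A)) \<longlonglongrightarrow> 0"
  proof (rule tendsto_sandwich[OF _ _ tendsto_const LIMSEQ_inverse_real_of_nat])
    show "\<forall>\<^sub>F l in sequentially. L1_dist m (fs l) (indicator A) \<le> inverse (real (Suc l))"
      using fs(4) by (intro always_eventually) (auto simp: inverse_eq_divide intro: less_imp_le)
  qed auto
  have "(\<lambda>l. pairing m (fs l) h) \<longlonglongrightarrow> pairing m (indicator A) h" if "lbdd h" for h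
    using A W fs(2) by (intro pairing_tendsto[OF that lipc_integrable[OF fs(1)] _ indicator_integrable _ lim, of j])
      (auto simp: indicator_def)
  then show ?thesis using that fs(1-3) lim by blast
qed

section \<open>Almost everywhere inequalities from Lipschitz test functions\<close>

lemma AE_all_V: assumes "\<And>j. AE x in m. x \<in> V j \<longrightarrow> P x" shows "AE x in m. P x"
proof -
  have "AE x in m. \<forall>j. x \<in> V j \<longrightarrow> P x" 
    by (subst AE_all_countable) (use assms in blast)
  then show ?thesis
  proof eventually_elim
    case (elim x)
    have "x \<in> (\<Union>j. V j)" using V_cover by simp
    then show ?case using elim by blast
  qed
qed

lemma AE_nonpos_of_integral:
  assumes h: "lbdd h" and A: "A \<in> sets borel" "A \<subseteq> V j" and le: "pairing m (indicator A) h \<le> 0"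
    and nn: "\<And>x. x \<in> A \<Longrightarrow> 0 < h x"
  shows "AE x in m. x \<notin> A"
proof -
  have i: "integrable m (\<lambda>x. indicator A x * h x)"
    using A by (intro lbdd_integrable[OF h indicator_integrable]) (auto simp: indicator_def)
  have nn': "0 \<le> indicator A x * h x" for x using nn[of x] by (auto simp: indicator_def)
  have "pairing m (indicator A) h = 0"
  proof (rule antisym[OF le])
    show "0 \<le> pairing m (indicator A) h" by (rule integral_nonneg_AE) (use nn' in auto)
  qed
  then have "AE x in m. indicator A x * h x = 0"
    using integral_nonneg_eq_0_iff_AE[OF i] nn' by auto
  then show ?thesis by eventually_elim (use nn in \<open>force simp: indicator_def\<close>)
qed

text \<open>The indicator of the bad set is in general not Lipschitz. The inequality holds for
  approximations of it supported in W and passes to the limit; on the bad set h - C is positive, so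
  the set is null.\<close>

lemma AE_le_of_test:
  assumes h: "lbdd h" and W: "open W"
    and le: "\<And>f. lipc f \<Longrightarrow> {x. f x \<noteq> 0} \<subseteq> W \<Longrightarrow> pairing m f h \<le> C * L1_norm m f"
  shows "AE x in m. x \<in> W \<longrightarrow> h x \<le> C"
proof (rule AE_all_V)
  fix j
  have hC: "lbdd (\<lambda>x. h x - C)" using lbdd_diff[OF h, of "\<lambda>_. C"] unfolding lbdd_def by auto
  have [measurable]: "h \<in> borel_measurable borel" "W \<in> sets borel" using lbdd_measurable[OF h] W by auto
  define A where "A = {x. x \<in> W \<and> x \<in> V j \<and> C < h x}"
  have A: "A \<in> sets borel" "A \<subseteq> W \<inter> V j" "A \<subseteq> V j"
    unfolding A_def by auto measurable
  have W': "open (W \<inter> V j)" "W \<inter> V j \<subseteq> V j" using W open_V by auto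
  obtain fs where fs: "\<And>l::nat. lipc (fs l)" "\<And>l. {x. fs l x \<noteq> 0} \<subseteq> W \<inter> V j" "\<And>l x. 0 \<le> fs l x"
    "(\<lambda>l. L1_dist m (fs l) (indicator A)) \<longlonglongrightarrow> 0"
    "\<And>h. lbdd h \<Longrightarrow> (\<lambda>l. pairing m (fs l) h) \<longlonglongrightarrow> pairing m (indicator A) h"
    by (rule indicator_approx_sequence[OF A(1,2) W']) (rule that)
  have "(\<integral>x. fs l x * (h x - C) \<partial>m) \<le> 0" for l
  proof -
    have "(\<integral>x. fs l x * (h x - C) \<partial>m) = pairing m (fs l) h - C * (\<integral>x. fs l x \<partial>m)"
      using lipc_lbdd_integrable[OF fs(1) h] lipc_integrable[OF fs(1)]
      by (simp add: right_diff_distrib mult.commute[of _ C])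
    also have "(\<integral>x. fs l x \<partial>m) = L1_norm m (fs l)" using fs(3) by simp
    finally show ?thesis using le[OF fs(1)] fs(2)[of l] by auto
  qed
  then have "(\<integral>x. indicator A x * (h x - C) \<partial>m) \<le> 0"
    using LIMSEQ_le_const2[OF fs(5)[OF hC]] by blast
  then have "AE x in m. x \<notin> A"
    by (rule AE_nonpos_of_integral[OF hC A(1,3)]) (auto simp: A_def)
  then show "AE x in m. x \<in> V j \<longrightarrow> x \<in> W \<longrightarrow> h x \<le> C"
    by eventually_elim (auto simp: A_def)
qed

lemma AE_abs_le_of_test:
  assumes h: "lbdd h" and W: "open W"
    and le: "\<And>f. lipc f \<Longrightarrow> {x. f x \<noteq> 0} \<subseteq> W \<Longrightarrow> \<bar>pairing m f h\<bar> \<le> C * L1_norm m f"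
  shows "AE x in m. x \<in> W \<longrightarrow> \<bar>h x\<bar> \<le> C"
proof -
  have "AE x in m. x \<in> W \<longrightarrow> h x \<le> C" using le by (intro AE_le_of_test h W) (meson abs_le_D1)
  moreover have "AE x in m. x \<in> W \<longrightarrow> - h x \<le> C"
    using le by (intro AE_le_of_test lbdd_minus h W) (simp add: abs_le_iff)
  ultimately show ?thesis by eventually_elim auto
qed

lemma AE_eq_of_test:
  assumes h: "lbdd h" "lbdd h'"
    and eq: "\<And>f. lipc f \<Longrightarrow> pairing m f h = pairing m f h'"
  shows "AE x in m. h x = h' x"
proof -
  have "AE x in m. x \<in> UNIV \<longrightarrow> \<bar>h x - h' x\<bar> \<le> 0"
  proof (rule AE_abs_le_of_test[OF lbdd_diff[OF h]])
    fix f :: "'a \<Rightarrow> real" assume f: "lipc f"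
    have "(\<integral>x. f x * (h x - h' x) \<partial>m) = 0"
      using eq[OF f] lipc_lbdd_integrable[OF f h(1)] lipc_lbdd_integrable[OF f h(2)] by (simp add: right_diff_distrib)
    then show "\<bar>\<integral>x. f x * (h x - h' x) \<partial>m\<bar> \<le> 0 * L1_norm m f" by simp
  qed simp
  then show ?thesis by eventually_elim simp
qed

text \<open>The mass on \<open>V j\<close> is finite, so the L1 representation applies to
  \<open>T\<close> on Lipschitz functions living in \<open>V j\<close>.\<close>

lemma local_density:
  assumes g: "ktuple k g"
  obtains h C where "h \<in> borel_measurable borel" "\<And>x. \<bar>h x\<bar> \<le> C"
    "\<And>f. lipc f \<Longrightarrow> {x. f x \<noteq> 0} \<subseteq> V j \<Longrightarrow> T f g = pairing m f h"
    "\<And>\<beta> e. integrable m \<beta> \<Longrightarrow> {x. \<beta> x \<noteq> 0} \<subseteq> V j \<Longrightarrow> 0 < e \<Longrightarrow>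
       \<exists>f. lipc f \<and> {x. f x \<noteq> 0} \<subseteq> V j \<and> L1_dist m f \<beta> < e"
proof -
  \<comment> \<open>A density with an indicator, in place of a restricted space, keeps the Borel
    sets of all of X.\<close>
  define M where "M = density m (\<lambda>x. ennreal (indicator (V j) x))"
  have sM [measurable_cong, simp]: "sets M = sets borel" by (simp add: M_def)
  have int_M: "(\<integral>x. f x \<partial>M) = (\<integral>x. f x \<partial>m)" if "f \<in> borel_measurable borel" "{x. f x \<noteq> 0} \<subseteq> V j" for f :: "'a \<Rightarrow> real"
  proof -
    have "(\<integral>x. f x \<partial>M) = (\<integral>x. indicator (V j) x *\<^sub>R f x \<partial>m)"
      unfolding M_def by (rule integral_density) (use that in auto)
    also have "(\<lambda>x. indicator (V j) x *\<^sub>R f x) = f" using that(2) by (auto simp: indicator_def fun_eq_iff)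
    finally show ?thesis .
  qed
  have integrable_M: "integrable M f \<longleftrightarrow> integrable m f" if "f \<in> borel_measurable borel" "{x. f x \<noteq> 0} \<subseteq> V j" for f :: "'a \<Rightarrow> real"
  proof -
    have "integrable M f \<longleftrightarrow> integrable m (\<lambda>x. indicator (V j) x *\<^sub>R f x)"
      unfolding M_def by (rule integrable_density) (use that in auto)
    also have "(\<lambda>x. indicator (V j) x *\<^sub>R f x) = f" using that(2) by (auto simp: indicator_def fun_eq_iff)
    finally show ?thesis .
  qed
  define D where "D = {f :: 'a \<Rightarrow> real. lipc f \<and> {x. f x \<noteq> 0} \<subseteq> V j}"
  obtain L where L: "\<And>i. i < k \<Longrightarrow> 0 < L i" "\<And>i. i < k \<Longrightarrow> (L i)-lipschitz_on (closure (V j)) (g i)"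
    using ktuple_lipschitz_constants[OF g closure_V_compact] by blast
  define C where "C = (\<Prod>i<k. L i)"
  have C: "0 \<le> C" unfolding C_def using L(1) by (intro prod_nonneg) (auto intro: less_imp_le)
  have fin: "finite_measure M"
  proof (rule finite_measureI)
    have "emeasure M (space M) = emeasure m (V j)"
      unfolding M_def by (simp add: emeasure_density ennreal_indicator)
    then show "emeasure M (space M) \<noteq> \<infinity>" using emeasure_V_finite[of j] by simp
  qed
  obtain h where h: "h \<in> borel_measurable M" "\<And>x. \<bar>h x\<bar> \<le> C" "\<And>f. f \<in> D \<Longrightarrow> T f g = pairing M f h"
    "\<And>\<beta> e. integrable M \<beta> \<Longrightarrow> 0 < e \<Longrightarrow> \<exists>f\<in>D. L1_dist M f \<beta> < e"
  proof (rule L1_functional_representation[OF fin C, of D "\<lambda>f. T f g"])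
    show "integrable M f" if "f \<in> D" for f
      using that integrable_M[of f] lipc_measurable lipc_integrable unfolding D_def by blast
    show "(\<lambda>x. a * f x + b * f' x) \<in> D" if "f \<in> D" "f' \<in> D" for f f' a b
    proof -
      have "{x. a * f x + b * f' x \<noteq> 0} \<subseteq> {x. f x \<noteq> 0} \<union> {x. f' x \<noteq> 0}" by auto
      then show ?thesis using that lipc_linear unfolding D_def by blast
    qed
    show "T (\<lambda>x. a * f x + b * f' x) g = a * T f g + b * T f' g" if "f \<in> D" "f' \<in> D" for f f' a b
      using that g unfolding D_def by (intro linear) auto
    show "\<bar>T f g\<bar> \<le> C * L1_norm M f" if "f \<in> D" for f
    proof -
      have f: "lipc f" "{x. f x \<noteq> 0} \<subseteq> V j" using that by (auto simp: D_def)
      \<comment> \<open>f vanishes off \<open>V j\<close>, but its support may reach the boundary;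
        this is why the constants were taken on the compact closure.\<close>
      have "fsupp f \<subseteq> closure (V j)" unfolding fsupp_def by (rule closure_mono[OF f(2)])
      then have "\<bar>T f g\<bar> \<le> C * L1_norm m f"
        unfolding C_def using L lipschitz_on_subset by (intro current_le_mass f g) blast+
      then show ?thesis using int_M[of "\<lambda>x. \<bar>f x\<bar>"] lipc_measurable[OF f(1)] f(2) by auto
    qed
    show "\<exists>f\<in>D. L1_dist M f (indicator A) < e" if A: "A \<in> sets M" and e: "0 < e" for A e
    proof -
      \<comment> \<open>M does not charge the complement of \<open>V j\<close>, so only the part of
        A inside it has to be approximated.\<close>
      have AV: "A \<inter> V j \<in> sets borel" "A \<inter> V j \<subseteq> V j" using A by auto
      obtain f where f: "lipc f" "{x. f x \<noteq> 0} \<subseteq> V j" "L1_dist m f (indicator (A \<inter> V j)) < e"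
        using indicator_approx[OF AV open_V order_refl e] by metis
      have [measurable]: "f \<in> borel_measurable borel" "A \<in> sets borel" using lipc_measurable[OF f(1)] A by auto
      have "L1_dist M f (indicator A) = (\<integral>x. indicator (V j) x *\<^sub>R \<bar>f x - indicator A x\<bar> \<partial>m)"
        unfolding M_def by (rule integral_density) auto
      also have "(\<lambda>x. indicator (V j) x *\<^sub>R \<bar>f x - indicator A x\<bar>) = (\<lambda>x. \<bar>f x - indicator (A \<inter> V j) x\<bar>)"
        using f(2) by (auto simp: indicator_def fun_eq_iff)
      finally show ?thesis using f by (auto simp: D_def)
    qed
  qed (use that in blast)
  show ?thesis
  proof (rule that[of h C])
    show hm: "h \<in> borel_measurable borel" using h(1) by simp
    show "T f g = pairing m f h" if f: "lipc f" "{x. f x \<noteq> 0} \<subseteq> V j" for f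
    proof -
      have "T f g = pairing M f h" using h(3)[of f] f by (simp add: D_def)
      also have "\<dots> = pairing m f h" using lipc_measurable[OF f(1)] hm f(2) by (intro int_M) auto
      finally show ?thesis .
    qed
    show "\<exists>f. lipc f \<and> {x. f x \<noteq> 0} \<subseteq> V j \<and> L1_dist m f \<beta> < e"
      if b: "integrable m \<beta>" "{x. \<beta> x \<noteq> 0} \<subseteq> V j" and e: "0 < e" for \<beta> e
    proof -
      have bm: "\<beta> \<in> borel_measurable borel" using borel_measurable_integrable[OF b(1)] by simp
      obtain f where f: "f \<in> D" "L1_dist M f \<beta> < e"
        using h(4)[of \<beta> e] integrable_M[OF bm b(2)] b e by blast
      have "L1_dist M f \<beta> = L1_dist m f \<beta>"
      proof (rule int_M)
        have "{x. \<bar>f x - \<beta> x\<bar> \<noteq> 0} \<subseteq> {x. f x \<noteq> 0} \<union> {x. \<beta> x \<noteq> 0}" by auto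
        then show "{x. \<bar>f x - \<beta> x\<bar> \<noteq> 0} \<subseteq> V j" using f(1) b(2) unfolding D_def by blast
        show "(\<lambda>x. \<bar>f x - \<beta> x\<bar>) \<in> borel_measurable borel"
          using f(1) bm lipc_measurable[of f] by (auto simp: D_def)
      qed
      then show ?thesis using f by (auto simp: D_def)
    qed
  qed (rule h(2))
qed

section \<open>Gluing the local densities, and the extension to bounded Borel forms\<close>

definition represents :: "(nat \<Rightarrow> 'a \<Rightarrow> real) \<Rightarrow> ('a \<Rightarrow> real) \<Rightarrow> bool" where
  "represents g h \<longleftrightarrow> lbdd h \<and> (\<forall>f. lipc f \<longrightarrow> T f g = pairing m f h)"

text \<open>The density for \<open>V j\<close> also represents \<open>T\<close> on the smaller
  \<open>V i\<close>, so the two agree almost everywhere on \<open>V i\<close>. The glued function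
  takes at x the density of the first \<open>V j\<close> that contains x, which makes it Borel and
  locally bounded.\<close>

lemma ex_represents:
  assumes g: "ktuple k g"
  shows "\<exists>h. represents g h"
proof -
  define Q where "Q j h C \<longleftrightarrow> h \<in> borel_measurable borel \<and> (\<forall>x. \<bar>h x\<bar> \<le> C) \<and>
      (\<forall>f. lipc f \<longrightarrow> {x. f x \<noteq> 0} \<subseteq> V j \<longrightarrow> T f g = pairing m f h)" for j h C
  have "\<exists>h C. Q j h C" for j
    unfolding Q_def by (rule local_density[OF g, of j]) blast
  then obtain hs C where Q: "\<And>j. Q j (hs j) (C j)" by metis
  have hs: "\<And>j. hs j \<in> borel_measurable borel" "\<And>j x. \<bar>hs j x\<bar> \<le> C j"
    "\<And>j f. lipc f \<Longrightarrow> {x. f x \<noteq> 0} \<subseteq> V j \<Longrightarrow> T f g = pairing m f (hs j)"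
    using Q unfolding Q_def by blast+
  have lb: "lbdd (hs j)" for j unfolding lbdd_def using hs by blast
  have agree: "AE x in m. x \<in> V i \<longrightarrow> hs i x = hs j x" if "i \<le> j" for i j
  proof -
    have "AE x in m. x \<in> V i \<longrightarrow> \<bar>hs i x - hs j x\<bar> \<le> 0"
    proof (rule AE_abs_le_of_test[OF lbdd_diff[OF lb lb] open_V])
      fix f :: "'a \<Rightarrow> real" assume f: "lipc f" "{x. f x \<noteq> 0} \<subseteq> V i"
      have "{x. f x \<noteq> 0} \<subseteq> V j" using f(2) incseqD[OF incseq_V that] by blast
      then have "(\<integral>x. f x * (hs i x - hs j x) \<partial>m) = 0"
        using hs(3)[OF f] hs(3)[OF f(1), of j] lipc_lbdd_integrable[OF f(1) lb]
        by (simp add: right_diff_distrib)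
      then show "\<bar>\<integral>x. f x * (hs i x - hs j x) \<partial>m\<bar> \<le> 0 * L1_norm m f" by simp
    qed
    then show ?thesis by eventually_elim simp
  qed
  define J where "J x = (LEAST j. x \<in> V j)" for x
  have J: "x \<in> V (J x)" for x
  proof -
    have "\<exists>j. x \<in> V j" using V_cover by blast
    then show ?thesis unfolding J_def by (rule LeastI_ex)
  qed
  have J_le: "J x \<le> j" if "x \<in> V j" for x j unfolding J_def using that by (rule Least_le)
  have [measurable]: "J \<in> measurable borel (count_space UNIV)" unfolding J_def by measurable
  define h where "h x = hs (J x) x" for x
  have hm: "h \<in> borel_measurable borel"
    unfolding h_def by (rule measurable_compose_countable[of "\<lambda>j x. hs j x"]) (use hs in measurable)
  have lbh: "lbdd h"
    unfolding lbdd_def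
  proof (intro conjI allI hm)
    fix j
    have "\<bar>h x\<bar> \<le> Max (C ` {..j})" if "x \<in> V j" for x
    proof -
      have "\<bar>h x\<bar> \<le> C (J x)" unfolding h_def by (rule hs(2))
      also have "\<dots> \<le> Max (C ` {..j})" using J_le[OF that] by (intro Max_ge) auto
      finally show ?thesis .
    qed
    then show "\<exists>B. \<forall>x\<in>V j. \<bar>h x\<bar> \<le> B" by blast
  qed
  have hj: "AE x in m. x \<in> V j \<longrightarrow> h x = hs j x" for j
  proof -
    \<comment> \<open>On \<open>V j\<close> the first index \<open>J x\<close> is at most j, so
      finitely many agreements suffice.\<close>
    have "AE x in m. \<forall>i\<in>{..j}. x \<in> V i \<longrightarrow> hs i x = hs j x"
      using agree by (simp add: AE_finite_all)
    then show ?thesis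
    proof eventually_elim
      case (elim x)
      then show ?case using J[of x] J_le[of x j] unfolding h_def by blast
    qed
  qed
  have "T f g = pairing m f h" if f: "lipc f" for f
  proof -
    obtain j where j: "{x. f x \<noteq> 0} \<subseteq> V j" by (rule lipc_subset_V[OF f])
    have "T f g = pairing m f (hs j)" by (rule hs(3)[OF f j])
    also have "\<dots> = pairing m f h"
    proof (rule integral_cong_AE)
      show "(\<lambda>x. f x * hs j x) \<in> borel_measurable m" "(\<lambda>x. f x * h x) \<in> borel_measurable m"
        using lipc_measurable[OF f] hs(1) hm by auto
      show "AE x in m. f x * hs j x = f x * h x"
        using hj[of j] by eventually_elim (use j in auto)
    qed
    finally show ?thesis .
  qed
  then show ?thesis using lbh unfolding represents_def by blast
qed

text \<open>A choice, determined only up to null sets of the mass (\<open>H_unique\<close>);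
  therefore identities between such densities, including linearity in the entries, are almost
  everywhere statements.\<close>

definition H :: "(nat \<Rightarrow> 'a \<Rightarrow> real) \<Rightarrow> 'a \<Rightarrow> real" where
  "H g = (SOME h. represents g h)"

lemma H_represents: "ktuple k g \<Longrightarrow> represents g (H g)"
  unfolding H_def by (rule someI_ex[OF ex_represents])

lemma H_lbdd: "ktuple k g \<Longrightarrow> lbdd (H g)"
  and H_eq: "ktuple k g \<Longrightarrow> lipc f \<Longrightarrow> T f g = pairing m f (H g)"
  using H_represents[of g] unfolding represents_def by blast+

lemma H_unique:
  assumes "ktuple k g" "lbdd h" "\<And>f. lipc f \<Longrightarrow> T f g = pairing m f h"
  shows "AE x in m. H g x = h x"
  using assms H_eq by (intro AE_eq_of_test H_lbdd) auto

lemma H_linear: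
  assumes g: "ktuple k g" and i: "i < k" and u: "liploc u" and v: "liploc v"
  shows "AE x in m. H (g(i := (\<lambda>x. a * u x + b * v x))) x = a * H (g(i := u)) x + b * H (g(i := v)) x"
proof (rule H_unique)
  have gu: "ktuple k (g(i := u))" "ktuple k (g(i := v))" by (rule ktuple_upd[OF g i u] ktuple_upd[OF g i v])+
  show "ktuple k (g(i := (\<lambda>x. a * u x + b * v x)))" by (rule ktuple_upd[OF g i liploc_linear[OF u v]])
  show "lbdd (\<lambda>x. a * H (g(i := u)) x + b * H (g(i := v)) x)" by (intro lbdd_linear H_lbdd gu)
  fix f :: "'a \<Rightarrow> real" assume f: "lipc f"
  have "T f (g(i := (\<lambda>x. a * u x + b * v x))) = a * pairing m f (H (g(i := u))) + b * pairing m f (H (g(i := v)))"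
    using linear_upd[OF f g i u v] H_eq[OF gu(1) f] H_eq[OF gu(2) f] by simp
  also have "\<dots> = (\<integral>x. a * (f x * H (g(i := u)) x) + b * (f x * H (g(i := v)) x) \<partial>m)"
    using lipc_lbdd_integrable[OF f H_lbdd[OF gu(1)]] lipc_lbdd_integrable[OF f H_lbdd[OF gu(2)]] by simp
  finally show "T f (g(i := (\<lambda>x. a * u x + b * v x))) = (\<integral>x. f x * (a * H (g(i := u)) x + b * H (g(i := v)) x) \<partial>m)"
    by (simp add: algebra_simps)
qed

text \<open>The closure of W appears since the support of a function that vanishes off W may reach
  the boundary.\<close>

lemma H_le:
  assumes g: "ktuple k g" and W: "open W"
    and L: "\<And>i. i < k \<Longrightarrow> 0 < L i" "\<And>i. i < k \<Longrightarrow> (L i)-lipschitz_on (closure W) (g i)"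
  shows "AE x in m. x \<in> W \<longrightarrow> \<bar>H g x\<bar> \<le> (\<Prod>i<k. L i)"
proof (rule AE_abs_le_of_test[OF H_lbdd[OF g] W])
  fix f :: "'a \<Rightarrow> real" assume f: "lipc f" "{x. f x \<noteq> 0} \<subseteq> W"
  have "fsupp f \<subseteq> closure W" unfolding fsupp_def by (rule closure_mono[OF f(2)])
  then have "\<bar>T f g\<bar> \<le> (\<Prod>i<k. L i) * L1_norm m f"
    using L lipschitz_on_subset by (intro current_le_mass f g) blast+
  then show "\<bar>pairing m f (H g)\<bar> \<le> (\<Prod>i<k. L i) * L1_norm m f" using H_eq[OF g f(1)] by simp
qed

text \<open>The definite description is meaningful for two reasons: all admissible sequences give
  the same limit, and at least one admissible sequence exists.\<close>

lemma current_ext_eq: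
  assumes \<beta>: "bborel_c \<beta>" and g: "ktuple k g"
  shows "current_ext k T \<beta> g = pairing m \<beta> (H g)"
proof -
  have [measurable]: "\<beta> \<in> borel_measurable borel" using \<beta> by (simp add: bborel_c_def)
  obtain B where B: "\<And>x. \<bar>\<beta> x\<bar> \<le> B" using \<beta> unfolding bborel_c_def bounded_iff by auto
  obtain K where K: "compact K" "{x. \<beta> x \<noteq> 0} \<subseteq> K" using \<beta> unfolding bborel_c_def by blast
  have \<beta>_int: "integrable m \<beta>"
  proof -
    obtain j where "K \<subseteq> V j" by (rule compact_subset_V[OF K(1)])
    then show ?thesis using K(2) by (intro integrable_if_bounded[of _ B j] B) auto
  qed
  let ?P = "\<lambda>fs. (\<forall>j. lipc (fs j)) \<and> (\<exists>K. compact K \<and> (\<forall>j. fsupp (fs j) \<subseteq> K))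
       \<and> ((\<lambda>j. \<integral>\<^sup>+ x. ennreal \<bar>fs j x - \<beta> x\<bar> \<partial>m) \<longlonglongrightarrow> 0)"
  have conv: "(\<lambda>j. T (fs j) g) \<longlonglongrightarrow> pairing m \<beta> (H g)" if fs: "?P fs" for fs
  proof -
    obtain K' where K': "compact K'" "\<And>j. fsupp (fs j) \<subseteq> K'" using fs by blast
    obtain n where n: "K \<union> K' \<subseteq> V n" by (rule compact_subset_V[OF compact_Un[OF K(1) K'(1)]])
    have f: "lipc (fs j)" "{x. fs j x \<noteq> 0} \<subseteq> V n" for j
      using fs subset_fsupp[of "fs j"] K'(2)[of j] n by auto
    have i: "integrable m (\<lambda>x. \<bar>fs j x - \<beta> x\<bar>)" for j using \<beta>_int lipc_integrable[OF f(1)] by auto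
    have "(\<lambda>j. ennreal (L1_dist m (fs j) \<beta>)) \<longlonglongrightarrow> ennreal 0" using fs nn_integral_eq_integral[OF i] by simp
    then have "(\<lambda>j. L1_dist m (fs j) \<beta>) \<longlonglongrightarrow> 0" by (subst (asm) tendsto_ennreal_iff) auto
    then have "(\<lambda>j. pairing m (fs j) (H g)) \<longlonglongrightarrow> pairing m \<beta> (H g)"
      using K(2) n by (intro pairing_tendsto[OF H_lbdd[OF g] lipc_integrable[OF f(1)] f(2) \<beta>_int]) auto
    then show ?thesis using H_eq[OF g f(1)] by simp
  qed
  \<comment> \<open>Without an admissible sequence every L would satisfy the description
    vacuously.\<close>
  have ex: "\<exists>fs. ?P fs"
  proof -
    obtain n where n: "K \<subseteq> V n" by (rule compact_subset_V[OF K(1)])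
    define Q where "Q j f \<longleftrightarrow> lipc f \<and> {x. f x \<noteq> 0} \<subseteq> V n \<and> L1_dist m f \<beta> < 1 / real (Suc j)" for j f
    have sV: "{x. \<beta> x \<noteq> 0} \<subseteq> V n" using K(2) n by blast
    have "\<exists>f. Q j f" for j
      unfolding Q_def
    proof (rule local_density[OF g, of n])
      assume *: "\<And>\<beta> e. integrable m \<beta> \<Longrightarrow> {x. \<beta> x \<noteq> 0} \<subseteq> V n \<Longrightarrow> 0 < e \<Longrightarrow>
         \<exists>f. lipc f \<and> {x. f x \<noteq> 0} \<subseteq> V n \<and> L1_dist m f \<beta> < e"
      show "\<exists>f. lipc f \<and> {x. f x \<noteq> 0} \<subseteq> V n \<and> L1_dist m f \<beta> < 1 / real (Suc j)"
        by (rule *[OF \<beta>_int sV]) simp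
    qed
    then obtain fs where Q: "\<And>j. Q j (fs j)" by metis
    have fs: "\<And>j. lipc (fs j)" "\<And>j. {x. fs j x \<noteq> 0} \<subseteq> V n" "\<And>j. L1_dist m (fs j) \<beta> < 1 / real (Suc j)"
      using Q unfolding Q_def by blast+
    have lim: "(\<lambda>j. L1_dist m (fs j) \<beta>) \<longlonglongrightarrow> 0"
    proof (rule tendsto_sandwich[OF _ _ tendsto_const LIMSEQ_inverse_real_of_nat])
      show "\<forall>\<^sub>F j in sequentially. L1_dist m (fs j) \<beta> \<le> inverse (real (Suc j))"
        using fs(3) by (intro always_eventually) (auto simp: inverse_eq_divide intro: less_imp_le)
    qed auto
    have "(\<lambda>j. ennreal (L1_dist m (fs j) \<beta>)) \<longlonglongrightarrow> ennreal 0" by (rule tendsto_ennrealI[OF lim])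
    moreover have "(\<integral>\<^sup>+ x. ennreal \<bar>fs j x - \<beta> x\<bar> \<partial>m) = ennreal (L1_dist m (fs j) \<beta>)" for j
      using \<beta>_int lipc_integrable[OF fs(1)] by (intro nn_integral_eq_integral) auto
    moreover have "fsupp (fs j) \<subseteq> closure (V n)" for j unfolding fsupp_def by (rule closure_mono[OF fs(2)])
    ultimately have "?P fs" using fs(1) closure_V_compact[of n] by auto
    then show ?thesis by blast
  qed
  show ?thesis
    unfolding current_ext_def
  proof (rule the_equality)
    show "\<forall>fs. ?P fs \<longrightarrow> (\<lambda>j. T (fs j) g) \<longlonglongrightarrow> pairing m \<beta> (H g)" using conv by blast
    fix L assume L: "\<forall>fs. ?P fs \<longrightarrow> (\<lambda>j. T (fs j) g) \<longlonglongrightarrow> L"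
    obtain fs where "?P fs" using ex by blast
    then show "L = pairing m \<beta> (H g)" using L conv LIMSEQ_unique by blast
  qed
qed

end

section \<open>Strict locality and alternation\<close>

lemma liploc_conv_compose:
  fixes \<psi> :: "nat \<Rightarrow> real \<Rightarrow> real"
  assumes u: "liploc u" and lip: "\<And>n. C-lipschitz_on UNIV (\<psi> n)" and conv: "\<And>t. (\<lambda>n. \<psi> n t) \<longlonglongrightarrow> t"
  shows "liploc_conv (\<lambda>n x. \<psi> n (u x)) u"
  unfolding liploc_conv_def
proof (intro conjI allI impI)
  show "(\<lambda>n. \<psi> n (u x)) \<longlonglongrightarrow> u x" for x by (rule conv)
  fix K :: "'a set" assume "compact K"
  then obtain D where D: "D-lipschitz_on K u" using u unfolding liploc_def by blast
  have "(C * D)-lipschitz_on K (\<lambda>x. \<psi> n (u x))" for n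
    by (rule lipschitz_on_compose2[OF D lipschitz_on_subset[OF lip]]) auto
  then show "\<exists>C. \<forall>n. C-lipschitz_on K (\<lambda>x. \<psi> n (u x))" by blast
qed

lemma inverse_nat_LIMSEQ: "(\<lambda>n. c / real (Suc n)) \<longlonglongrightarrow> 0"
  using tendsto_mult_right_zero[OF LIMSEQ_inverse_real_of_nat, of c] by (simp add: inverse_eq_divide)

context lf_current
begin

text \<open>Convergence is known against Lipschitz functions only, while the sign on B is tested by
  indicators. The bound C, uniform in n, allows the limit in n to be taken first for a fixed
  approximation of the indicator, and the approximation to be refined afterwards.\<close>

lemma weak_limit_nonpos:
  assumes B: "B \<in> sets borel" "B \<subseteq> V j" and hs: "\<And>n. lbdd (hs n)" and h: "lbdd h"
    and C: "0 \<le> C" "\<And>n. AE x in m. x \<in> V j \<longrightarrow> \<bar>hs n x\<bar> \<le> C"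
    and zero: "\<And>n. AE x in m. x \<in> B \<longrightarrow> hs n x = 0"
    and conv: "\<And>f. lipc f \<Longrightarrow> (\<lambda>n. pairing m f (hs n)) \<longlonglongrightarrow> pairing m f h"
  shows "AE x in m. x \<in> B \<longrightarrow> h x \<le> 0"
proof -
  have [measurable]: "h \<in> borel_measurable borel" "\<And>n. hs n \<in> borel_measurable borel" "B \<in> sets borel"
    using lbdd_measurable[OF h] lbdd_measurable[OF hs] B by auto
  define A where "A = {x. x \<in> B \<and> 0 < h x}"
  have A: "A \<in> sets borel" "A \<subseteq> V j" unfolding A_def using B by auto
  obtain fs where fs: "\<And>l::nat. lipc (fs l)" "\<And>l. {x. fs l x \<noteq> 0} \<subseteq> V j" "\<And>l x. 0 \<le> fs l x"
    "(\<lambda>l. L1_dist m (fs l) (indicator A)) \<longlonglongrightarrow> 0"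
    "\<And>h. lbdd h \<Longrightarrow> (\<lambda>l. pairing m (fs l) h) \<longlonglongrightarrow> pairing m (indicator A) h"
    by (rule indicator_approx_sequence[OF A open_V order_refl]) (rule that)
  have le: "pairing m (fs l) h \<le> C * L1_dist m (fs l) (indicator A)" for l
  proof (rule LIMSEQ_le_const2[OF conv[OF fs(1)]], intro exI allI impI)
    fix n
    have i: "integrable m (\<lambda>x. fs l x - indicator A x)"
      using indicator_integrable[OF A] lipc_integrable[OF fs(1)] by auto
    \<comment> \<open>\<open>hs n\<close> vanishes on A, so subtracting the indicator changes
      nothing and leaves a factor that is small in L1 and independent of n.\<close>
    have "AE x in m. fs l x * hs n x = (fs l x - indicator A x) * hs n x"
      using zero[of n] by eventually_elim (auto simp: A_def indicator_def)
    then have "pairing m (fs l) (hs n) = (\<integral>x. (fs l x - indicator A x) * hs n x \<partial>m)"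
      using lipc_measurable[OF fs(1)] A by (intro integral_cong_AE) auto
    moreover have "AE x in m. fs l x - indicator A x \<noteq> 0 \<longrightarrow> \<bar>hs n x\<bar> \<le> C"
      using C(2)[of n] by eventually_elim (use fs(2)[of l] A(2) in \<open>auto simp: indicator_def split: if_splits\<close>)
    ultimately show "pairing m (fs l) (hs n) \<le> C * L1_dist m (fs l) (indicator A)"
      using integral_mult_bound(2)[OF i _ _ C(1), of "hs n"] by (simp add: abs_le_iff)
  qed
  have "(\<lambda>l. C * L1_dist m (fs l) (indicator A)) \<longlonglongrightarrow> 0" by (rule tendsto_mult_right_zero[OF fs(4)])
  then have "pairing m (indicator A) h \<le> 0" by (rule LIMSEQ_le[OF fs(5)[OF h]]) (use le in blast)
  then have "AE x in m. x \<notin> A" by (rule AE_nonpos_of_integral[OF h A]) (auto simp: A_def)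
  then show ?thesis by eventually_elim (auto simp: A_def)
qed

text \<open>The one-sided lemma for h and for -h, on each B \<inter> \<open>V j\<close> with a bound
  of its own.\<close>

lemma weak_limit_zero:
  assumes B: "B \<in> sets borel" and hs: "\<And>n. lbdd (hs n)" and h: "lbdd h"
    and bd: "\<And>j. \<exists>C\<ge>0. \<forall>n. AE x in m. x \<in> V j \<longrightarrow> \<bar>hs n x\<bar> \<le> C"
    and zero: "\<And>n. AE x in m. x \<in> B \<longrightarrow> hs n x = 0"
    and conv: "\<And>f. lipc f \<Longrightarrow> (\<lambda>n. pairing m f (hs n)) \<longlonglongrightarrow> pairing m f h"
  shows "AE x in m. x \<in> B \<longrightarrow> h x = 0"
proof (rule AE_all_V)
  fix j
  obtain C where C: "C \<ge> 0" "\<And>n. AE x in m. x \<in> V j \<longrightarrow> \<bar>hs n x\<bar> \<le> C" using bd[of j] by blast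
  have BV: "B \<inter> V j \<in> sets borel" "B \<inter> V j \<subseteq> V j" using B by auto
  have zero': "AE x in m. x \<in> B \<inter> V j \<longrightarrow> hs n x = 0" for n using zero[of n] by eventually_elim auto
  have zero'': "AE x in m. x \<in> B \<inter> V j \<longrightarrow> - hs n x = 0" for n using zero[of n] by eventually_elim auto
  have "AE x in m. x \<in> B \<inter> V j \<longrightarrow> h x \<le> 0"
    by (rule weak_limit_nonpos[OF BV hs h C zero' conv])
  moreover have "AE x in m. x \<in> B \<inter> V j \<longrightarrow> - h x \<le> 0"
  proof (rule weak_limit_nonpos[OF BV lbdd_minus[OF hs] lbdd_minus[OF h] C(1) _ zero''])
    show "AE x in m. x \<in> V j \<longrightarrow> \<bar>- hs n x\<bar> \<le> C" for n using C(2)[of n] by simp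
    show "(\<lambda>n. \<integral>x. f x * - hs n x \<partial>m) \<longlonglongrightarrow> (\<integral>x. f x * - h x \<partial>m)" if "lipc f" for f
      using tendsto_minus[OF conv[OF that]] by simp
  qed
  ultimately show "AE x in m. x \<in> V j \<longrightarrow> x \<in> B \<longrightarrow> h x = 0" by eventually_elim auto
qed

text \<open>The axiom only gives locality on neighbourhoods of the support; pushing g i towards c by the
  functions psi below makes it constant near B.\<close>
lemma H_locality:
  assumes g: "ktuple k g" and i: "i < k" and B: "B \<in> sets borel" and c: "\<And>x. x \<in> B \<Longrightarrow> g i x = c"
  shows "AE x in m. x \<in> B \<longrightarrow> H g x = 0"
proof -
  define d where "d n = 1 / real (Suc n)" for n
  have d: "0 < d n" for n by (simp add: d_def)
  \<comment> \<open>Constantly c on [c - d n, c + d n], and a translation by d n towards c on either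
    side: a 1-Lipschitz map within d n of the identity.\<close>
  define \<psi> where "\<psi> n t = t - max (- d n) (min (d n) (t - c))" for n t
  have lip: "1-lipschitz_on UNIV (\<psi> n)" for n
    by (rule lipschitz_onI) (use d[of n] in \<open>auto simp: \<psi>_def dist_real_def max_def min_def abs_if\<close>)
  have \<psi>_conv: "(\<lambda>n. \<psi> n t) \<longlonglongrightarrow> t" for t
  proof -
    have "(\<lambda>n. \<psi> n t - t) \<longlonglongrightarrow> 0"
    proof (rule tendsto_rabs_zero_cancel, rule tendsto_sandwich[OF _ _ tendsto_const inverse_nat_LIMSEQ[of 1]])
      show "\<forall>\<^sub>F n in sequentially. \<bar>\<psi> n t - t\<bar> \<le> 1 / real (Suc n)"
      proof (intro always_eventually allI)
        fix n
        have "\<bar>\<psi> n t - t\<bar> \<le> d n" using d[of n] unfolding \<psi>_def by auto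
        then show "\<bar>\<psi> n t - t\<bar> \<le> 1 / real (Suc n)" by (simp only: d_def)
      qed
    qed auto
    then show ?thesis by (simp add: LIM_zero_iff)
  qed
  have gi: "liploc (g i)" using g i unfolding ktuple_def by blast
  define gs where "gs n = g(i := (\<lambda>x. \<psi> n (g i x)))" for n
  have gs: "ktuple k (gs n)" for n unfolding gs_def by (intro ktuple_upd g i liploc_compose[OF gi lip])
  have Tconv: "(\<lambda>n. T f (gs n)) \<longlonglongrightarrow> T f g" if "lipc f" for f
  proof (rule continuous_upd[OF that gs g])
    fix b assume "b < k"
    then show "liploc_conv (\<lambda>n. gs n b) (g b)"
      using liploc_conv_compose[OF gi lip \<psi>_conv] liploc_conv_const[of "g b"] g
      unfolding gs_def ktuple_def by (cases "b = i") auto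
  qed
  show ?thesis
  proof (rule weak_limit_zero[OF B H_lbdd[OF gs] H_lbdd[OF g]])
    show "\<exists>C\<ge>0. \<forall>n. AE x in m. x \<in> V j \<longrightarrow> \<bar>H (gs n) x\<bar> \<le> C" for j
    proof -
      obtain L where L: "\<And>i. i < k \<Longrightarrow> 0 < L i" "\<And>i. i < k \<Longrightarrow> (L i)-lipschitz_on (closure (V j)) (g i)"
        using ktuple_lipschitz_constants[OF g closure_V_compact] by blast
      have "(L b)-lipschitz_on (closure (V j)) (gs n b)" if "b < k" for b n
        using L(2)[OF that] lipschitz_on_compose2[OF L(2)[OF i] lipschitz_on_subset[OF lip[of n]]]
        by (cases "b = i") (auto simp: gs_def)
      then have "AE x in m. x \<in> V j \<longrightarrow> \<bar>H (gs n) x\<bar> \<le> (\<Prod>i<k. L i)" for n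
        using L(1) by (intro H_le gs open_V)
      moreover have "0 \<le> (\<Prod>i<k. L i)" using L(1) by (intro prod_nonneg) (auto intro: less_imp_le)
      ultimately show ?thesis by blast
    qed
    show "AE x in m. x \<in> B \<longrightarrow> H (gs n) x = 0" for n
    proof -
      \<comment> \<open>An open neighbourhood of B. Functions vanishing off it have supports in the
        closed slab with \<le> in place of <, where \<open>gs n i\<close> is still equal to
        c.\<close>
      define W where "W = {x. \<bar>g i x - c\<bar> < d n}"
      have cont: "continuous_on UNIV (g i)" by (rule liploc_continuous[OF gi])
      have W: "open W" unfolding W_def by (intro open_Collect_less continuous_intros cont)
      have "AE x in m. x \<in> W \<longrightarrow> \<bar>H (gs n) x\<bar> \<le> 0"
      proof (rule AE_abs_le_of_test[OF H_lbdd[OF gs] W])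
        fix f :: "'a \<Rightarrow> real" assume f: "lipc f" "{x. f x \<noteq> 0} \<subseteq> W"
        have "fsupp f \<subseteq> {x. \<bar>g i x - c\<bar> \<le> d n}"
          using f(2) by (intro fsupp_minimal closed_Collect_le continuous_intros cont) (auto simp: W_def)
        then have "gs n i x = c" if "x \<in> fsupp f" for x
          using that by (auto simp: gs_def \<psi>_def)
        then have "T f (gs n) = 0" by (rule vanishes_if_constant[OF f(1) gs i])
        then show "\<bar>pairing m f (H (gs n))\<bar> \<le> 0 * L1_norm m f" using H_eq[OF gs f(1)] by simp
      qed
      then show ?thesis by eventually_elim (use c d in \<open>auto simp: W_def\<close>)
    qed
    show "(\<lambda>n. pairing m f (H (gs n))) \<longlonglongrightarrow> pairing m f (H g)" if "lipc f" for f
      using Tconv[OF that] H_eq[OF gs that] H_eq[OF g that] by simp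
  qed
qed

text \<open>The entries are replaced one at a time by Lipschitz extensions of their restrictions to
  B. Each replacement changes the entry by a function that vanishes on B, so strict locality
  preserves the density on B; the final tuple satisfies the bounds on all of X.\<close>

lemma H_local_bound:
  assumes g: "ktuple k g" and B: "B \<in> sets borel"
    and L: "\<And>i. i < k \<Longrightarrow> 0 < L i" "\<And>i. i < k \<Longrightarrow> (L i)-lipschitz_on B (g i)"
  shows "AE x in m. x \<in> B \<longrightarrow> \<bar>H g x\<bar> \<le> (\<Prod>i<k. L i)"
proof -
  have "\<forall>i\<in>{..<k}. \<exists>u. (L i)-lipschitz_on UNIV u \<and> (\<forall>x\<in>B. u x = g i x)"
    using lipschitz_extension_real[OF L(2)] by (metis lessThan_iff)
  then obtain u where u: "\<And>i. i < k \<Longrightarrow> (L i)-lipschitz_on UNIV (u i)" "\<And>i x. i < k \<Longrightarrow> x \<in> B \<Longrightarrow> u i x = g i x"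
    using bchoice[of "{..<k}" "\<lambda>i u. (L i)-lipschitz_on UNIV u \<and> (\<forall>x\<in>B. u x = g i x)"] by (metis lessThan_iff)
  define G where "G n = (\<lambda>i. if i < n then u i else g i)" for n
  have lu: "liploc (u i)" if "i < k" for i by (rule liplocI[OF u(1)[OF that]])
  have lg: "liploc (g i)" if "i < k" for i using g that unfolding ktuple_def by blast
  have Gk: "ktuple k (G n)" if "n \<le> k" for n
    using g lu that unfolding ktuple_def G_def by auto
  have "n \<le> k \<longrightarrow> (AE x in m. x \<in> B \<longrightarrow> H g x = H (G n) x)" for n
  proof (induction n)
    case 0
    have "G 0 = g" by (simp add: G_def)
    then show ?case by simp
  next
    case (Suc n)
    show ?case
    proof
      assume nk: "Suc n \<le> k"
      then have n: "n < k" "n \<le> k" by auto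
      have G1: "(G n)(n := g n) = G n" "(G n)(n := u n) = G (Suc n)" by (auto simp: G_def fun_eq_iff less_Suc_eq)
      have "AE x in m. H ((G n)(n := (\<lambda>x. 1 * g n x + (-1) * u n x))) x
         = 1 * H ((G n)(n := g n)) x + (-1) * H ((G n)(n := u n)) x"
        by (rule H_linear[OF Gk[OF n(2)] n(1) lg[OF n(1)] lu[OF n(1)]])
      moreover have "AE x in m. x \<in> B \<longrightarrow> H ((G n)(n := (\<lambda>x. 1 * g n x + (-1) * u n x))) x = 0"
      proof (rule H_locality[OF _ n(1) B, where c=0])
        show "ktuple k ((G n)(n := (\<lambda>x. 1 * g n x + (-1) * u n x)))"
          by (rule ktuple_upd[OF Gk[OF n(2)] n(1) liploc_linear[OF lg[OF n(1)] lu[OF n(1)]]])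
      qed (use u(2)[OF n(1)] in auto)
      moreover have "AE x in m. x \<in> B \<longrightarrow> H g x = H (G n) x" using Suc n by blast
      ultimately show "AE x in m. x \<in> B \<longrightarrow> H g x = H (G (Suc n)) x"
        by eventually_elim (simp add: G1)
    qed
  qed
  then have eq: "AE x in m. x \<in> B \<longrightarrow> H g x = H (G k) x" by blast
  have "AE x in m. x \<in> UNIV \<longrightarrow> \<bar>H (G k) x\<bar> \<le> (\<Prod>i<k. L i)"
    using u(1) L(1) by (intro H_le Gk) (auto simp: G_def)
  then show ?thesis using eq by eventually_elim auto
qed

end

text \<open>Slope 1 to the right of an even integer and -1 to the right of an odd one, up to the
  next integer. Written as a distance function it is 1-Lipschitz without a case distinction.\<close>

definition sawtooth :: "real \<Rightarrow> real" where
  "sawtooth t = infdist t (range (\<lambda>z::int. 2 * real_of_int z))"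

lemma sawtooth_eq:
  assumes "\<bar>t - 2 * real_of_int z\<bar> \<le> 1"
  shows "sawtooth t = \<bar>t - 2 * real_of_int z\<bar>"
  unfolding sawtooth_def
proof (rule antisym)
  show "infdist t (range (\<lambda>z::int. 2 * real_of_int z)) \<le> \<bar>t - 2 * real_of_int z\<bar>"
    using infdist_le[of "2 * real_of_int z" "range (\<lambda>z::int. 2 * real_of_int z)" t] by (auto simp: dist_real_def)
  show "\<bar>t - 2 * real_of_int z\<bar> \<le> infdist t (range (\<lambda>z::int. 2 * real_of_int z))"
  proof (subst infdist_notempty, simp, rule cINF_greatest, simp)
    fix y :: real assume "y \<in> range (\<lambda>z::int. 2 * real_of_int z)"
    then obtain w :: int where w: "y = 2 * real_of_int w" by blast
    show "\<bar>t - 2 * real_of_int z\<bar> \<le> dist t y"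
    \<comment> \<open>Distinct even integers are at least 2 apart, so t, being within 1 of one of
      them, is no closer to another.\<close>
    proof (cases "w = z")
      case False
      then have "\<bar>w - z\<bar> \<ge> 1" by linarith
      then have "\<bar>real_of_int w - real_of_int z\<bar> \<ge> 1" by (metis of_int_1_le_iff of_int_abs of_int_diff)
      then show ?thesis using assms by (auto simp: w dist_real_def abs_if split: if_splits)
    qed (simp add: w dist_real_def)
  qed
qed

lemma sawtooth_lipschitz: "1-lipschitz_on UNIV sawtooth"
  unfolding sawtooth_def
proof (rule lipschitz_onI)
  fix x y :: real
  show "dist (infdist x (range (\<lambda>z::int. 2 * real_of_int z))) (infdist y (range (\<lambda>z::int. 2 * real_of_int z))) \<le> 1 * dist x y"
    using infdist_triangle_abs[of x _ y] by (simp only: dist_real_def[of "infdist _ _"] mult_1)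
qed simp

lemma sawtooth_near: "\<exists>z::int. \<bar>t - 2 * real_of_int z\<bar> \<le> 1"
proof
  show "\<bar>t - 2 * real_of_int \<lfloor>(t + 1) / 2\<rfloor>\<bar> \<le> 1" 
    using floor_correct[of "(t + 1) / 2"] by (simp add: abs_le_iff field_simps)
qed

lemma sawtooth_bound: "0 \<le> sawtooth t \<and> sawtooth t \<le> 1"
  using sawtooth_near[of t] sawtooth_eq by fastforce

text \<open>An even z starts a rising edge of the sawtooth, an odd z a falling one.\<close>

lemma sawtooth_slab:
  fixes z :: int
  shows "(\<forall>t\<in>{real_of_int z..real_of_int z + 1}. t - sawtooth t = real_of_int z)
       \<or> (\<forall>t\<in>{real_of_int z..real_of_int z + 1}. t + sawtooth t = real_of_int z + 1)"
proof (cases "even z")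
  case True
  then obtain w where w: "z = 2 * w" by blast
  have "t - sawtooth t = real_of_int z" if "t \<in> {real_of_int z..real_of_int z + 1}" for t
    using that sawtooth_eq[of t w] by (simp add: w)
  then show ?thesis by blast
next
  case False
  then obtain w where w: "z + 1 = 2 * w" by (metis evenE even_plus_one_iff)
  then have w': "real_of_int z = 2 * real_of_int w - 1" by (metis add_diff_cancel_right' of_int_1 of_int_diff of_int_mult of_int_numeral)
  have "t + sawtooth t = real_of_int z + 1" if "t \<in> {real_of_int z..real_of_int z + 1}" for t
    using that sawtooth_eq[of t w] by (simp add: w')
  then show ?thesis by blast
qed

section \<open>Alternation in the entries\<close>

context lf_current
begin

text \<open>Perturbing two equal entries u to u + s and u - s with a fine sawtooth s makes one of them constant
  on each slab, so that strict locality applies.\<close>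
lemma current_alternating:
  assumes g: "ktuple k g" and ij: "i < k" "j < k" "i \<noteq> j" and eq: "g i = g j" and f: "lipc f"
  shows "T f g = 0"
proof -
  define u where "u = g i"
  have u: "liploc u" using g ij unfolding u_def ktuple_def by blast
  have cont: "continuous_on UNIV u" by (rule liploc_continuous[OF u])
  \<comment> \<open>Height and half-period are 1/(n + 1): the slope remains 1 in absolute value
    while the function tends to 0.\<close>
  define s where "s n t = sawtooth (real (Suc n) * t) / real (Suc n)" for n t
  have s_lip: "1-lipschitz_on UNIV (s n)" for n
  proof (rule lipschitz_onI)
    fix a b
    have "\<bar>sawtooth (real (Suc n) * a) - sawtooth (real (Suc n) * b)\<bar> \<le> \<bar>real (Suc n) * a - real (Suc n) * b\<bar>"
      using lipschitz_onD[OF sawtooth_lipschitz] by (simp add: dist_real_def)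
    also have "\<dots> = real (Suc n) * \<bar>a - b\<bar>" by (simp only: abs_mult right_diff_distrib[symmetric] abs_of_nat)
    finally show "dist (s n a) (s n b) \<le> 1 * dist a b"
      unfolding s_def dist_real_def by (simp add: diff_divide_distrib[symmetric] divide_le_eq mult.commute)
  qed simp
  have s_conv: "(\<lambda>n. s n t) \<longlonglongrightarrow> 0" for t
  proof (rule tendsto_sandwich[OF _ _ tendsto_const inverse_nat_LIMSEQ[of 1]])
    show "\<forall>\<^sub>F n in sequentially. s n t \<le> 1 / real (Suc n)"
      using sawtooth_bound unfolding s_def by (intro always_eventually allI divide_right_mono) auto
    show "\<forall>\<^sub>F n in sequentially. 0 \<le> s n t"
      using sawtooth_bound unfolding s_def by (intro always_eventually allI divide_nonneg_nonneg) auto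
  qed
  define p q where "p n t = t + s n t" and "q n t = t - s n t" for n t
  \<comment> \<open>A constant independent of n, as convergence of locally Lipschitz functions
    requires.\<close>
  have lip: "2-lipschitz_on UNIV (p n)" "2-lipschitz_on UNIV (q n)" for n
    unfolding p_def q_def
    using lipschitz_on_add[OF lipschitz_on_id s_lip[of n]] lipschitz_on_diff[OF lipschitz_on_id s_lip[of n]] by auto
  have conv: "(\<lambda>n. p n t) \<longlonglongrightarrow> t" "(\<lambda>n. q n t) \<longlonglongrightarrow> t" for t
    unfolding p_def q_def
    using tendsto_add[OF tendsto_const s_conv[of t], of t] tendsto_diff[OF tendsto_const s_conv[of t], of t] by auto
  define gs where "gs n = g(i := (\<lambda>x. p n (u x)), j := (\<lambda>x. q n (u x)))" for n
  have gs: "ktuple k (gs n)" for n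
    unfolding gs_def by (intro ktuple_upd g ij liploc_compose[OF u lip(1)] liploc_compose[OF u lip(2)])
  have "(\<lambda>n. T f (gs n)) \<longlonglongrightarrow> T f g"
  proof (rule continuous_upd[OF f gs g])
    fix b assume "b < k"
    then have "liploc (g b)" using g unfolding ktuple_def by blast
    then show "liploc_conv (\<lambda>n. gs n b) (g b)"
      using liploc_conv_compose[OF u lip(1) conv(1)] liploc_conv_compose[OF u lip(2) conv(2)]
        liploc_conv_const[of "g b"] ij eq
      unfolding gs_def by (cases "b = j"; cases "b = i") (auto simp: u_def)
  qed
  moreover have "T f (gs n) = 0" for n
  proof -
    \<comment> \<open>Preimages under u of closed intervals of length 1/(n + 1), one per edge of the
      sawtooth; together they cover X.\<close>
    define S where "S z = {x. real_of_int z / real (Suc n) \<le> u x \<and> u x \<le> (real_of_int z + 1) / real (Suc n)}" for z :: int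
    have S: "S z \<in> sets borel" for z
      unfolding S_def by (intro borel_closed closed_Collect_conj closed_Collect_le continuous_intros cont)
    have "AE x in m. x \<in> S z \<longrightarrow> H (gs n) x = 0" for z
    proof -
      have mem: "real (Suc n) * u x \<in> {real_of_int z..real_of_int z + 1}" if "x \<in> S z" for x
        using that unfolding S_def by (auto simp: field_simps)
      have dv: "t = (real (Suc n) * t) / real (Suc n)" for t by simp
      from sawtooth_slab[of z] show ?thesis
      proof
        assume a: "\<forall>t\<in>{real_of_int z..real_of_int z + 1}. t - sawtooth t = real_of_int z"
        have "gs n j x = real_of_int z / real (Suc n)" if "x \<in> S z" for x
          using a[rule_format, OF mem[OF that]] unfolding gs_def q_def s_def
          by (simp add: field_simps)
        then show ?thesis by (rule H_locality[OF gs ij(2) S])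
      next
        assume a: "\<forall>t\<in>{real_of_int z..real_of_int z + 1}. t + sawtooth t = real_of_int z + 1"
        have "gs n i x = (real_of_int z + 1) / real (Suc n)" if "x \<in> S z" for x
          using a[rule_format, OF mem[OF that]] ij(3) unfolding gs_def p_def s_def
          by (simp add: field_simps)
        then show ?thesis by (rule H_locality[OF gs ij(1) S])
      qed
    qed
    then have "AE x in m. \<forall>z. x \<in> S z \<longrightarrow> H (gs n) x = 0" by (subst AE_all_countable) blast
    then have "AE x in m. H (gs n) x = 0"
    proof eventually_elim
      case (elim x)
      define z where "z = \<lfloor>real (Suc n) * u x\<rfloor>"
      have "real_of_int z \<le> real (Suc n) * u x" "real (Suc n) * u x \<le> real_of_int z + 1"
        unfolding z_def by linarith+
      then have "x \<in> S z" unfolding S_def by (simp add: field_simps)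
      then show ?case using elim by blast
    qed
    then have "pairing m f (H (gs n)) = (\<integral>x. 0 \<partial>m)"
      using lipc_measurable[OF f] lbdd_measurable[OF H_lbdd[OF gs]] by (intro integral_cong_AE) auto
    then show ?thesis using H_eq[OF gs f] by simp
  qed
  ultimately show ?thesis using LIMSEQ_unique[OF tendsto_const[of 0]] by simp
qed

text \<open>Polarisation: the tuple with g i + g j in both slots gives 0, and so do the two diagonal
  terms of its expansion.\<close>

lemma current_swap:
  assumes g: "ktuple k g" and ij: "i < k" "j < k" "i \<noteq> j" and f: "lipc f"
  shows "T f (g(i := g j, j := g i)) = - T f g"
proof -
  have l: "liploc (g i)" "liploc (g j)" using g ij unfolding ktuple_def by auto
  define w where "w = (\<lambda>x. 1 * g i x + 1 * g j x)"
  have lw: "liploc w" unfolding w_def by (rule liploc_linear[OF l])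
  have kt: "ktuple k (g(i := a, j := b))" if "liploc a" "liploc b" for a b
    by (intro ktuple_upd g ij that)
  have z: "T f (g(i := a, j := a)) = 0" if "liploc a" for a
    using current_alternating[OF kt[OF that that] ij _ f] ij(3) by simp
  have 1: "T f (g(i := a, j := w)) = T f (g(i := a, j := g i)) + T f (g(i := a, j := g j))" if "liploc a" for a
    using linear_upd[OF f ktuple_upd[OF g ij(1) that] ij(2) l, of 1 1] by (simp add: w_def)
  have 2: "T f (g(i := w, j := b)) = T f (g(i := g i, j := b)) + T f (g(i := g j, j := b))" if "liploc b" for b
  proof -
    have "T f (g(j := b, i := w)) = T f (g(j := b, i := g i)) + T f (g(j := b, i := g j))"
      using linear_upd[OF f ktuple_upd[OF g ij(2) that] ij(1) l, of 1 1] by (simp add: w_def)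
    then show ?thesis by (simp only: fun_upd_twist[OF ij(3)])
  qed
  have "0 = T f (g(i := w, j := w))" using z[OF lw] by simp
  also have "\<dots> = T f (g(i := g i, j := g j)) + T f (g(i := g j, j := g i))"
    using 1[OF lw] 2[OF l(1)] 2[OF l(2)] z[OF l(1)] z[OF l(2)] by simp
  finally show ?thesis by simp
qed

end

section \<open>Expanding alternating multilinear expressions\<close>

text \<open>Splits off the last value of the index function; this is the inductive step of
  \<open>H_expand\<close>.\<close>

lemma sum_PiE_lessThan_Suc:
  fixes F :: "(nat \<Rightarrow> 'b) \<Rightarrow> 'c::comm_monoid_add"
  shows "(\<Sum>\<phi>\<in>PiE {..<Suc j} (\<lambda>_. A). F \<phi>) = (\<Sum>\<phi>\<in>PiE {..<j} (\<lambda>_. A). \<Sum>i\<in>A. F (\<phi>(j := i)))"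
proof -
  have "(\<Sum>\<phi>\<in>PiE {..<Suc j} (\<lambda>_. A). F \<phi>) = (\<Sum>x\<in>A \<times> PiE {..<j} (\<lambda>_. A). F ((\<lambda>(y, g). g(j := y)) x))"
    unfolding lessThan_Suc PiE_insert_eq
    by (rule sum.reindex[unfolded o_def]) (rule inj_combinator, simp)
  also have "\<dots> = (\<Sum>i\<in>A. \<Sum>\<phi>\<in>PiE {..<j} (\<lambda>_. A). F (\<phi>(j := i)))"
    by (subst sum.cartesian_product) (auto intro: sum.cong)
  also have "\<dots> = (\<Sum>\<phi>\<in>PiE {..<j} (\<lambda>_. A). \<Sum>i\<in>A. F (\<phi>(j := i)))" by (rule sum.swap)
  finally show ?thesis .
qed

text \<open>An injective \<phi> factors uniquely as a permutation of {..<k} followed by the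
  increasing enumeration of its image I. For fixed I the sum over the permutations is the
  determinant.\<close>

lemma sum_alternating_eq_wedge_pair:
  fixes \<Phi> :: "(nat \<Rightarrow> nat) \<Rightarrow> real"
  assumes noninj: "\<And>\<phi>. \<phi> \<in> PiE {..<k} (\<lambda>_. {..<n}) \<Longrightarrow> \<not> inj_on \<phi> {..<k} \<Longrightarrow> \<Phi> \<phi> = 0"
    and perm: "\<And>I \<sigma>. I \<subseteq> {..<n} \<Longrightarrow> card I = k \<Longrightarrow> \<sigma> permutes {..<k} \<Longrightarrow>
      \<Phi> (restrict (\<lambda>a. sorted_list_of_set I ! \<sigma> a) {..<k}) = of_int (sign \<sigma>) * lam I"
  shows "(\<Sum>\<phi>\<in>PiE {..<k} (\<lambda>_. {..<n}). (\<Prod>a<k. w a (\<phi> a)) * \<Phi> \<phi>) = wedge_pair k n w lam"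
proof -
  define X where "X = {I. I \<subseteq> {..<n} \<and> card I = k}"
  define P where "P = {\<sigma>. \<sigma> permutes {..<k}}"
  define e where "e I = (\<lambda>b. sorted_list_of_set I ! b)" for I :: "nat set"
  define F where "F = (\<lambda>(I, \<sigma>). restrict (\<lambda>a. e I (\<sigma> a)) {..<k})"
  have e: "bij_betw (e I) {..<k} I" if "I \<in> X" for I
  proof -
    have "finite I" using that finite_subset unfolding X_def by blast
    then show ?thesis using that unfolding X_def e_def
      by (intro bij_betw_nth) auto
  qed
  have \<sigma>: "bij_betw \<sigma> {..<k} {..<k}" if "\<sigma> \<in> P" for \<sigma> using that permutes_imp_bij unfolding P_def by blast
  have e\<sigma>: "bij_betw (\<lambda>a. e I (\<sigma> a)) {..<k} I" if "I \<in> X" "\<sigma> \<in> P" for I \<sigma>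
    using bij_betw_trans[OF \<sigma>[OF that(2)] e[OF that(1)]] by (simp add: o_def)
  have bij: "bij_betw F (X \<times> P) {\<phi> \<in> PiE {..<k} (\<lambda>_. {..<n}). inj_on \<phi> {..<k}}"
    unfolding bij_betw_def
  proof
    show "inj_on F (X \<times> P)"
    proof (rule inj_onI, clarify)
      fix I \<sigma> I' \<sigma>' assume a: "I \<in> X" "\<sigma> \<in> P" "I' \<in> X" "\<sigma>' \<in> P" and eq: "F (I, \<sigma>) = F (I', \<sigma>')"
      have pt: "e I (\<sigma> a) = e I' (\<sigma>' a)" if "a < k" for a
        using fun_cong[OF eq, of a] that by (simp add: F_def)
      have "I = (\<lambda>a. e I (\<sigma> a)) ` {..<k}" using e\<sigma>[OF a(1,2)] by (simp add: bij_betw_def)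
      also have "\<dots> = (\<lambda>a. e I' (\<sigma>' a)) ` {..<k}" using pt by (intro image_cong) auto
      also have "\<dots> = I'" using e\<sigma>[OF a(3,4)] by (simp add: bij_betw_def)
      finally have I: "I = I'" .
      have "\<sigma> a = \<sigma>' a" for a
      proof (cases "a < k")
        case True
        then have "\<sigma> a \<in> {..<k}" "\<sigma>' a \<in> {..<k}" using \<sigma>[OF a(2)] \<sigma>[OF a(4)] bij_betwE by blast+
        then show ?thesis using pt[OF True] e[OF a(1)] I unfolding bij_betw_def inj_on_def by blast
      next
        case False
        then show ?thesis using a(2,4) unfolding P_def by (simp add: permutes_not_in)
      qed
      then show "I = I' \<and> \<sigma> = \<sigma>'" using I by blast
    qed
    show "F ` (X \<times> P) = {\<phi> \<in> PiE {..<k} (\<lambda>_. {..<n}). inj_on \<phi> {..<k}}"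
    proof (intro equalityI subsetI)
      fix \<phi> assume "\<phi> \<in> F ` (X \<times> P)"
      then obtain I \<sigma> where a: "I \<in> X" "\<sigma> \<in> P" "\<phi> = F (I, \<sigma>)" by blast
      have eq: "\<phi> a = e I (\<sigma> a)" if "a < k" for a using a(3) that by (simp add: F_def)
      have "inj_on \<phi> {..<k}" using e\<sigma>[OF a(1,2)] eq unfolding bij_betw_def inj_on_def by auto
      moreover have "\<phi> \<in> PiE {..<k} (\<lambda>_. {..<n})"
      proof
        fix a assume "a \<in> {..<k}"
        then have "\<phi> a \<in> I" using eq e\<sigma>[OF a(1,2)] bij_betwE by (metis lessThan_iff)
        then show "\<phi> a \<in> {..<n}" using a(1) unfolding X_def by blast
      qed (use a(3) in \<open>simp add: F_def\<close>)
      ultimately show "\<phi> \<in> {\<phi> \<in> PiE {..<k} (\<lambda>_. {..<n}). inj_on \<phi> {..<k}}" by blast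
    next
      fix \<phi> assume "\<phi> \<in> {\<phi> \<in> PiE {..<k} (\<lambda>_. {..<n}). inj_on \<phi> {..<k}}"
      then have \<phi>: "\<phi> \<in> PiE {..<k} (\<lambda>_. {..<n})" "inj_on \<phi> {..<k}" by auto
      define I where "I = \<phi> ` {..<k}"
      have I: "I \<in> X" unfolding X_def I_def using \<phi> card_image by fastforce
      \<comment> \<open>The identity outside {..<k}, as \<open>permutes\<close> requires.\<close>
      define \<sigma> where "\<sigma> a = (if a < k then inv_into {..<k} (e I) (\<phi> a) else a)" for a
      have "bij_betw (inv_into {..<k} (e I) \<circ> \<phi>) {..<k} {..<k}"
        using \<phi>(2) bij_betw_inv_into[OF e[OF I]] by (intro bij_betw_trans) (auto simp: bij_betw_def I_def)
      then have "bij_betw \<sigma> {..<k} {..<k}" by (rule bij_betw_cong[THEN iffD1, rotated]) (simp add: \<sigma>_def)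
      then have "\<sigma> \<in> P" unfolding P_def by (auto intro!: bij_imp_permutes simp: \<sigma>_def split: if_splits)
      moreover have "\<phi> = F (I, \<sigma>)"
      proof
        fix a show "\<phi> a = F (I, \<sigma>) a"
        proof (cases "a < k")
          case True
          then have "\<phi> a \<in> e I ` {..<k}" using e[OF I] unfolding bij_betw_def I_def by auto
          then show ?thesis using True by (simp add: F_def \<sigma>_def f_inv_into_f)
        next
          case False
          then show ?thesis using \<phi>(1) by (auto simp: F_def PiE_def extensional_def)
        qed
      qed
      ultimately show "\<phi> \<in> F ` (X \<times> P)" using I by blast
    qed
  qed
  have fin: "finite (PiE {..<k} (\<lambda>_. {..<n}))" by (rule finite_PiE) auto
  have "(\<Sum>\<phi>\<in>PiE {..<k} (\<lambda>_. {..<n}). (\<Prod>a<k. w a (\<phi> a)) * \<Phi> \<phi>)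
      = (\<Sum>\<phi>\<in>{\<phi> \<in> PiE {..<k} (\<lambda>_. {..<n}). inj_on \<phi> {..<k}}. (\<Prod>a<k. w a (\<phi> a)) * \<Phi> \<phi>)"
    by (rule sum.mono_neutral_right[OF fin]) (auto simp: noninj)
  also have "\<dots> = (\<Sum>x\<in>X \<times> P. (\<Prod>a<k. w a (F x a)) * \<Phi> (F x))"
    by (rule sum.reindex_bij_betw[OF bij, symmetric])
  also have "\<dots> = (\<Sum>(I, \<sigma>)\<in>X \<times> P. (\<Prod>a<k. w a (e I (\<sigma> a))) * (of_int (sign \<sigma>) * lam I))"
  proof (rule sum.cong[OF refl], clarify)
    fix I \<sigma> assume a: "I \<in> X" "\<sigma> \<in> P"
    have "\<Phi> (F (I, \<sigma>)) = of_int (sign \<sigma>) * lam I"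
      unfolding F_def e_def using a perm unfolding X_def P_def by simp
    moreover have "(\<Prod>a<k. w a (F (I, \<sigma>) a)) = (\<Prod>a<k. w a (e I (\<sigma> a)))"
      by (rule prod.cong) (auto simp: F_def)
    ultimately show "(\<Prod>a<k. w a (F (I, \<sigma>) a)) * \<Phi> (F (I, \<sigma>)) = (\<Prod>a<k. w a (e I (\<sigma> a))) * (of_int (sign \<sigma>) * lam I)"
      by simp
  qed
  also have "\<dots> = (\<Sum>I\<in>X. \<Sum>\<sigma>\<in>P. (\<Prod>a<k. w a (e I (\<sigma> a))) * (of_int (sign \<sigma>) * lam I))"
    by (rule sum.cartesian_product[symmetric])
  also have "\<dots> = wedge_pair k n w lam"
    unfolding wedge_pair_def kdet_def sum_distrib_left X_def P_def e_def
    by (intro sum.cong refl) (simp add: mult_ac)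
  finally show ?thesis .
qed

context lf_current
begin

section \<open>Differentiation of the density\<close>

lemma H_const:
  assumes "ktuple k g" "a < k"
  shows "AE x in m. H (g(a := (\<lambda>_. c))) x = 0"
  using H_locality[OF ktuple_upd[OF assms liploc_const] assms(2), of UNIV c] by simp

lemma H_linear_sum:
  fixes n :: nat
  assumes g: "ktuple k g" and a: "a < k" and p: "\<And>i. i < n \<Longrightarrow> liploc (p i)"
  shows "AE x in m. H (g(a := (\<lambda>x. \<Sum>i<n. q i * p i x))) x = (\<Sum>i<n. q i * H (g(a := p i)) x)"
  using p
proof (induction n)
  case 0
  show ?case using H_const[OF g a, of 0] by (simp only: lessThan_0 sum.empty)
next
  case (Suc n)
  have l: "liploc (\<lambda>x. \<Sum>i<n. q i * p i x)" using Suc.prems by (intro liploc_sum liploc_cmult) auto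
  have "AE x in m. H (g(a := (\<lambda>x. 1 * (\<Sum>i<n. q i * p i x) + q n * p n x))) x
      = 1 * H (g(a := (\<lambda>x. \<Sum>i<n. q i * p i x))) x + q n * H (g(a := p n)) x"
    by (rule H_linear[OF g a l]) (use Suc.prems in auto)
  moreover have "AE x in m. H (g(a := (\<lambda>x. \<Sum>i<n. q i * p i x))) x = (\<Sum>i<n. q i * H (g(a := p i)) x)"
    by (rule Suc.IH) (use Suc.prems in auto)
  ultimately show ?case by eventually_elim (simp add: fun_upd_def)
qed

text \<open>The set A of points where w is within \<open>\<epsilon>\<close> of a rational covector q and the first order expansion
  of g a holds up to \<open>\<epsilon>\<close> at scale r: there \<open>g a - q \<cdot> p\<close> has a Lipschitz constant of order \<open>\<epsilon>\<close>, on the closure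
  of A as well, so strict locality bounds the density. Countably many such sets cover Y.\<close>
lemma H_bound_on_approximating_set:
  fixes p :: "nat \<Rightarrow> 'a \<Rightarrow> real"
  assumes g: "ktuple k g" and a: "a < k" and p: "\<And>i. i < n \<Longrightarrow> c-lipschitz_on UNIV (p i)" and c: "0 \<le> c"
    and L: "\<And>b. b < k \<Longrightarrow> 0 < L b" "\<And>b. b < k \<Longrightarrow> (L b)-lipschitz_on (closure (V J)) (g b)"
    and \<epsilon>: "0 < \<epsilon>"
    and A_def: "A = {y \<in> Y. y \<in> V J \<and> dist z y < r / 2 \<and> (\<forall>i<n. \<bar>w y i - q i\<bar> \<le> \<epsilon>) \<and>
      (\<forall>x\<in>Y. dist x y < r \<longrightarrow> \<bar>g a x - g a y - (\<Sum>i<n. w y i * (p i x - p i y))\<bar> \<le> \<epsilon> * dist x y)}"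
  shows "AE y in m. y \<in> A \<longrightarrow> \<bar>H g y - (\<Sum>i<n. q i * H (g(a := p i)) y)\<bar>
    \<le> \<epsilon> * ((1 + real n * c) * (\<Prod>b\<in>{..<k} - {a}. L b))"
proof -
  define u where "u x = 1 * g a x + (-1) * (\<Sum>i<n. q i * p i x)" for x
  have lg: "liploc (g a)" using g a unfolding ktuple_def by blast
  have lp: "liploc (p i)" if "i < n" for i by (rule liplocI[OF p[OF that]])
  have ls: "liploc (\<lambda>x. \<Sum>i<n. q i * p i x)" using lp by (intro liploc_sum liploc_cmult) auto
  have lu: "liploc u" unfolding u_def by (rule liploc_linear[OF lg ls])
  \<comment> \<open>The expansion contributes \<epsilon>, and each of the n coordinates contributes
    \<epsilon> * c for using q in place of w y.\<close>
  define \<delta> where "\<delta> = \<epsilon> * (1 + real n * c)"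
  have \<delta>: "0 < \<delta>" unfolding \<delta>_def using \<epsilon> c by (intro mult_pos_pos) (auto intro: add_pos_nonneg)
  have "\<delta>-lipschitz_on A u"
  proof (rule lipschitz_onI)
    fix x y assume x: "x \<in> A" and y: "y \<in> A"
    \<comment> \<open>Both points are within r/2 of z, so the expansion at y may be evaluated at
      x.\<close>
    have "dist x y < r" using x y dist_triangle3[of x y z] unfolding A_def by (auto simp: dist_commute)
    then have 1: "\<bar>g a x - g a y - (\<Sum>i<n. w y i * (p i x - p i y))\<bar> \<le> \<epsilon> * dist x y"
      using x y unfolding A_def by blast
    have "u x - u y = (g a x - g a y - (\<Sum>i<n. w y i * (p i x - p i y))) + (\<Sum>i<n. (w y i - q i) * (p i x - p i y))"
      unfolding u_def by (simp add: sum_subtractf algebra_simps sum.distrib)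
    also have "\<bar>\<dots>\<bar> \<le> \<epsilon> * dist x y + \<bar>\<Sum>i<n. (w y i - q i) * (p i x - p i y)\<bar>"
      using 1 by linarith
    also have "\<bar>\<Sum>i<n. (w y i - q i) * (p i x - p i y)\<bar> \<le> (\<Sum>i<n. \<epsilon> * (c * dist x y))"
    proof (rule order_trans[OF sum_abs], rule sum_mono)
      fix i assume "i \<in> {..<n}"
      then have i: "i < n" by simp
      have "\<bar>w y i - q i\<bar> \<le> \<epsilon>" using y i unfolding A_def by blast
      moreover have "\<bar>p i x - p i y\<bar> \<le> c * dist x y" using lipschitz_onD[OF p[OF i], of x y] by (simp add: dist_real_def)
      ultimately show "\<bar>(w y i - q i) * (p i x - p i y)\<bar> \<le> \<epsilon> * (c * dist x y)"
        unfolding abs_mult using \<epsilon> by (intro mult_mono) auto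
    qed
    finally show "dist (u x) (u y) \<le> \<delta> * dist x y"
      unfolding \<delta>_def by (simp add: dist_real_def algebra_simps)
  qed (use \<delta> in simp)
  \<comment> \<open>A is not known to be measurable; its closure is a Borel set, and continuity of u
    carries the constant over to it.\<close>
  then have uA: "\<delta>-lipschitz_on (closure A) u"
    by (rule lipschitz_on_closure) (rule continuous_on_subset[OF liploc_continuous[OF lu] subset_UNIV])
  have clA: "closure A \<subseteq> closure (V J)" by (rule closure_mono) (auto simp: A_def)
  have "AE x in m. x \<in> closure A \<longrightarrow> \<bar>H (g(a := u)) x\<bar> \<le> (\<Prod>b<k. (L(a := \<delta>)) b)"
  proof (rule H_local_bound[OF ktuple_upd[OF g a lu]])
    show "((L(a := \<delta>)) b)-lipschitz_on (closure A) ((g(a := u)) b)" if "b < k" for b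
      using uA lipschitz_on_subset[OF L(2)[OF that] clA] by auto
  qed (use L(1) \<delta> in auto)
  \<comment> \<open>Only the factor of entry a is replaced by \<delta>; it alone makes the product
    small.\<close>
  moreover have "(\<Prod>b<k. (L(a := \<delta>)) b) = \<epsilon> * ((1 + real n * c) * (\<Prod>b\<in>{..<k} - {a}. L b))"
    using a by (subst prod.remove[of _ a]) (auto simp: \<delta>_def mult.assoc intro!: prod.cong)
  moreover have "AE x in m. H (g(a := u)) x = 1 * H (g(a := g a)) x + (-1) * H (g(a := (\<lambda>x. \<Sum>i<n. q i * p i x))) x"
    unfolding u_def by (rule H_linear[OF g a lg ls])
  moreover have "AE x in m. H (g(a := (\<lambda>x. \<Sum>i<n. q i * p i x))) x = (\<Sum>i<n. q i * H (g(a := p i)) x)"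
    by (rule H_linear_sum[OF g a lp])
  ultimately show ?thesis
  proof (elim AE_mp, intro AE_I2 impI)
  qed (use closure_subset[of A] in auto)
qed

lemma ex_rat_near: "0 < e \<Longrightarrow> \<exists>q::rat. \<bar>t - real_of_rat q\<bar> \<le> e"
proof -
  assume "0 < e"
  then obtain q where "t - e < real_of_rat q" "real_of_rat q < t + e"
    using of_rat_dense[of "t - e" "t + e"] by auto
  then show ?thesis by (intro exI[of _ q]) (auto simp: abs_le_iff)
qed

text \<open>Almost every y satisfies all of the countably many estimates at once. For such a y in Y
  and each precision, a suitable scale, dense point and rational covector put y into one of the
  sets; the errors then tend to 0 at this fixed y.\<close>

lemma H_chain_rule:
  fixes p :: "nat \<Rightarrow> 'a \<Rightarrow> real"
  assumes D: "countable (D :: 'a set)" "closure D = UNIV"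
    and g: "ktuple k g" and a: "a < k" and p: "\<And>i. i < n \<Longrightarrow> c-lipschitz_on UNIV (p i)" and c: "0 \<le> c"
    and diff: "AE y in m. y \<in> Y \<longrightarrow>
      ((\<lambda>x. (g a x - g a y - (\<Sum>i<n. w y i * (p i x - p i y))) / dist x y) \<longlongrightarrow> 0) (at y within Y)"
  shows "AE y in m. y \<in> Y \<longrightarrow> H g y = (\<Sum>i<n. w y i * H (g(a := p i)) y)"
proof -
  define L where "L J = (SOME L. (\<forall>b<k. 0 < L b) \<and> (\<forall>b<k. (L b)-lipschitz_on (closure (V J)) (g b)))" for J
  have L: "\<forall>b<k. 0 < L J b" "\<forall>b<k. (L J b)-lipschitz_on (closure (V J)) (g b)" for J
  proof -
    have "\<exists>L. (\<forall>b<k. 0 < L b) \<and> (\<forall>b<k. (L b)-lipschitz_on (closure (V J)) (g b))"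
      by (rule ktuple_lipschitz_constants[OF g closure_V_compact[of J]]) blast
    from someI_ex[OF this] show "\<forall>b<k. 0 < L J b" "\<forall>b<k. (L J b)-lipschitz_on (closure (V J)) (g b)"
      unfolding L_def by blast+
  qed
  define \<epsilon> where "\<epsilon> N = 1 / real (Suc N)" for N
  have \<epsilon>: "0 < \<epsilon> N" for N by (simp add: \<epsilon>_def)
  define Q where "Q J = (1 + real n * c) * (\<Prod>b\<in>{..<k} - {a}. L J b)" for J
  \<comment> \<open>Precision N, scale M, rational covector l, point t of the dense set, exhaustion
    index J. Every index has a countable type, a covector being coded as a list.\<close>
  define A where "A N M l t J = {y \<in> Y. y \<in> V J \<and> dist (from_nat_into D t) y < \<epsilon> M / 2 \<and>
      (\<forall>i<n. \<bar>w y i - real_of_rat (l ! i)\<bar> \<le> \<epsilon> N) \<and>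
      (\<forall>x\<in>Y. dist x y < \<epsilon> M \<longrightarrow> \<bar>g a x - g a y - (\<Sum>i<n. w y i * (p i x - p i y))\<bar> \<le> \<epsilon> N * dist x y)}"
    for N M :: nat and l :: "rat list" and t J :: nat
  have "AE y in m. y \<in> A N M l t J \<longrightarrow>
     \<bar>H g y - (\<Sum>i<n. real_of_rat (l ! i) * H (g(a := p i)) y)\<bar> \<le> \<epsilon> N * Q J" for N M l t J
    unfolding Q_def using L by (intro H_bound_on_approximating_set[OF g a p c _ _ \<epsilon> A_def]) auto
  then have "AE y in m. \<forall>N M l t J. y \<in> A N M l t J \<longrightarrow>
     \<bar>H g y - (\<Sum>i<n. real_of_rat (l ! i) * H (g(a := p i)) y)\<bar> \<le> \<epsilon> N * Q J"
    by (simp add: AE_all_countable)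
  then show ?thesis
    using diff
  proof eventually_elim
    case (elim y)
    show ?case
    proof
      assume y: "y \<in> Y"
      define R where "R = H g y - (\<Sum>i<n. w y i * H (g(a := p i)) y)"
      \<comment> \<open>Fixed before the precision N, so that \<open>Q J\<close> stays the same as N
        grows.\<close>
      obtain J where J: "y \<in> V J" using V_cover by blast
      \<comment> \<open>Controls the error of passing from the rational covector back to w
        y.\<close>
      define S where "S = (\<Sum>i<n. \<bar>H (g(a := p i)) y\<bar>)"
      have "\<bar>R\<bar> \<le> (Q J + S) / real (Suc N)" for N
      proof -
        have "\<forall>\<^sub>F x in at y within Y. dist ((g a x - g a y - (\<Sum>i<n. w y i * (p i x - p i y))) / dist x y) 0 < \<epsilon> N"
          using elim(2) y \<epsilon>[of N] by (intro tendstoD) auto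
        then obtain r where r: "r > 0" "\<And>x. x \<in> Y \<Longrightarrow> x \<noteq> y \<Longrightarrow> dist x y < r \<Longrightarrow>
           \<bar>(g a x - g a y - (\<Sum>i<n. w y i * (p i x - p i y))) / dist x y\<bar> < \<epsilon> N"
          unfolding eventually_at by (auto simp: dist_real_def)
        obtain M where M: "\<epsilon> M < r" unfolding \<epsilon>_def using nat_approx_posE[OF r(1)] by metis
        have lip: "\<bar>g a x - g a y - (\<Sum>i<n. w y i * (p i x - p i y))\<bar> \<le> \<epsilon> N * dist x y" if x: "x \<in> Y" "dist x y < \<epsilon> M" for x
        proof (cases "x = y")
          case False
          then have "\<bar>g a x - g a y - (\<Sum>i<n. w y i * (p i x - p i y))\<bar> / dist x y < \<epsilon> N"
            using r(2)[OF x(1) False] x(2) M by (simp add: abs_divide)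
          then show ?thesis using False by (simp add: divide_less_eq)
        qed simp
        obtain z where "z \<in> D" "dist z y < \<epsilon> M / 2"
          using closure_approachable[of y D] D(2) \<epsilon>[of M] by (metis UNIV_I half_gt_zero)
        moreover then obtain t where "from_nat_into D t = z" using from_nat_into_surj[OF D(1)] by metis
        ultimately have t: "dist (from_nat_into D t) y < \<epsilon> M / 2" by simp
        have "\<forall>i. \<exists>q. \<bar>w y i - real_of_rat q\<bar> \<le> \<epsilon> N" using ex_rat_near[OF \<epsilon>[of N]] by blast
        from choice[OF this] obtain qf where qf: "\<And>i. \<bar>w y i - real_of_rat (qf i)\<bar> \<le> \<epsilon> N" by blast
        define l where "l = map qf [0..<n]"
        have l: "\<bar>w y i - real_of_rat (l ! i)\<bar> \<le> \<epsilon> N" if "i < n" for i using qf[of i] that by (simp add: l_def)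
        have "y \<in> A N M l t J" unfolding A_def using y J t l lip by blast
        then have b1: "\<bar>H g y - (\<Sum>i<n. real_of_rat (l ! i) * H (g(a := p i)) y)\<bar> \<le> \<epsilon> N * Q J" using elim(1) by blast
        have "R = (H g y - (\<Sum>i<n. real_of_rat (l ! i) * H (g(a := p i)) y))
            - (\<Sum>i<n. (w y i - real_of_rat (l ! i)) * H (g(a := p i)) y)"
          unfolding R_def by (simp add: left_diff_distrib sum_subtractf)
        moreover have "\<bar>\<Sum>i<n. (w y i - real_of_rat (l ! i)) * H (g(a := p i)) y\<bar> \<le> \<epsilon> N * S"
          unfolding S_def sum_distrib_left
          by (rule order_trans[OF sum_abs], rule sum_mono) (use l in \<open>auto simp: abs_mult intro: mult_right_mono\<close>)
        ultimately have "\<bar>R\<bar> \<le> \<epsilon> N * Q J + \<epsilon> N * S" using b1 by linarith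
        then show ?thesis by (simp add: \<epsilon>_def add_divide_distrib)
      qed
      then have "\<bar>R\<bar> \<le> 0"
        by (intro LIMSEQ_le_const[OF inverse_nat_LIMSEQ[of "Q J + S"]]) blast
      then show "H g y = (\<Sum>i<n. w y i * H (g(a := p i)) y)" by (simp add: R_def)
    qed
  qed
qed

end

section \<open>Coordinate tuples and the k-vector of their densities\<close>

definition coord_tuple :: "nat \<Rightarrow> (nat \<Rightarrow> 'a \<Rightarrow> real) \<Rightarrow> (nat \<Rightarrow> nat) \<Rightarrow> nat \<Rightarrow> 'a \<Rightarrow> real" where
  "coord_tuple k p \<phi> = (\<lambda>b. if b < k then p (\<phi> b) else (\<lambda>_. 0))"

lemma ktuple_coord_tuple:
  "(\<And>i. i < n \<Longrightarrow> liploc (p i)) \<Longrightarrow> (\<And>b. b < k \<Longrightarrow> \<phi> b < n) \<Longrightarrow> ktuple k (coord_tuple k p \<phi>)"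
  unfolding ktuple_def coord_tuple_def by auto

context lf_current
begin

lemma current_coord_tuple_perm:
  assumes p: "\<And>i. i < n \<Longrightarrow> liploc (p i)" and f: "lipc f" and \<sigma>: "\<sigma> permutes {..<k}"
    and \<phi>: "\<And>b. b < k \<Longrightarrow> \<phi> b < n"
  shows "T f (coord_tuple k p (\<phi> \<circ> \<sigma>)) = of_int (sign \<sigma>) * T f (coord_tuple k p \<phi>)"
proof -
  \<comment> \<open>Generalised over \<phi>: in the induction step the outer transposition is
    absorbed into \<phi> before the hypothesis is used.\<close>
  have "\<forall>\<phi>. (\<forall>b<k. \<phi> b < n) \<longrightarrow> T f (coord_tuple k p (\<phi> \<circ> \<sigma>)) = of_int (sign \<sigma>) * T f (coord_tuple k p \<phi>)"
    using \<sigma> finite_lessThan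
  proof (induction rule: permutes_induct)
    case id
    then show ?case by simp
  next
    case (swap a b \<tau>)
    show ?case
    proof (intro allI impI)
      fix \<phi> assume \<phi>: "\<forall>b<k. \<phi> b < n"
      let ?t = "Transposition.transpose a b"
      have ab: "a < k" "b < k" "a \<noteq> b" using swap by auto
      have "(\<phi> \<circ> ?t) c < n" if "c < k" for c
        using \<phi> ab that by (auto simp: Transposition.transpose_def)
      then have "T f (coord_tuple k p ((\<phi> \<circ> ?t) \<circ> \<tau>)) = of_int (sign \<tau>) * T f (coord_tuple k p (\<phi> \<circ> ?t))"
        using swap.IH by blast
      moreover have "coord_tuple k p (\<phi> \<circ> ?t)
          = (coord_tuple k p \<phi>)(a := coord_tuple k p \<phi> b, b := coord_tuple k p \<phi> a)"
        using ab by (auto simp: coord_tuple_def Transposition.transpose_def fun_eq_iff)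
      moreover have "T f ((coord_tuple k p \<phi>)(a := coord_tuple k p \<phi> b, b := coord_tuple k p \<phi> a))
          = - T f (coord_tuple k p \<phi>)"
        using \<phi> by (intro current_swap ktuple_coord_tuple[OF p] ab f) auto
      moreover have "sign (?t \<circ> \<tau>) = - sign \<tau>"
        using sign_compose[OF permutation_swap_id permutes_imp_permutation[OF finite_lessThan \<open>\<tau> permutes {..<k}\<close>], of a b] ab
        by (simp add: sign_swap_id)
      ultimately show "T f (coord_tuple k p (\<phi> \<circ> (?t \<circ> \<tau>))) = of_int (sign (?t \<circ> \<tau>)) * T f (coord_tuple k p \<phi>)"
        by (simp add: o_assoc)
    qed
  qed
  then show ?thesis using \<phi> by blast
qed

lemma H_coord_tuple_perm:
  assumes p: "\<And>i. i < n \<Longrightarrow> liploc (p i)" and \<sigma>: "\<sigma> permutes {..<k}" and \<phi>: "\<And>b. b < k \<Longrightarrow> \<phi> b < n"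
  shows "AE x in m. H (coord_tuple k p (\<phi> \<circ> \<sigma>)) x = of_int (sign \<sigma>) * H (coord_tuple k p \<phi>) x"
proof (rule H_unique)
  have k1: "ktuple k (coord_tuple k p \<phi>)" by (rule ktuple_coord_tuple[OF p \<phi>])
  show "ktuple k (coord_tuple k p (\<phi> \<circ> \<sigma>))"
  proof (rule ktuple_coord_tuple[OF p])
    show "(\<phi> \<circ> \<sigma>) b < n" if "b < k" for b using \<phi> permutes_in_image[OF \<sigma>, of b] that by simp
  qed
  show "lbdd (\<lambda>x. of_int (sign \<sigma>) * H (coord_tuple k p \<phi>) x)"
    using lbdd_linear[OF H_lbdd[OF k1] lbdd_zero, of "of_int (sign \<sigma>)" 0] by simp
  show "T f (coord_tuple k p (\<phi> \<circ> \<sigma>)) = (\<integral>x. f x * (of_int (sign \<sigma>) * H (coord_tuple k p \<phi>) x) \<partial>m)" if f: "lipc f" for f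
  proof -
    have "(\<integral>x. f x * (of_int (sign \<sigma>) * H (coord_tuple k p \<phi>) x) \<partial>m) = (\<integral>x. of_int (sign \<sigma>) * (f x * H (coord_tuple k p \<phi>) x) \<partial>m)"
      by (rule Bochner_Integration.integral_cong) (auto simp: mult_ac)
    also have "\<dots> = of_int (sign \<sigma>) * T f (coord_tuple k p \<phi>)" using H_eq[OF k1 f] by simp
    finally show ?thesis using current_coord_tuple_perm[OF p f \<sigma> \<phi>] by simp
  qed
qed

lemma H_coord_tuple_noninj:
  assumes p: "\<And>i. i < n \<Longrightarrow> liploc (p i)" and \<phi>: "\<And>b. b < k \<Longrightarrow> \<phi> b < n" and ni: "\<not> inj_on \<phi> {..<k}"
  shows "AE x in m. H (coord_tuple k p \<phi>) x = 0"
proof (rule H_unique[OF _ lbdd_zero])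
  show k1: "ktuple k (coord_tuple k p \<phi>)" by (rule ktuple_coord_tuple[OF p \<phi>])
  obtain a b where "a < k" "b < k" "a \<noteq> b" "\<phi> a = \<phi> b" using ni unfolding inj_on_def by auto
  then show "T f (coord_tuple k p \<phi>) = (\<integral>x. f x * 0 \<partial>m)" if "lipc f" for f
    using current_alternating[OF k1 _ _ _ _ that, of a b] by (simp add: coord_tuple_def)
qed

text \<open>The entries are expanded one after another. Entry j of a partially expanded tuple is
  still g j, so the same differential w j serves all of these tuples.\<close>

lemma H_expand:
  fixes p :: "nat \<Rightarrow> 'a \<Rightarrow> real"
  assumes D: "countable (D :: 'a set)" "closure D = UNIV"
    and g: "ktuple k g" and p: "\<And>i. i < n \<Longrightarrow> c-lipschitz_on UNIV (p i)" and c: "0 \<le> c"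
    and diff: "\<And>a. a < k \<Longrightarrow> AE y in m. y \<in> Y \<longrightarrow>
      ((\<lambda>x. (g a x - g a y - (\<Sum>i<n. w a y i * (p i x - p i y))) / dist x y) \<longlongrightarrow> 0) (at y within Y)"
    and "j \<le> k"
  shows "AE y in m. y \<in> Y \<longrightarrow> H g y =
    (\<Sum>\<phi>\<in>PiE {..<j} (\<lambda>_. {..<n}). (\<Prod>a<j. w a y (\<phi> a)) * H (\<lambda>b. if b < j then p (\<phi> b) else g b) y)"
  using \<open>j \<le> k\<close>
proof (induction j)
  case 0
  have "(\<lambda>b. if b < 0 then p b else g b) = g" by auto
  then show ?case by simp
next
  case (Suc j)
  define G where "G j \<phi> = (\<lambda>b. if b < j then p (\<phi> b) else g b)" for j and \<phi> :: "nat \<Rightarrow> nat"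
  have j: "j < k" using Suc.prems by simp
  have lp: "liploc (p i)" if "i < n" for i by (rule liplocI[OF p[OF that]])
  have "AE y in m. \<forall>\<phi>\<in>PiE {..<j} (\<lambda>_. {..<n}). y \<in> Y \<longrightarrow> H (G j \<phi>) y = (\<Sum>i<n. w j y i * H ((G j \<phi>)(j := p i)) y)"
  proof (rule AE_finite_allI)
    show "finite (PiE {..<j} (\<lambda>_. {..<n}))" by (rule finite_PiE) auto
    fix \<phi> assume "\<phi> \<in> PiE {..<j} (\<lambda>_. {..<n})"
    then have "ktuple k (G j \<phi>)"
      using g lp j unfolding ktuple_def G_def by (auto simp: PiE_iff)
    moreover have "G j \<phi> j = g j" by (simp add: G_def)
    ultimately show "AE y in m. y \<in> Y \<longrightarrow> H (G j \<phi>) y = (\<Sum>i<n. w j y i * H ((G j \<phi>)(j := p i)) y)"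
      using diff[OF j] by (intro H_chain_rule[OF D _ j p c]) auto
  qed
  moreover have "AE y in m. y \<in> Y \<longrightarrow> H g y = (\<Sum>\<phi>\<in>PiE {..<j} (\<lambda>_. {..<n}). (\<Prod>a<j. w a y (\<phi> a)) * H (G j \<phi>) y)"
    using Suc unfolding G_def by simp
  ultimately have "AE y in m. y \<in> Y \<longrightarrow> H g y =
    (\<Sum>\<phi>\<in>PiE {..<Suc j} (\<lambda>_. {..<n}). (\<Prod>a<Suc j. w a y (\<phi> a)) * H (G (Suc j) \<phi>) y)"
  proof eventually_elim
    case (elim y)
    have G: "(G j \<phi>)(j := p i) = G (Suc j) (\<phi>(j := i))" for \<phi> i
      by (auto simp: G_def fun_eq_iff less_Suc_eq)
    have P: "(\<Prod>a<Suc j. w a y ((\<phi>(j := i)) a)) = (\<Prod>a<j. w a y (\<phi> a)) * w j y i" for \<phi> i by simp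
    show ?case
    proof
      assume y: "y \<in> Y"
      have "H g y = (\<Sum>\<phi>\<in>PiE {..<j} (\<lambda>_. {..<n}). (\<Prod>a<j. w a y (\<phi> a)) * (\<Sum>i<n. w j y i * H (G (Suc j) (\<phi>(j := i))) y))"
        using elim y by (simp add: G)
      also have "\<dots> = (\<Sum>\<phi>\<in>PiE {..<j} (\<lambda>_. {..<n}). \<Sum>i<n. (\<Prod>a<Suc j. w a y ((\<phi>(j := i)) a)) * H (G (Suc j) (\<phi>(j := i))) y)"
        unfolding P sum_distrib_left by (simp only: mult.assoc)
      also have "\<dots> = (\<Sum>\<phi>\<in>PiE {..<Suc j} (\<lambda>_. {..<n}). (\<Prod>a<Suc j. w a y (\<phi> a)) * H (G (Suc j) \<phi>) y)"
        by (rule sum_PiE_lessThan_Suc[symmetric])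
      finally show "H g y = (\<Sum>\<phi>\<in>PiE {..<Suc j} (\<lambda>_. {..<n}). (\<Prod>a<Suc j. w a y (\<phi> a)) * H (G (Suc j) \<phi>) y)" .
    qed
  qed
  then show ?case unfolding G_def .
qed

lemma H_wedge_pair:
  fixes p :: "nat \<Rightarrow> 'a \<Rightarrow> real"
  assumes D: "countable (D :: 'a set)" "closure D = UNIV"
    and g: "ktuple k g" and p: "\<And>i. i < n \<Longrightarrow> c-lipschitz_on UNIV (p i)" and c: "0 \<le> c"
    and diff: "\<And>a. a < k \<Longrightarrow> AE y in m. y \<in> Y \<longrightarrow>
      ((\<lambda>x. (g a x - g a y - (\<Sum>i<n. w a y i * (p i x - p i y))) / dist x y) \<longlongrightarrow> 0) (at y within Y)"
  shows "AE y in m. y \<in> Y \<longrightarrow> H g y =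
    wedge_pair k n (\<lambda>a. w a y) (\<lambda>I. H (coord_tuple k p (\<lambda>b. sorted_list_of_set I ! b)) y)"
proof -
  have lp: "liploc (p i)" if "i < n" for i by (rule liplocI[OF p[OF that]])
  have "(\<lambda>b. if b < k then p (\<phi> b) else g b) = coord_tuple k p \<phi>" for \<phi>
    using g unfolding coord_tuple_def ktuple_def by auto
  then have "AE y in m. y \<in> Y \<longrightarrow> H g y =
    (\<Sum>\<phi>\<in>PiE {..<k} (\<lambda>_. {..<n}). (\<Prod>a<k. w a y (\<phi> a)) * H (coord_tuple k p \<phi>) y)"
    using H_expand[OF D g p c diff order_refl] by simp
  moreover have "AE y in m. \<forall>\<phi>\<in>PiE {..<k} (\<lambda>_. {..<n}). \<not> inj_on \<phi> {..<k} \<longrightarrow> H (coord_tuple k p \<phi>) y = 0"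
  proof (rule AE_finite_allI)
    show "finite (PiE {..<k} (\<lambda>_. {..<n}))" by (rule finite_PiE) auto
    fix \<phi> assume \<phi>: "\<phi> \<in> PiE {..<k} (\<lambda>_. {..<n})"
    show "AE y in m. \<not> inj_on \<phi> {..<k} \<longrightarrow> H (coord_tuple k p \<phi>) y = 0"
    proof (cases "inj_on \<phi> {..<k}")
      case False
      have "AE y in m. H (coord_tuple k p \<phi>) y = 0"
        by (rule H_coord_tuple_noninj[OF lp _ False]) (use \<phi> in \<open>auto simp: PiE_iff\<close>)
      then show ?thesis by simp
    qed simp
  qed
  moreover have "AE y in m. \<forall>x\<in>{I. I \<subseteq> {..<n} \<and> card I = k} \<times> {\<sigma>. \<sigma> permutes {..<k}}.
     H (coord_tuple k p ((\<lambda>b. sorted_list_of_set (fst x) ! b) \<circ> snd x)) y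
       = of_int (sign (snd x)) * H (coord_tuple k p (\<lambda>b. sorted_list_of_set (fst x) ! b)) y"
  proof (rule AE_finite_allI)
    have "finite {I. I \<subseteq> {..<n} \<and> card I = k}" by (rule finite_subset[of _ "Pow {..<n}"]) auto
    then show "finite ({I. I \<subseteq> {..<n} \<and> card I = k} \<times> {\<sigma>. \<sigma> permutes {..<k}})"
      using finite_permutations[of "{..<k}"] by simp
    fix x assume x: "x \<in> {I. I \<subseteq> {..<n} \<and> card I = k} \<times> {\<sigma>. \<sigma> permutes {..<k}}"
    show "AE y in m. H (coord_tuple k p ((\<lambda>b. sorted_list_of_set (fst x) ! b) \<circ> snd x)) y
       = of_int (sign (snd x)) * H (coord_tuple k p (\<lambda>b. sorted_list_of_set (fst x) ! b)) y"
    proof (rule H_coord_tuple_perm[OF lp])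
      show "snd x permutes {..<k}" using x by auto
      fix b assume b: "b < k"
      have fst: "fst x \<subseteq> {..<n}" "card (fst x) = k" using x by auto
      then have "finite (fst x)" using finite_subset by blast
      then have "sorted_list_of_set (fst x) ! b \<in> fst x"
        using b fst(2) by (metis length_sorted_list_of_set nth_mem set_sorted_list_of_set)
      then show "sorted_list_of_set (fst x) ! b < n" using fst(1) by blast
    qed
  qed
  ultimately show ?thesis
  proof eventually_elim
    case (elim y)
    have "(\<Sum>\<phi>\<in>PiE {..<k} (\<lambda>_. {..<n}). (\<Prod>a<k. w a y (\<phi> a)) * H (coord_tuple k p \<phi>) y)
       = wedge_pair k n (\<lambda>a. w a y) (\<lambda>I. H (coord_tuple k p (\<lambda>b. sorted_list_of_set I ! b)) y)"
    proof (rule sum_alternating_eq_wedge_pair)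
      show "H (coord_tuple k p \<phi>) y = 0" if "\<phi> \<in> PiE {..<k} (\<lambda>_. {..<n})" "\<not> inj_on \<phi> {..<k}" for \<phi>
        using elim(2) that by blast
      fix I \<sigma> assume I: "I \<subseteq> {..<n}" "card I = k" "\<sigma> permutes {..<k}"
      \<comment> \<open>\<open>coord_tuple\<close> reads its index function below k only, so the
        restriction is invisible.\<close>
      have "coord_tuple k p (restrict (\<lambda>a. sorted_list_of_set I ! \<sigma> a) {..<k}) = coord_tuple k p ((\<lambda>b. sorted_list_of_set I ! b) \<circ> \<sigma>)"
        by (auto simp: coord_tuple_def)
      then show "H (coord_tuple k p (restrict (\<lambda>a. sorted_list_of_set I ! \<sigma> a) {..<k})) y
         = of_int (sign \<sigma>) * H (coord_tuple k p (\<lambda>b. sorted_list_of_set I ! b)) y"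
        using elim(3)[rule_format, of "(I, \<sigma>)"] I by simp
    qed
    then show ?case using elim(1) by simp
  qed
qed

section \<open>Bounded Borel forms and the passage from the mass to the reference measure\<close>

lemma sigma_finite_mass: "sigma_finite_measure m"
proof
  have "countable (range V) \<and> range V \<subseteq> sets m \<and> \<Union> (range V) = space m \<and> (\<forall>a\<in>range V. emeasure m a \<noteq> \<infinity>)"
    using V_cover emeasure_V_finite by (auto simp: less_top)
  then show "\<exists>A. countable A \<and> A \<subseteq> sets m \<and> \<Union> A = space m \<and> (\<forall>a\<in>A. emeasure m a \<noteq> \<infinity>)" by blast
qed

end

lemma bborel_c_linear:
  assumes "bborel_c f" "bborel_c g"
  shows "bborel_c (\<lambda>x. a * f x + b * g x)"
proof -
  obtain K L where K: "compact K" "{x. f x \<noteq> 0} \<subseteq> K" "compact L" "{x. g x \<noteq> 0} \<subseteq> L"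
    using assms unfolding bborel_c_def by blast
  obtain B C where B: "\<And>x. \<bar>f x\<bar> \<le> B" "\<And>x. \<bar>g x\<bar> \<le> C"
    using assms unfolding bborel_c_def bounded_iff by (metis rangeI real_norm_def)
  have "{x. a * f x + b * g x \<noteq> 0} \<subseteq> {x. f x \<noteq> 0} \<union> {x. g x \<noteq> 0}" by auto
  then have "{x. a * f x + b * g x \<noteq> 0} \<subseteq> K \<union> L" using K by blast
  moreover have "\<bar>a * f x + b * g x\<bar> \<le> \<bar>a\<bar> * B + \<bar>b\<bar> * C" for x
  proof -
    have "\<bar>a * f x + b * g x\<bar> \<le> \<bar>a\<bar> * \<bar>f x\<bar> + \<bar>b\<bar> * \<bar>g x\<bar>" by (metis abs_mult abs_triangle_ineq)
    also have "\<dots> \<le> \<bar>a\<bar> * B + \<bar>b\<bar> * C" using B by (intro add_mono mult_left_mono) auto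
    finally show ?thesis .
  qed
  moreover have "(\<lambda>x. a * f x + b * g x) \<in> borel_measurable borel" using assms unfolding bborel_c_def by auto
  ultimately show ?thesis
    using K compact_Un unfolding bborel_c_def bounded_iff by auto
qed

lemma bborel_c_indicator:
  assumes "bborel_c f" "Y \<in> sets borel"
  shows "bborel_c (\<lambda>x. indicator Y x * f x)"
proof -
  obtain K where K: "compact K" "{x. f x \<noteq> 0} \<subseteq> K" using assms unfolding bborel_c_def by blast
  obtain B where B: "\<And>x. \<bar>f x\<bar> \<le> B"
    using assms unfolding bborel_c_def bounded_iff by (metis rangeI real_norm_def)
  have "0 \<le> B" using B[of undefined] by linarith
  then have "\<bar>indicator Y x * f x\<bar> \<le> B" for x using B[of x] by (auto simp: indicator_def)
  then have "bounded (range (\<lambda>x. indicator Y x * f x))" unfolding bounded_iff by auto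
  moreover have "{x. indicator Y x * f x \<noteq> 0} \<subseteq> K" using K by auto
  moreover have "(\<lambda>x. indicator Y x * f x) \<in> borel_measurable borel" using assms unfolding bborel_c_def by auto
  ultimately show ?thesis using K(1) unfolding bborel_c_def by blast
qed

text \<open>\<open>precurrent_on\<close> asks for integrable coefficients at every set I; cutting
  them off outside the k-subsets of {..<n} meets this and does not affect the pairing.\<close>

lemma wedge_pair_scale:
  "wedge_pair k n w (\<lambda>I. if I \<subseteq> {..<n} \<and> card I = k then t * lam I else 0) = t * wedge_pair k n w lam"
  unfolding wedge_pair_def sum_distrib_left by (rule sum.cong) (auto simp: mult.assoc)

lemma borel_measurable_wedge_pair:
  assumes w: "\<And>a i. a < k \<Longrightarrow> i < n \<Longrightarrow> (\<lambda>y. w y a i) \<in> borel_measurable M"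
    and lam: "\<And>I. I \<subseteq> {..<n} \<Longrightarrow> card I = k \<Longrightarrow> (\<lambda>y. lam y I) \<in> borel_measurable M"
  shows "(\<lambda>y. wedge_pair k n (w y) (lam y)) \<in> borel_measurable M"
  unfolding wedge_pair_def kdet_def
proof (intro borel_measurable_sum borel_measurable_times borel_measurable_const borel_measurable_prod)
  fix I assume I: "I \<in> {I. I \<subseteq> {..<n} \<and> card I = k}"
  then show "(\<lambda>y. lam y I) \<in> borel_measurable M" using lam by blast
  fix \<sigma> a assume \<sigma>: "\<sigma> \<in> {\<sigma>. \<sigma> permutes {..<k}}" and a: "a \<in> {..<k}"
  have fin: "finite I" using I finite_subset by blast
  have "\<sigma> a < length (sorted_list_of_set I)" using permutes_in_image[of \<sigma> "{..<k}" a] \<sigma> a I fin by simp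
  then have "sorted_list_of_set I ! \<sigma> a \<in> I" using fin by (metis nth_mem set_sorted_list_of_set)
  then show "(\<lambda>y. w y a (sorted_list_of_set I ! \<sigma> a)) \<in> borel_measurable M" using w a I by auto
qed

context lf_current
begin

text \<open>Through \<open>current_ext_eq\<close> the claim becomes linearity of an integral; in the
  entries, the density is linear almost everywhere.\<close>

lemma multilinear_current_ext:
  assumes Y: "Y \<in> sets borel"
  shows "multilinear_on k bborel_c liploc (\<lambda>\<beta> g. current_ext k T (\<lambda>x. indicator Y x * \<beta> x) g)"
  unfolding multilinear_on_def
proof (intro conjI allI impI)
  have int: "integrable m (\<lambda>x. (indicator Y x * f x) * H g x)" if f: "bborel_c f" and g: "ktuple k g" for f g
  proof -
    have b: "bborel_c (\<lambda>x. indicator Y x * f x)" by (rule bborel_c_indicator[OF f Y])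
    obtain K where K: "compact K" "{x. indicator Y x * f x \<noteq> 0} \<subseteq> K" using b unfolding bborel_c_def by blast
    obtain B where B: "\<And>x. \<bar>indicator Y x * f x\<bar> \<le> B"
      using b unfolding bborel_c_def bounded_iff by (metis rangeI real_norm_def)
    obtain j where j: "K \<subseteq> V j" by (rule compact_subset_V[OF K(1)])
    have "integrable m (\<lambda>x. indicator Y x * f x)"
      using b K(2) j by (intro integrable_if_bounded[of _ B j] B) (auto simp: bborel_c_def)
    then show ?thesis using K(2) j by (intro lbdd_integrable[OF H_lbdd[OF g]]) auto
  qed
  {
    fix f1 f2 :: "'a \<Rightarrow> real" and g :: "nat \<Rightarrow> 'a \<Rightarrow> real" and a b
    assume A: "bborel_c f1 \<and> bborel_c f2 \<and> (\<forall>i<k. liploc (g i)) \<and> (\<forall>i\<ge>k. g i = (\<lambda>_. 0))"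
    then have f: "bborel_c f1" "bborel_c f2" and g: "ktuple k g" by (auto simp: ktuple_def)
    have "current_ext k T (\<lambda>x. indicator Y x * (a * f1 x + b * f2 x)) g
       = (\<integral>x. a * ((indicator Y x * f1 x) * H g x) + b * ((indicator Y x * f2 x) * H g x) \<partial>m)"
      unfolding current_ext_eq[OF bborel_c_indicator[OF bborel_c_linear[OF f] Y] g]
      by (rule Bochner_Integration.integral_cong) (auto simp: algebra_simps)
    also have "\<dots> = a * current_ext k T (\<lambda>x. indicator Y x * f1 x) g + b * current_ext k T (\<lambda>x. indicator Y x * f2 x) g"
      unfolding current_ext_eq[OF bborel_c_indicator[OF f(1) Y] g] current_ext_eq[OF bborel_c_indicator[OF f(2) Y] g]
      using int[OF f(1) g] int[OF f(2) g] by simp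
    finally show "current_ext k T (\<lambda>x. indicator Y x * (a * f1 x + b * f2 x)) g
       = a * current_ext k T (\<lambda>x. indicator Y x * f1 x) g + b * current_ext k T (\<lambda>x. indicator Y x * f2 x) g" .
  next
    fix f :: "'a \<Rightarrow> real" and g :: "nat \<Rightarrow> 'a \<Rightarrow> real" and i and h1 h2 :: "'a \<Rightarrow> real" and a b
    assume A: "bborel_c f \<and> (\<forall>i<k. liploc (g i)) \<and> (\<forall>i\<ge>k. g i = (\<lambda>_. 0)) \<and> i < k \<and> liploc h1 \<and> liploc h2"
    then have f: "bborel_c f" and g: "ktuple k g" and i: "i < k" and h: "liploc h1" "liploc h2" by (auto simp: ktuple_def)
    have g1: "ktuple k (g(i := h1))" and g2: "ktuple k (g(i := h2))"
      and g3: "ktuple k (g(i := (\<lambda>x. a * h1 x + b * h2 x)))"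
      by (rule ktuple_upd[OF g i h(1)] ktuple_upd[OF g i h(2)] ktuple_upd[OF g i liploc_linear[OF h]])+
    note b = bborel_c_indicator[OF f Y]
    have AEeq: "AE x in m. (indicator Y x * f x) * H (g(i := (\<lambda>x. a * h1 x + b * h2 x))) x
       = a * ((indicator Y x * f x) * H (g(i := h1)) x) + b * ((indicator Y x * f x) * H (g(i := h2)) x)"
      using H_linear[OF g i h, of a b] by eventually_elim (simp add: algebra_simps)
    have "current_ext k T (\<lambda>x. indicator Y x * f x) (g(i := (\<lambda>x. a * h1 x + b * h2 x)))
       = (\<integral>x. a * ((indicator Y x * f x) * H (g(i := h1)) x) + b * ((indicator Y x * f x) * H (g(i := h2)) x) \<partial>m)"
      unfolding current_ext_eq[OF b g3]
    proof (rule integral_cong_AE[OF _ _ AEeq])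
      show "(\<lambda>x. indicator Y x * f x * H (g(i := \<lambda>x. a * h1 x + b * h2 x)) x) \<in> borel_measurable m"
        by (rule borel_measurable_integrable[OF int[OF f g3]])
      show "(\<lambda>x. a * (indicator Y x * f x * H (g(i := h1)) x) + b * (indicator Y x * f x * H (g(i := h2)) x)) \<in> borel_measurable m"
        using borel_measurable_integrable[OF int[OF f g1]] borel_measurable_integrable[OF int[OF f g2]] by measurable
    qed
    also have "\<dots> = a * current_ext k T (\<lambda>x. indicator Y x * f x) (g(i := h1)) + b * current_ext k T (\<lambda>x. indicator Y x * f x) (g(i := h2))"
      unfolding current_ext_eq[OF b g1] current_ext_eq[OF b g2] using int[OF f g1] int[OF f g2] by simp
    finally show "current_ext k T (\<lambda>x. indicator Y x * f x) (g(i := (\<lambda>x. a * h1 x + b * h2 x)))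
       = a * current_ext k T (\<lambda>x. indicator Y x * f x) (g(i := h1)) + b * current_ext k T (\<lambda>x. indicator Y x * f x) (g(i := h2))" .
  }
qed

text \<open>The exhaustion makes \<mu> sigma-finite, so a density exists; sigma-finiteness of the
  mass makes it finite almost everywhere, hence replaceable by a real function.\<close>

lemma mass_real_density:
  assumes mu: "sets \<mu> = sets borel" and fin: "\<forall>K. compact K \<longrightarrow> emeasure \<mu> K < \<infinity>"
    and ac: "absolutely_continuous \<mu> m"
  obtains \<theta> :: "'a \<Rightarrow> real" where "\<theta> \<in> borel_measurable \<mu>" "\<And>x. 0 \<le> \<theta> x" "m = density \<mu> (\<lambda>x. ennreal (\<theta> x))"
proof -
  have sp: "space \<mu> = UNIV" using sets_eq_imp_space_eq[OF mu] by simp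
  interpret sigma_finite_measure \<mu>
  proof
    have "emeasure \<mu> (V j) < \<infinity>" for j
    proof -
      obtain K where K: "compact K" "V j \<subseteq> K" using V_compact by blast
      then have "emeasure \<mu> (V j) \<le> emeasure \<mu> K" by (intro emeasure_mono) (auto simp: mu borel_compact)
      then show ?thesis using fin K(1) le_less_trans by blast
    qed
    then have "countable (range V) \<and> range V \<subseteq> sets \<mu> \<and> \<Union> (range V) = space \<mu> \<and> (\<forall>a\<in>range V. emeasure \<mu> a \<noteq> \<infinity>)"
      using V_cover by (auto simp: mu sp less_top)
    then show "\<exists>A. countable A \<and> A \<subseteq> sets \<mu> \<and> \<Union> A = space \<mu> \<and> (\<forall>a\<in>A. emeasure \<mu> a \<noteq> \<infinity>)" by blast
  qed
  obtain \<rho> where \<rho> [measurable]: "\<rho> \<in> borel_measurable \<mu>" and d: "density \<mu> \<rho> = m"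
    using Radon_Nikodym[OF ac] mu by auto
  have "AE x in \<mu>. \<rho> x \<noteq> \<infinity>"
    using sigma_finite_iff_density_finite[OF \<rho>] sigma_finite_mass d by simp
  then have "AE x in \<mu>. ennreal (enn2real (\<rho> x)) = \<rho> x" by eventually_elim (simp add: less_top)
  then have "density \<mu> (\<lambda>x. ennreal (enn2real (\<rho> x))) = m" using d by (subst density_cong[of _ _ \<rho>]) auto
  then show ?thesis using that[of "\<lambda>x. enn2real (\<rho> x)"] by auto
qed

lemma precurrent_current_ext:
  fixes \<mu> :: "'a measure"
  assumes D: "countable (D :: 'a set)" "closure D = UNIV"
    and mu: "sets \<mu> = sets borel" and fin: "\<forall>K. compact K \<longrightarrow> emeasure \<mu> K < \<infinity>"
    and ac: "absolutely_continuous \<mu> m"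
  shows "precurrent \<mu> k (current_ext k T)"
  unfolding precurrent_def
proof (intro allI impI)
  fix Y \<pi> n assume patch: "coord_patch \<mu> Y \<pi> n"
  have sp: "space \<mu> = UNIV" using sets_eq_imp_space_eq[OF mu] by simp
  have Y [measurable]: "Y \<in> sets borel" using patch mu unfolding coord_patch_def by simp
  have [measurable_cong]: "sets \<mu> = sets borel" by (rule mu)
  obtain C where C: "\<And>x y. x \<in> Y \<Longrightarrow> y \<in> Y \<Longrightarrow> eucl_dist n (\<pi> x) (\<pi> y) \<le> C * dist x y"
    using patch unfolding coord_patch_def by blast
  \<comment> \<open>C may be negative when Y has at most one point.\<close>
  define c where "c = max C 0"
  have c: "0 \<le> c" by (simp add: c_def)
  have pi_lip: "c-lipschitz_on Y (\<lambda>x. \<pi> x i)" if "i < n" for i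
  proof (rule lipschitz_onI[OF _ c])
    fix x y assume xy: "x \<in> Y" "y \<in> Y"
    have "\<bar>\<pi> x i - \<pi> y i\<bar> \<le> eucl_dist n (\<pi> x) (\<pi> y)"
      unfolding eucl_dist_def using that
      by (intro real_le_rsqrt) (simp, intro member_le_sum[of i "{..<n}" "\<lambda>i. (\<pi> x i - \<pi> y i)\<^sup>2"], auto)
    also have "\<dots> \<le> c * dist x y" using C[OF xy] mult_right_mono[of C c "dist x y"] by (simp add: c_def)
    finally show "dist (\<pi> x i) (\<pi> y i) \<le> c * dist x y" by (simp add: dist_real_def)
  qed
  \<comment> \<open>The coordinates are Lipschitz on Y only, whereas the entries of a tuple have to
    be locally Lipschitz on all of X.\<close>
  have "\<forall>i\<in>{..<n}. \<exists>u. c-lipschitz_on UNIV u \<and> (\<forall>x\<in>Y. u x = \<pi> x i)"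
  proof
    fix i assume "i \<in> {..<n}"
    then show "\<exists>u. c-lipschitz_on UNIV u \<and> (\<forall>x\<in>Y. u x = \<pi> x i)"
      using lipschitz_extension_real[OF pi_lip[of i]] by (metis lessThan_iff)
  qed
  from bchoice[OF this] obtain p where p: "\<And>i. i < n \<Longrightarrow> c-lipschitz_on UNIV (p i)"
    "\<And>i x. i < n \<Longrightarrow> x \<in> Y \<Longrightarrow> p i x = \<pi> x i" by auto
  obtain \<theta> :: "'a \<Rightarrow> real" where \<theta>_mu: "\<theta> \<in> borel_measurable \<mu>" and \<theta>0: "\<And>x. 0 \<le> \<theta> x"
    and dens: "m = density \<mu> (\<lambda>x. ennreal (\<theta> x))"
    using mass_real_density[OF mu fin ac] by blast
  have \<theta> [measurable]: "\<theta> \<in> borel_measurable borel" using \<theta>_mu mu by (simp cong: measurable_cong_sets)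
  have int_m: "(\<integral>x. u x \<partial>m) = (\<integral>x. \<theta> x * u x \<partial>\<mu>)" if "u \<in> borel_measurable borel" for u :: "'a \<Rightarrow> real"
    unfolding dens by (subst integral_density) (use that \<theta>0 in auto)
  have integrable_m: "integrable m u \<longleftrightarrow> integrable \<mu> (\<lambda>x. \<theta> x * u x)" if "u \<in> borel_measurable borel" for u :: "'a \<Rightarrow> real"
    unfolding dens by (subst integrable_density) (use that \<theta>0 in auto)
  define h where "h I = H (coord_tuple k p (\<lambda>b. sorted_list_of_set I ! b))" for I
  \<comment> \<open>The coefficient at I: the density of the coordinate tuple of I with respect to
    the mass, times the density \<theta> of the mass with respect to \<mu>.\<close>
  define lam where "lam y I = (if I \<subseteq> {..<n} \<and> card I = k then \<theta> y * h I y else 0)" for y I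
  have h_lbdd: "lbdd (h I)" if "I \<subseteq> {..<n}" "card I = k" for I
    unfolding h_def
  proof (rule H_lbdd, rule ktuple_coord_tuple[of n])
    show "liploc (p i)" if "i < n" for i by (rule liplocI[OF p(1)[OF that]])
    fix b assume b: "b < k"
    have "finite I" using that(1) finite_subset by blast
    then have "sorted_list_of_set I ! b \<in> I"
      using b that(2) by (metis length_sorted_list_of_set nth_mem set_sorted_list_of_set)
    then show "sorted_list_of_set I ! b < n" using that(1) by blast
  qed
  show "precurrent_on \<mu> k (\<lambda>\<beta> g. current_ext k T (\<lambda>x. indicator Y x * \<beta> x) g) Y \<pi> n"
    unfolding precurrent_on_def
  proof (intro conjI exI[of _ lam] allI impI)
    show "multilinear_on k bborel_c liploc (\<lambda>\<beta> g. current_ext k T (\<lambda>x. indicator Y x * \<beta> x) g)"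
      by (rule multilinear_current_ext[OF Y])
  next
    fix I :: "nat set" and K :: "'a set" assume K: "compact K"
    show "set_integrable \<mu> (Y \<inter> K) (\<lambda>y. lam y I)"
    proof (cases "I \<subseteq> {..<n} \<and> card I = k")
      case True
      have YK: "Y \<inter> K \<in> sets borel" using K by (intro sets.Int Y borel_compact)
      obtain j where j: "K \<subseteq> V j" by (rule compact_subset_V[OF K])
      have hl: "lbdd (h I)" using h_lbdd True by blast
      have "integrable m (\<lambda>x. indicator (Y \<inter> K) x * h I x)"
        using j YK by (intro lbdd_integrable[OF hl indicator_integrable]) (auto simp: indicator_def)
      then have "integrable \<mu> (\<lambda>x. \<theta> x * (indicator (Y \<inter> K) x * h I x))"
        using integrable_m[of "\<lambda>x. indicator (Y \<inter> K) x * h I x"] lbdd_measurable[OF hl] YK by simp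
      moreover have "(\<lambda>x. \<theta> x * (indicator (Y \<inter> K) x * h I x)) = (\<lambda>x. indicator (Y \<inter> K) x *\<^sub>R lam x I)"
        using True by (auto simp: lam_def fun_eq_iff)
      ultimately show ?thesis unfolding set_integrable_def by simp
    next
      case False
      then have "lam y I = 0" for y unfolding lam_def by (simp only: if_False)
      then show ?thesis unfolding set_integrable_def by simp
    qed
  next
    fix \<beta> :: "'a \<Rightarrow> real" and g :: "nat \<Rightarrow> 'a \<Rightarrow> real" assume bg: "bborel_c \<beta> \<and> ktuple k g"
    then have \<beta>: "bborel_c \<beta>" and g: "ktuple k g" by auto
    define w where "w a y = dpi Y \<pi> n (g a) y" for a y
    have lg: "liploc (g a)" if "a < k" for a using g that unfolding ktuple_def by blast
    have diff: "AE y in m. y \<in> Y \<longrightarrow>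
      ((\<lambda>x. (g a x - g a y - (\<Sum>i<n. w a y i * (p i x - p i y))) / dist x y) \<longlongrightarrow> 0) (at y within Y)" if a: "a < k" for a
    proof -
      obtain Yg where Yg: "Yg \<subseteq> Y" "Yg \<in> sets \<mu>" "emeasure \<mu> (Y - Yg) = 0" "\<And>y. y \<in> Yg \<Longrightarrow> \<exists>!w. is_pi_diff Y \<pi> n (g a) y w"
        using patch lg[OF a] unfolding coord_patch_def by meson
      have "Y - Yg \<in> null_sets \<mu>" using Yg(2,3) Y mu by (intro null_setsI) auto
      \<comment> \<open>Absolute continuity is decisive here: the exceptional set of the
        differential is null for \<mu>, while the chain rule works with the mass.\<close>
      then have "Y - Yg \<in> null_sets m" using ac unfolding absolutely_continuous_def by blast
      then have "AE y in m. y \<notin> Y - Yg" by (rule AE_not_in)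
      then show ?thesis
      proof eventually_elim
        case (elim y)
        show ?case
        proof
          assume y: "y \<in> Y"
          then have "y \<in> Yg" using elim by blast
          then have ex: "\<exists>!w. is_pi_diff Y \<pi> n (g a) y w" by (rule Yg(4))
          then have "is_pi_diff Y \<pi> n (g a) y (w a y)"
            unfolding w_def dpi_def using theI'[OF ex] by simp
          then have lim: "((\<lambda>x. (g a x - g a y - (\<Sum>i<n. w a y i * (\<pi> x i - \<pi> y i))) / dist x y) \<longlongrightarrow> 0) (at y within Y)"
            unfolding is_pi_diff_def by blast
          \<comment> \<open>The limit is taken within Y, where the extensions p agree with
            \<pi>.\<close>
          have "\<forall>\<^sub>F x in at y within Y. (g a x - g a y - (\<Sum>i<n. w a y i * (\<pi> x i - \<pi> y i))) / dist x y
              = (g a x - g a y - (\<Sum>i<n. w a y i * (p i x - p i y))) / dist x y"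
            unfolding eventually_at_filter using p(2) y by (intro always_eventually) simp
          then show "((\<lambda>x. (g a x - g a y - (\<Sum>i<n. w a y i * (p i x - p i y))) / dist x y) \<longlongrightarrow> 0) (at y within Y)"
            by (rule Lim_transform_eventually[OF lim])
        qed
      qed
    qed
    have "AE y in m. y \<in> Y \<longrightarrow> H g y = wedge_pair k n (\<lambda>a. w a y) (\<lambda>I. h I y)"
      unfolding h_def by (rule H_wedge_pair[OF D g p(1) c diff])
    \<comment> \<open>A statement almost everywhere for the mass transfers to \<mu> only where
      \<theta> > 0; where \<theta> = 0 both integrands below vanish.\<close>
    then have "AE y in \<mu>. 0 < ennreal (\<theta> y) \<longrightarrow> y \<in> Y \<longrightarrow> H g y = wedge_pair k n (\<lambda>a. w a y) (\<lambda>I. h I y)"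
      unfolding dens by (subst (asm) AE_density) (use \<theta>_mu in auto)
    then have AEeq: "AE y in \<mu>. \<theta> y * ((indicator Y y * \<beta> y) * H g y)
        = indicator Y y *\<^sub>R (\<beta> y * wedge_pair k n (\<lambda>a. w a y) (lam y))"
    proof eventually_elim
      case (elim y)
      have l: "wedge_pair k n (\<lambda>a. w a y) (lam y) = \<theta> y * wedge_pair k n (\<lambda>a. w a y) (\<lambda>I. h I y)"
        unfolding lam_def by (rule wedge_pair_scale)
      show ?case
      proof (cases "\<theta> y = 0 \<or> y \<notin> Y")
        case True
        then show ?thesis unfolding l by auto
      next
        case False
        then have "0 < ennreal (\<theta> y)" using \<theta>0[of y] by (simp add: less_le)
        then show ?thesis using elim False unfolding l by simp
      qed
    qed
    have m1: "(\<lambda>y. (indicator Y y * \<beta> y) * H g y) \<in> borel_measurable borel"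
      using \<beta> lbdd_measurable[OF H_lbdd[OF g]] by (auto simp: bborel_c_def)
    have m2: "(\<lambda>y. indicator Y y *\<^sub>R (\<beta> y * wedge_pair k n (\<lambda>a. w a y) (lam y))) \<in> borel_measurable \<mu>"
    proof -
      \<comment> \<open>A patch provides measurability of the differential after multiplication with
        the indicator of Y, so the indicator is inserted into the pairing; on Y it equals 1.\<close>
      have w_meas: "(\<lambda>y. indicator Y y * w a y i) \<in> borel_measurable \<mu>" if "a < k" "i < n" for a i
        using patch lg[OF that(1)] that(2) unfolding coord_patch_def w_def by blast
      have lam_meas: "(\<lambda>y. lam y I) \<in> borel_measurable \<mu>" if I: "I \<subseteq> {..<n}" "card I = k" for I
        using lbdd_measurable[OF h_lbdd[OF I]] I by (simp add: lam_def)
      have wp: "(\<lambda>y. wedge_pair k n (\<lambda>a i. indicator Y y * w a y i) (lam y)) \<in> borel_measurable \<mu>"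
        by (rule borel_measurable_wedge_pair[OF w_meas lam_meas])
      have "\<beta> \<in> borel_measurable borel" using \<beta> by (simp add: bborel_c_def)
      then have bm: "\<beta> \<in> borel_measurable \<mu>" using mu by (simp cong: measurable_cong_sets)
      have "(\<lambda>y. indicator Y y *\<^sub>R (\<beta> y * wedge_pair k n (\<lambda>a. w a y) (lam y)))
          = (\<lambda>y. indicator Y y *\<^sub>R (\<beta> y * wedge_pair k n (\<lambda>a i. indicator Y y * w a y i) (lam y)))"
      proof
        fix y
        show "indicator Y y *\<^sub>R (\<beta> y * wedge_pair k n (\<lambda>a. w a y) (lam y))
            = indicator Y y *\<^sub>R (\<beta> y * wedge_pair k n (\<lambda>a i. indicator Y y * w a y i) (lam y))"
          by (cases "y \<in> Y") auto
      qed
      then show ?thesis using wp bm by simp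
    qed
    have "current_ext k T (\<lambda>x. indicator Y x * \<beta> x) g = (\<integral>y. (indicator Y y * \<beta> y) * H g y \<partial>m)"
      by (rule current_ext_eq[OF bborel_c_indicator[OF \<beta> Y] g])
    also have "\<dots> = (\<integral>y. \<theta> y * ((indicator Y y * \<beta> y) * H g y) \<partial>\<mu>)" by (rule int_m[OF m1])
    also have "\<dots> = (\<integral>y. indicator Y y *\<^sub>R (\<beta> y * wedge_pair k n (\<lambda>a. w a y) (lam y)) \<partial>\<mu>)"
      by (rule integral_cong_AE[OF _ m2 AEeq]) (use m1 in measurable)
    finally show "current_ext k T (\<lambda>x. indicator Y x * \<beta> x) g
       = (\<integral>y\<in>Y. \<beta> y * wedge_pair k n (\<lambda>a. dpi Y \<pi> n (g a) y) (lam y) \<partial>\<mu>)"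
      unfolding set_lebesgue_integral_def w_def .
  qed
qed

end

theorem theorem1p3:
  fixes \<mu> :: "'a::metric_space measure"
    and k :: nat
    and T :: "('a \<Rightarrow> real) \<Rightarrow> (nat \<Rightarrow> 'a \<Rightarrow> real) \<Rightarrow> real"
  assumes separable: "\<exists>D :: 'a set. countable D \<and> closure D = UNIV"
    and loc_compact: "\<forall>x :: 'a. \<exists>U K. open U \<and> compact K \<and> x \<in> U \<and> U \<subseteq> K"
    and borel_mu: "sets \<mu> = sets borel"
    and loc_finite_mu: "\<forall>K. compact K \<longrightarrow> emeasure \<mu> K < \<infinity>"
    and diff_structure: "strong_mds \<mu>"
    and current: "metric_current k T"
    and lf_mass: "locally_finite_mass k T"
    and ac: "absolutely_continuous \<mu> (mass_measure k T)"
  shows "precurrent \<mu> k (current_ext k T)"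
proof -
  obtain D :: "'a set" where D: "countable D" "closure D = UNIV" using separable by blast
  obtain V :: "nat \<Rightarrow> 'a set" where V: "\<And>j. open (V j)" "incseq V" "\<And>j. \<exists>K. compact K \<and> V j \<subseteq> K" "(\<Union>j. V j) = UNIV"
    using relatively_compact_exhaustion[OF separable loc_compact] by blast
  interpret lf_current k T V
    by unfold_locales (use current lf_mass V in auto)
  show ?thesis by (rule precurrent_current_ext[OF D borel_mu loc_finite_mu ac])
qed

end
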